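(* Let $\Bbbk$ be an algebraically closed field of any characteristic. Let $X\subset\mathbb{P}^{n+e}_{\Bbbk}$ be a non-degenerate algebraic set of dimension $n$ satisfying property $\mathbf{N}_{d,p}$ with $d\ge2$ and $1\le p\le e$. Suppose that $L\subset\mathbb{P}^{n+e}$ is any linear subspace of dimension $p$ whose intersection with $X$ is zero-dimensional. Then: (a) $\operatorname{length}(L\cap X)\le\binom{d-1+p}{p}$. (b) Moreover, if $\operatorname{length}(L\cap X)=\binom{d-1+p}{p}$, then for every $1\le k\le d-1$ the base locus of the linear system $|H^0(\mathcal{I}_{X/\mathbb{P}^{n+e}}(k))|$ contains $L$.
   Context: An algebraic set is a reduced closed subscheme of projective space, possibly reducible. $X$ is non-degenerate if it is not contained in any hyperplane. Let $R=\Bbbk[x_0,\dots,x_{n+e}]$ and $I_X=\bigoplus_{m\ge0}H^0(\mathcal{I}_{X/\mathbb{P}^{n+e}}(m))\subset R$. $X$ satisfies property $\mathbf{N}_{d,p}$ ($d\ge2$, $p\ge1$) if $\beta_{i,j}(X):=\dim_{\Bbbk}\operatorname{Tor}^R_i(R/I_X,\Bbbk)_{i+j}=0$ for all $i\le p$ and all $j\ge d$. The intersection $L\cap X$ is the scheme-theoretic intersection. The base locus of $|H^0(\mathcal{I}_{X/\mathbb{P}^{n+e}}(k))|$ is the common zero locus in $\mathbb{P}^{n+e}$ of all forms of degree $k$ in $I_X$ (all of $\mathbb{P}^{n+e}$ if there are none). *)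

theory Defs
  imports
    "HOL-Analysis.Cartesian_Space"
    "HOL-Library.Poly_Mapping"
    "HOL-Library.Function_Algebras"
    "HOL-Library.Extended_Nat"
    "HOL-Computational_Algebra.Polynomial"
    "HOL-Computational_Algebra.Fraction_Field"
begin

section \<open>The polynomial ring\<close>

text \<open>
  The variables of \<open>R\<close> are indexed by a finite type \<open>'v\<close>, so that \<open>n + e + 1\<close> is \<open>CARD('v)\<close>.
  The linear order on \<open>'v\<close> is needed only for the type class instance saying that \<open>R\<close> is an
  integral domain.
\<close>

type_synonym ('v, 'k) mpoly = "('v \<Rightarrow>\<^sub>0 nat) \<Rightarrow>\<^sub>0 'k"

definition mon_degree :: "('v::finite \<Rightarrow>\<^sub>0 nat) \<Rightarrow> nat" where
  "mon_degree a = (\<Sum>i\<in>UNIV. Poly_Mapping.lookup a i)"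

definition eval_poly :: "('v::finite, 'k::comm_ring_1) mpoly \<Rightarrow> 'k ^ 'v \<Rightarrow> 'k" where
  "eval_poly f x =
     (\<Sum>a\<in>Poly_Mapping.keys f. Poly_Mapping.lookup f a * (\<Prod>i\<in>UNIV. (x $ i) ^ Poly_Mapping.lookup a i))"

text \<open>The zero polynomial is a form of every degree.\<close>

definition is_form :: "nat \<Rightarrow> ('v::finite, 'k::zero) mpoly \<Rightarrow> bool" where
  "is_form m f \<longleftrightarrow> (\<forall>a\<in>Poly_Mapping.keys f. mon_degree a = m)"

section \<open>Projective space and algebraic sets\<close>

text \<open>
  A point of projective space is a line through the origin of the affine space \<open>'k ^ 'v\<close>. Over an
  algebraically closed field, a reduced closed subscheme of projective space is the same thing as
  a Zariski closed set of such points.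
\<close>

definition proj_space :: "('k::field ^ 'v::finite) set set" where
  "proj_space = {P. vec.subspace P \<and> vec.dim P = 1}"

definition vanishes_at :: "('v::finite, 'k::field) mpoly \<Rightarrow> ('k ^ 'v) set \<Rightarrow> bool" where
  "vanishes_at f P \<longleftrightarrow> (\<forall>x\<in>P. eval_poly f x = 0)"

definition zero_locus :: "('v::finite, 'k::field) mpoly set \<Rightarrow> ('k ^ 'v) set set" where
  "zero_locus S = {P \<in> proj_space. \<forall>f\<in>S. vanishes_at f P}"

definition algebraic_set :: "('k::field ^ 'v::finite) set set \<Rightarrow> bool" where
  "algebraic_set X \<longleftrightarrow> (\<exists>S. (\<forall>f\<in>S. \<exists>m. is_form m f) \<and> X = zero_locus S)"

definition linear_subspace :: "nat \<Rightarrow> ('k::field ^ 'v::finite) set set \<Rightarrow> bool" where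
  "linear_subspace r L \<longleftrightarrow>
     (\<exists>V. vec.subspace V \<and> vec.dim V = r + 1 \<and> L = {P \<in> proj_space. P \<subseteq> V})"

definition nondegenerate :: "('k::field ^ 'v::finite) set set \<Rightarrow> bool" where
  "nondegenerate X \<longleftrightarrow> \<not> (\<exists>H r. r + 2 = CARD('v) \<and> linear_subspace r H \<and> X \<subseteq> H)"

definition irreducible_set :: "('k::field ^ 'v::finite) set set \<Rightarrow> bool" where
  "irreducible_set Z \<longleftrightarrow> algebraic_set Z \<and> Z \<noteq> {} \<and>
     (\<forall>A B. algebraic_set A \<and> algebraic_set B \<and> Z = A \<union> B \<longrightarrow> Z = A \<or> Z = B)"

definition irreducible_chain ::
    "('k::field ^ 'v::finite) set set \<Rightarrow> nat \<Rightarrow> (nat \<Rightarrow> ('k ^ 'v) set set) \<Rightarrow> bool" where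
  "irreducible_chain X m C \<longleftrightarrow>
     (\<forall>i\<le>m. irreducible_set (C i) \<and> C i \<subseteq> X) \<and> (\<forall>i<m. C i \<subset> C (Suc i))"

text \<open>
  Krull dimension of the underlying topological space. The empty set has no dimension in the
  sense of this predicate.
\<close>

definition has_dimension :: "('k::field ^ 'v::finite) set set \<Rightarrow> nat \<Rightarrow> bool" where
  "has_dimension X m \<longleftrightarrow>
     (\<exists>C. irreducible_chain X m C) \<and> (\<forall>l C. irreducible_chain X l C \<longrightarrow> l \<le> m)"

section \<open>Homogeneous ideals and base loci\<close>

text \<open>\<open>H\<^sup>0\<close> of the \<open>m\<close>-th twist of the ideal sheaf of the reduced scheme \<open>X\<close>.\<close>

definition ideal_forms :: "('k::field ^ 'v::finite) set set \<Rightarrow> nat \<Rightarrow> ('v, 'k) mpoly set" where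
  "ideal_forms X m = {f. is_form m f \<and> (\<forall>P\<in>X. vanishes_at f P)}"

definition ideal_of :: "('k::field ^ 'v::finite) set set \<Rightarrow> ('v, 'k) mpoly set" where
  "ideal_of X = {(\<Sum>m<N. h m) | h N. \<forall>m. h m \<in> ideal_forms X m}"

definition base_locus :: "('k::field ^ 'v::finite) set set \<Rightarrow> nat \<Rightarrow> ('k ^ 'v) set set" where
  "base_locus X k = zero_locus (ideal_forms X k)"

text \<open>A homogeneous ideal defining the scheme-theoretic intersection of \<open>X\<close> and \<open>Y\<close>.\<close>

definition intersection_ideal ::
    "('k::field ^ 'v::finite) set set \<Rightarrow> ('k ^ 'v) set set \<Rightarrow> ('v, 'k) mpoly set" where
  "intersection_ideal X Y = {f + g | f g. f \<in> ideal_of X \<and> g \<in> ideal_of Y}"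

section \<open>Length of a scheme\<close>

text \<open>
  The local ring of projective space at \<open>P\<close>, inside the fraction field of \<open>R\<close>, and the stalk at
  \<open>P\<close> of the ideal sheaf associated with a homogeneous ideal \<open>J\<close>.
\<close>

definition local_ring ::
    "('k::field ^ 'v::{finite,linorder}) set \<Rightarrow> ('v, 'k) mpoly fract set" where
  "local_ring P =
     {Fract f g | f g m. is_form m f \<and> is_form m g \<and> \<not> vanishes_at g P}"

definition ideal_stalk ::
    "('v, 'k) mpoly set \<Rightarrow> ('k::field ^ 'v::{finite,linorder}) set \<Rightarrow> ('v, 'k) mpoly fract set"
  where
  "ideal_stalk J P =
     {Fract f g | f g m. f \<in> J \<and> is_form m f \<and> is_form m g \<and> \<not> vanishes_at g P}"

definition is_ideal_in :: "'a::comm_ring_1 set \<Rightarrow> 'a set \<Rightarrow> bool" where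
  "is_ideal_in A M \<longleftrightarrow> M \<subseteq> A \<and> 0 \<in> M \<and> (\<forall>u\<in>M. \<forall>v\<in>M. u + v \<in> M) \<and> (\<forall>a\<in>A. \<forall>u\<in>M. a * u \<in> M)"

text \<open>
  The length of the quotient ring \<open>A/Q\<close> as a module over itself: its submodules correspond to
  the ideals of \<open>A\<close> containing \<open>Q\<close>.
\<close>

definition quotient_length :: "'a::comm_ring_1 set \<Rightarrow> 'a set \<Rightarrow> enat" where
  "quotient_length A Q = Sup (enat ` {l. \<exists>M.
     (\<forall>i\<le>l. is_ideal_in A (M i) \<and> Q \<subseteq> M i) \<and> (\<forall>i<l. M i \<subset> M (Suc i))})"

text \<open>
  The sum of the lengths of the local rings of the closed subscheme defined by \<open>J\<close> over all its
  points. For a zero-dimensional scheme only finitely many points contribute; taking the supremum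
  of the finite partial sums avoids the convention that sums over infinite sets are zero.
\<close>

definition scheme_length :: "('v::{finite,linorder}, 'k::field) mpoly set \<Rightarrow> enat" where
  "scheme_length J =
     (SUP T\<in>{T :: ('k, 'v) vec set set. finite T \<and> T \<subseteq> proj_space}.
        \<Sum>P\<in>T. quotient_length (local_ring P) (ideal_stalk J P))"

section \<open>Graded Betti numbers\<close>

text \<open>
  A sequence of graded free modules \<open>F\<^sub>i\<close> of finite rank with basis elements \<open>e\<^sub>k\<close>
  (\<open>k < rk F i\<close>) of degree \<open>bdeg F i k\<close>, and maps \<open>F\<^sub>i\<^sub>+\<^sub>1 \<rightarrow> F\<^sub>i\<close> where \<open>entry F i k l\<close> is the
  coefficient of \<open>e\<^sub>k\<close> in the image of \<open>e\<^sub>l\<close>. Elements of \<open>F\<^sub>i\<close> are coefficient functions on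
  \<open>nat\<close> that are zero outside \<open>{..<rk F i}\<close>.
\<close>

record (overloaded) ('v, 'k) graded_free_seq =
  rk :: "nat \<Rightarrow> nat"
  bdeg :: "nat \<Rightarrow> nat \<Rightarrow> nat"
  entry :: "nat \<Rightarrow> nat \<Rightarrow> nat \<Rightarrow> ('v, 'k) mpoly"

definition free_mod ::
    "('v, 'k::comm_ring_1) graded_free_seq \<Rightarrow> nat \<Rightarrow> (nat \<Rightarrow> ('v, 'k) mpoly) set" where
  "free_mod F i = {u. \<forall>k. rk F i \<le> k \<longrightarrow> u k = 0}"

definition bd ::
    "('v, 'k::comm_ring_1) graded_free_seq \<Rightarrow> nat \<Rightarrow> (nat \<Rightarrow> ('v, 'k) mpoly) \<Rightarrow> (nat \<Rightarrow> ('v, 'k) mpoly)"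
  where
  "bd F i u = (\<lambda>k. if k < rk F i then \<Sum>l<rk F (Suc i). entry F i k l * u l else 0)"

text \<open>
  A graded free resolution \<open>\<dots> \<rightarrow> F\<^sub>2 \<rightarrow> F\<^sub>1 \<rightarrow> F\<^sub>0 = R \<rightarrow> R/I \<rightarrow> 0\<close> with maps of degree zero. It need
  not be minimal.
\<close>

definition graded_free_resolution ::
    "('v::finite, 'k::comm_ring_1) graded_free_seq \<Rightarrow> ('v, 'k) mpoly set \<Rightarrow> bool" where
  "graded_free_resolution F I \<longleftrightarrow>
     rk F 0 = 1 \<and> bdeg F 0 0 = 0 \<and>
     (\<forall>i. \<forall>k<rk F i. \<forall>l<rk F (Suc i).
        if bdeg F i k \<le> bdeg F (Suc i) l
        then is_form (bdeg F (Suc i) l - bdeg F i k) (entry F i k l)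
        else entry F i k l = 0) \<and>
     (\<lambda>u. u 0) ` bd F 0 ` free_mod F 1 = I \<and>
     (\<forall>i. {u \<in> free_mod F (Suc i). bd F i u = 0} = bd F (Suc i) ` free_mod F (Suc (Suc i)))"

text \<open>
  The complex \<open>F \<otimes> \<Bbbk>\<close> with \<open>\<Bbbk> = R/(x\<^sub>0, x\<^sub>1, \<dots>)\<close>: tensoring replaces the matrix entries by their
  constant terms. \<open>tensor_piece F i t\<close> is the part of degree \<open>t\<close> of \<open>F\<^sub>i \<otimes> \<Bbbk>\<close>.
\<close>

definition tensor_piece :: "('v, 'k::field) graded_free_seq \<Rightarrow> nat \<Rightarrow> nat \<Rightarrow> (nat \<Rightarrow> 'k) set" where
  "tensor_piece F i t = {u. \<forall>k. \<not> (k < rk F i \<and> bdeg F i k = t) \<longrightarrow> u k = 0}"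

definition tensor_bd ::
    "('v, 'k::field) graded_free_seq \<Rightarrow> nat \<Rightarrow> (nat \<Rightarrow> 'k) \<Rightarrow> (nat \<Rightarrow> 'k)" where
  "tensor_bd F i u =
     (\<lambda>k. if k < rk F i then \<Sum>l<rk F (Suc i). Poly_Mapping.lookup (entry F i k l) 0 * u l else 0)"

definition tensor_cycles :: "('v, 'k::field) graded_free_seq \<Rightarrow> nat \<Rightarrow> nat \<Rightarrow> (nat \<Rightarrow> 'k) set" where
  "tensor_cycles F i t =
     {u \<in> tensor_piece F i t. case i of 0 \<Rightarrow> True | Suc i' \<Rightarrow> tensor_bd F i' u = 0}"

definition tensor_boundaries ::
    "('v, 'k::field) graded_free_seq \<Rightarrow> nat \<Rightarrow> nat \<Rightarrow> (nat \<Rightarrow> 'k) set" where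
  "tensor_boundaries F i t = tensor_bd F i ` tensor_piece F (Suc i) t"

interpretation coord: vector_space "\<lambda>(c::'k::field) (u::nat \<Rightarrow> 'k) k. c * u k"
  by unfold_locales (auto simp: fun_eq_iff algebra_simps)

text \<open>
  The dimension of the part of degree \<open>i + j\<close> of the \<open>i\<close>-th \<open>Tor\<close> of \<open>R/I\<close> and \<open>\<Bbbk>\<close>, where
  \<open>Tor\<close> is computed, as usual, from a chosen resolution of \<open>R/I\<close>; the result does not depend on
  the choice.
\<close>

definition betti :: "('v::finite, 'k::field) mpoly set \<Rightarrow> nat \<Rightarrow> nat \<Rightarrow> nat" where
  "betti I i j =
     (let F = (SOME F. graded_free_resolution F I)
      in coord.dim (tensor_cycles F i (i + j)) - coord.dim (tensor_boundaries F i (i + j)))"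

definition property_N :: "nat \<Rightarrow> nat \<Rightarrow> ('k::field ^ 'v::finite) set set \<Rightarrow> bool" where
  "property_N d p X \<longleftrightarrow> (\<forall>i\<le>p. \<forall>j\<ge>d. betti (ideal_of X) i j = 0)"

end

theory Submission
  imports Defs
begin

text \<open>
  Write \<open>L\<close> as the projectivization of \<open>V\<close>, and let \<open>J = I\<^sub>X + I\<^sub>L\<close>. The finite set \<open>L \<inter> X\<close> misses some hyperplane
  \<open>l = 0\<close>; put \<open>W = V \<inter> {l = 0}\<close>, a space of dimension \<open>p\<close> whose projectivization does not meet \<open>X\<close>. By the
  Nullstellensatz, \<open>I\<^sub>X\<close> and the forms vanishing on \<open>W\<close> generate all forms of large degree, so a free
  resolution \<open>F\<close> of \<open>R/I\<^sub>X\<close> restricted to a subspace of \<open>W\<close> has homology of finite length. Cutting \<open>W\<close> down to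
  \<open>0\<close> one hyperplane at a time, the connecting maps carry a class of top degree \<open>t\<close> in
  \<open>R/(I\<^sub>X + I(W))\<close> to a nonzero class of degree \<open>t + p\<close> in \<open>Tor\<^sub>p(R/I\<^sub>X, k)\<close>, so that \<open>t < d\<close>.

  Hence every form of degree \<open>t \<ge> d\<close> is congruent modulo \<open>J\<close> to \<open>l\<close> times a form of degree \<open>t - 1\<close>, and
  \<open>dim (R/J)\<^sub>t \<le> dim (R/J)\<^sub>d\<^sub>-\<^sub>1\<close> for \<open>t \<ge> d - 1\<close>. Chains of ideals in the local rings of the intersection
  scheme yield forms of one degree that are independent modulo \<open>J\<close>, which bounds the length by
  \<open>dim (R/J)\<^sub>d\<^sub>-\<^sub>1\<close>. This is at most the dimension \<open>(d - 1 + p) choose p\<close> of the space of forms of degree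
  \<open>d - 1\<close> on \<open>V\<close>, with equality only if no form of degree \<open>d - 1\<close> in \<open>J\<close> is nonzero on \<open>V\<close>.
\<close>

section \<open>Polynomials and forms\<close>

text \<open>A class of top degree can be chosen only if some degree is known beyond which homology
  vanishes, and the Nullstellensatz gives merely an ineffective one. Such a degree comes from a
  power of I_X that kills the homology; the sharp bound d results from descending induction on the
  degree. Each cut raises homological and internal degree by one, so internal degree t + p in the
  p-th Tor is the Betti number with i = p and j = t.

  \<open>betti\<close> selects its resolution by \<open>SOME\<close> and carries information only
  once a resolution is known to exist; hence the part on finite generation of graded submodules.

  Homology and R/J are never formed as quotients. Homology is a pair of submodules of F_j, and a
  bound on the dimension of (R/J)_t says that every family of more than \<open>card B\<close> forms
  of degree t is dependent modulo J.\<close>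

abbreviation "lookup \<equiv> Poly_Mapping.lookup"
abbreviation "keys \<equiv> Poly_Mapping.keys"
abbreviation "single \<equiv> Poly_Mapping.single"

definition Const :: "'k::zero \<Rightarrow> ('v, 'k) mpoly" where
  "Const c = single 0 c"

definition Var :: "'v \<Rightarrow> ('v, 'k::zero_neq_one) mpoly" where
  "Var i = single (single i 1) 1"

lemma Const_0 [simp]: "Const 0 = 0" and Const_1 [simp]: "Const 1 = 1"
  by (simp_all add: Const_def)

lemma Const_add: "Const (a + b) = Const a + Const b"
  by (simp add: Const_def single_add)

lemma Const_minus: "Const (- a) = - Const (a::'k::ring_1)"
  by (simp add: Const_def single_uminus)

lemma Const_mult: "Const (a * b) = Const a * Const (b::'k::comm_ring_1)"
  by (simp add: Const_def mult_single)

lemma mon_degree_0 [simp]: "mon_degree 0 = 0"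
  by (simp add: mon_degree_def)

lemma mon_degree_add: "mon_degree (a + b) = mon_degree a + mon_degree b"
  by (simp add: mon_degree_def lookup_add sum.distrib)

lemma mon_degree_single [simp]: "mon_degree (single i n) = n"
  by (simp add: mon_degree_def lookup_single when_def)

lemma mon_degree_eq_0_iff: "mon_degree a = 0 \<longleftrightarrow> a = 0"
  by (auto simp: mon_degree_def intro: poly_mapping_eqI)

lemma mon_split_Suc:
  assumes "mon_degree a = Suc t"
  obtains i b where "a = single i 1 + b" "mon_degree b = t"
proof -
  have "a \<noteq> 0" using assms by auto
  then obtain i where i: "lookup a i \<noteq> 0" by (metis poly_mapping_eqI lookup_zero)
  define b where "b = a - single i 1"
  have "a = single i 1 + b"
    by (rule poly_mapping_eqI)
      (use i in \<open>auto simp: b_def lookup_add lookup_minus lookup_single when_def\<close>)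
  then show ?thesis using that assms by (metis mon_degree_add mon_degree_single plus_1_eq_Suc nat.inject)
qed

lemma single_add_eq_mult:
  "single (a + b) c = single a 1 * single b (c::'k::comm_ring_1)"
  by (simp add: mult_single)

lemma finite_mon_degree_le: "finite {a::'v::finite \<Rightarrow>\<^sub>0 nat. mon_degree a \<le> t}"
proof -
  have le: "lookup a i \<le> mon_degree a" for a :: "'v \<Rightarrow>\<^sub>0 nat" and i
    unfolding mon_degree_def by (rule member_le_sum) auto
  have "lookup ` {a::'v \<Rightarrow>\<^sub>0 nat. mon_degree a \<le> t} \<subseteq> {f. \<forall>i. (i \<in> UNIV \<longrightarrow> f i \<in> {..t}) \<and> (i \<notin> UNIV \<longrightarrow> f i = 0)}"
    by (force intro: order_trans[OF le])
  then have "finite (lookup ` {a::'v \<Rightarrow>\<^sub>0 nat. mon_degree a \<le> t})"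
    by (rule finite_subset) (rule finite_set_of_finite_funs; simp)
  then show ?thesis
    by (rule finite_imageD) (auto intro: inj_onI poly_mapping_eqI)
qed

lemma mpoly_monomial_sum:
  "f = (\<Sum>a\<in>keys f. single a (lookup f a))"
  by (rule poly_mapping_eqI)
    (auto simp: lookup_sum lookup_single when_def in_keys_iff sum.delta' cong: if_cong)

lemma monomial_induct:
  fixes P :: "nat \<Rightarrow> ('v::finite, 'k::comm_ring_1) mpoly \<Rightarrow> bool"
  assumes C: "\<And>c. P 0 (Const c)"
    and V: "\<And>t i f. is_form t f \<Longrightarrow> P t f \<Longrightarrow> P (Suc t) (Var i * f)"
  shows "P (mon_degree a) (single a c)"
proof (induction "mon_degree a" arbitrary: a)
  case 0
  then have "a = 0" by (simp add: mon_degree_eq_0_iff)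
  then show ?case using C by (simp add: Const_def)
next
  case (Suc t)
  from Suc(2) obtain i b where ib: "a = single i 1 + b" "mon_degree b = t"
    by (metis mon_split_Suc)
  have "is_form t (single b c)" using ib by (simp add: is_form_def)
  moreover have "P t (single b c)" using Suc(1)[of b] ib by simp
  ultimately have "P (Suc t) (Var i * single b c)" by (rule V)
  then show ?case using ib Suc(2)[symmetric] by (simp add: Var_def single_add_eq_mult)
qed

lemma form_induct [consumes 1, case_names Const zero add Var]:
  fixes P :: "nat \<Rightarrow> ('v::finite, 'k::comm_ring_1) mpoly \<Rightarrow> bool"
  assumes "is_form t f"
    and "\<And>c. P 0 (Const c)"
    and "\<And>t. P t 0"
    and "\<And>t f g. P t f \<Longrightarrow> P t g \<Longrightarrow> P t (f + g)"
    and "\<And>t i f. is_form t f \<Longrightarrow> P t f \<Longrightarrow> P (Suc t) (Var i * f)"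
  shows "P t f"
proof -
  have m: "P t (single a (lookup f a))" if "a \<in> keys f" for a
    using monomial_induct[of P a, OF assms(2,5)] assms(1) that by (auto simp: is_form_def)
  have "P t (\<Sum>a\<in>A. single a (lookup f a))"
    if "A \<subseteq> keys f" for A
    using finite_subset[OF that finite_keys] that
    by (induction rule: finite_induct) (auto intro: assms(3,4) m)
  then show ?thesis using mpoly_monomial_sum[of f] by (metis subset_refl)
qed

lemma mpoly_induct [case_names Const add Var]:
  fixes P :: "('v::finite, 'k::comm_ring_1) mpoly \<Rightarrow> bool"
  assumes "\<And>c. P (Const c)"
    and "\<And>f g. P f \<Longrightarrow> P g \<Longrightarrow> P (f + g)"
    and "\<And>i f. P f \<Longrightarrow> P (Var i * f)"
  shows "P f"
proof -
  have m: "P (single a c)" for a c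
    using monomial_induct[of "\<lambda>_. P" a c] assms(1,3) by blast
  have "P (\<Sum>a\<in>A. single a (lookup f a))" if "finite A" for A
    using that by (induction rule: finite_induct) (auto intro: assms(2) m simp: assms(1)[of 0, simplified])
  then show ?thesis using mpoly_monomial_sum[of f] by (metis finite_keys)
qed

lemma eval_poly_superset:
  assumes "finite A" "keys f \<subseteq> A"
  shows "eval_poly f x = (\<Sum>a\<in>A. lookup f a * (\<Prod>i\<in>UNIV. (x $ i) ^ lookup a i))"
  unfolding eval_poly_def by (rule sum.mono_neutral_left) (use assms in \<open>auto simp: in_keys_iff\<close>)

lemma eval_add [simp]: "eval_poly (f + g) x = eval_poly f x + eval_poly g x"
proof -
  let ?A = "keys f \<union> keys g"
  have "keys (f + g) \<subseteq> ?A" by (rule keys_add)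
  then show ?thesis
    by (simp add: eval_poly_superset[of ?A] lookup_add sum.distrib algebra_simps)
qed

lemma eval_0 [simp]: "eval_poly 0 x = 0"
  by (simp add: eval_poly_def)

lemma eval_uminus [simp]: "eval_poly (- f) x = - eval_poly f x"
  using eval_add[of f "- f" x] by (simp add: eq_neg_iff_add_eq_0 add.commute del: eval_add)

lemma eval_diff [simp]: "eval_poly (f - g) x = eval_poly f x - eval_poly g x"
  using eval_add[of f "- g" x] by simp

lemma eval_sum [simp]: "eval_poly (sum f A) x = (\<Sum>a\<in>A. eval_poly (f a) x)"
  by (induction A rule: infinite_finite_induct) auto

lemma eval_single: "eval_poly (single a c) x = c * (\<Prod>i\<in>UNIV. (x $ i) ^ lookup a i)"
  by (cases "c = 0") (simp_all add: eval_poly_def)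

lemma eval_mult [simp]: "eval_poly (f * g) x = eval_poly f x * eval_poly g x"
proof -
  have s: "eval_poly (single a c * single b d) x
      = eval_poly (single a c) x * eval_poly (single b d) x" for a b c d
    by (simp add: mult_single eval_single lookup_add power_add prod.distrib algebra_simps)
  have "f * g = (\<Sum>a\<in>keys f. single a (lookup f a)) *
      (\<Sum>b\<in>keys g. single b (lookup g b))"
    using mpoly_monomial_sum[of f] mpoly_monomial_sum[of g] by simp
  then have "eval_poly (f * g) x = eval_poly (\<Sum>a\<in>keys f. single a (lookup f a)) x *
      eval_poly (\<Sum>b\<in>keys g. single b (lookup g b)) x"
    by (simp add: sum_product s)
  then show ?thesis using mpoly_monomial_sum[of f] mpoly_monomial_sum[of g] by metis
qed

lemma eval_Const [simp]: "eval_poly (Const c) x = c"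
  by (simp add: Const_def eval_single)

lemma eval_1 [simp]: "eval_poly 1 x = 1"
  using eval_Const[of 1 x] by simp

lemma eval_Var [simp]: "eval_poly (Var i) x = x $ i"
proof -
  have "(\<Prod>j\<in>UNIV. (x $ j) ^ lookup (single i (1::nat)) j)
     = (\<Prod>j\<in>UNIV. if j = i then x $ i else 1)"
    by (rule prod.cong) (auto simp: lookup_single when_def)
  then show ?thesis by (simp add: Var_def eval_single)
qed

lemma eval_power [simp]: "eval_poly (f ^ n) x = eval_poly f x ^ n"
  by (induction n) auto

lemma eval_at_0:
  fixes f :: "('v::finite, 'k::comm_ring_1) mpoly"
  shows "eval_poly f 0 = lookup f 0"
proof (induction f rule: mpoly_induct)
  case (Const c)
  show ?case by (simp add: Const_def eval_single)
next
  case (add f g)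
  then show ?case by (simp add: lookup_add)
next
  case (Var i f)
  have "lookup (Var i * f) 0 = 0"
  proof (rule ccontr)
    assume "\<not> ?thesis"
    then have "0 \<in> keys (Var i * f)" by (simp add: in_keys_iff)
    then obtain a b where "a \<in> keys (Var i :: ('v, 'k) mpoly)" "0 = a + b"
      using keys_mult by blast
    then have "0 = single i (1::nat) + b" by (simp add: Var_def)
    then have "mon_degree (single i (1::nat) + b) = 0" by simp
    then show False by (simp add: mon_degree_add)
  qed
  then show ?case by simp
qed

lemma is_form_0 [simp]: "is_form t 0"
  by (simp add: is_form_def)

lemma is_form_add: "is_form t f \<Longrightarrow> is_form t g \<Longrightarrow> is_form t (f + g)"
  using keys_add[of f g] by (auto simp: is_form_def)

lemma is_form_uminus: "is_form t (f::('v::finite, 'k::comm_ring_1) mpoly) \<Longrightarrow> is_form t (- f)"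
  by (auto simp: is_form_def in_keys_iff)

lemma is_form_diff: "is_form t (f::('v::finite, 'k::comm_ring_1) mpoly) \<Longrightarrow> is_form t g \<Longrightarrow> is_form t (f - g)"
  using is_form_add[of t f "- g"] is_form_uminus[of t g] by simp

lemma is_form_sum: "(\<And>a. a \<in> A \<Longrightarrow> is_form t (f a)) \<Longrightarrow> is_form t (sum f A)"
  by (induction A rule: infinite_finite_induct) (auto intro: is_form_add)

lemma is_form_mult:
  "is_form s f \<Longrightarrow> is_form t g \<Longrightarrow> is_form (s + t) (f * (g::('v::finite, 'k::comm_ring_1) mpoly))"
  using keys_mult[of f g] by (auto simp: is_form_def mon_degree_add)

lemma is_form_Const [simp]: "is_form 0 (Const c)"
  by (simp add: is_form_def Const_def)

lemma is_form_1 [simp]: "is_form 0 (1::('v::finite, 'k::comm_ring_1) mpoly)"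
  by (simp add: is_form_def)

lemma is_form_Var [simp]: "is_form 1 (Var i)" "is_form (Suc 0) (Var i)"
  by (simp_all add: is_form_def Var_def)

lemma is_form_Const_mult: "is_form t f \<Longrightarrow> is_form t (Const c * (f::('v::finite, 'k::comm_ring_1) mpoly))"
  using is_form_mult[of 0 "Const c" t f] by simp

lemma is_form_power:
  "is_form 1 (f::('v::finite, 'k::comm_ring_1) mpoly) \<Longrightarrow> is_form n (f ^ n)"
  by (induction n) (auto dest: is_form_mult)

section \<open>Homogeneous components\<close>

definition hcomp :: "nat \<Rightarrow> ('v::finite, 'k::comm_ring_1) mpoly \<Rightarrow> ('v, 'k) mpoly" where
  "hcomp t f = (\<Sum>a\<in>{a\<in>keys f. mon_degree a = t}. single a (lookup f a))"

lemma lookup_hcomp: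
  "lookup (hcomp t f) a = (if mon_degree a = t then lookup f a else 0)"
  by (auto simp: hcomp_def lookup_sum lookup_single when_def in_keys_iff sum.delta' cong: if_cong)

lemma hcomp_add: "hcomp t (f + g) = hcomp t f + hcomp t g"
  by (rule poly_mapping_eqI) (simp add: lookup_hcomp lookup_add)

lemma hcomp_0 [simp]: "hcomp t 0 = 0"
  by (rule poly_mapping_eqI) (simp add: lookup_hcomp)

lemma hcomp_diff: "hcomp t (f - g) = hcomp t f - hcomp t g"
  by (rule poly_mapping_eqI) (simp add: lookup_hcomp lookup_minus)

lemma hcomp_sum: "hcomp t (sum f A) = (\<Sum>a\<in>A. hcomp t (f a))"
  by (induction A rule: infinite_finite_induct) (auto simp: hcomp_add)

lemma is_form_hcomp [simp]: "is_form t (hcomp t f)"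
  by (auto simp: is_form_def in_keys_iff lookup_hcomp split: if_splits)

lemma hcomp_form: "is_form s f \<Longrightarrow> hcomp t f = (if s = t then f else 0)"
  by (rule poly_mapping_eqI) (auto simp: lookup_hcomp is_form_def in_keys_iff)

lemma hcomp_decomp: obtains N where "f = (\<Sum>t<N. hcomp t f)"
proof -
  define N where "N = Suc (Max (insert 0 (mon_degree ` keys f)))"
  have "lookup f a = 0" if "mon_degree a \<ge> N" for a
  proof (rule ccontr)
    assume "lookup f a \<noteq> 0"
    then have "mon_degree a \<le> Max (insert 0 (mon_degree ` keys f))"
      by (intro Max_ge) (auto simp: in_keys_iff)
    then show False using that by (simp add: N_def)
  qed
  then have "f = (\<Sum>t<N. hcomp t f)"
    by (intro poly_mapping_eqI) (auto simp: lookup_sum lookup_hcomp not_less)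
  then show ?thesis by (rule that)
qed

lemma hcomp_mult_form:
  assumes "is_form s g"
  shows "hcomp t (g * f) = (if s \<le> t then g * hcomp (t - s) f else 0)"
proof -
  obtain N where N: "f = (\<Sum>u<N. hcomp u f)" by (rule hcomp_decomp)
  have h: "hcomp t (g * hcomp u f) = (if s + u = t then g * hcomp u f else 0)" for u
    using hcomp_form[OF is_form_mult[OF assms is_form_hcomp]] .
  have "hcomp t (g * f) = (\<Sum>u<N. if s + u = t then g * hcomp u f else 0)"
    by (subst N) (simp add: sum_distrib_left hcomp_sum h)
  also have "\<dots> = (if s \<le> t then g * hcomp (t - s) (\<Sum>u<N. hcomp u f) else 0)"
  proof (cases "s \<le> t")
    case True
    have "(\<Sum>u<N. if s + u = t then g * hcomp u f else 0) = (\<Sum>u<N. g * (if u = t - s then hcomp u f else 0))"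
      by (rule sum.cong) (use True in auto)
    also have "\<dots> = g * (\<Sum>u<N. hcomp (t - s) (hcomp u f))"
      by (simp add: hcomp_form[OF is_form_hcomp] sum_distrib_left[symmetric] del: sum.delta sum.delta')
    also have "\<dots> = g * hcomp (t - s) (\<Sum>u<N. hcomp u f)"
      by (simp add: hcomp_sum)
    finally show ?thesis using True by simp
  qed simp
  finally show ?thesis using N by simp
qed

lemma hcomp_form_mult:
  assumes "is_form s g"
  shows "hcomp t (f * g) = (if s \<le> t then hcomp (t - s) f * g else 0)"
  using hcomp_mult_form[OF assms, of t f] by (simp add: mult.commute)

text \<open>Every monomial of degree \<open>s + t\<close> is a product of monomials of degrees
  \<open>s\<close> and \<open>t\<close>. The rule reduces a claim about forms of high degree to
  products of two forms of prescribed degrees.\<close>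

lemma form_split:
  assumes "is_form (s + t) f" "0 \<in> U" "\<And>f g. f \<in> U \<Longrightarrow> g \<in> U \<Longrightarrow> f + g \<in> U"
    and "\<And>m g. is_form s m \<Longrightarrow> is_form t g \<Longrightarrow> m * g \<in> U"
  shows "(f::('v::finite, 'k::comm_ring_1) mpoly) \<in> U"
proof -
  have sp: "\<exists>b c. a = b + c \<and> mon_degree b = s \<and> mon_degree c = t" if "mon_degree a = s + t" for a :: "'v \<Rightarrow>\<^sub>0 nat"
    using that
  proof (induction s arbitrary: a)
    case 0
    then show ?case by (intro exI[of _ 0] exI[of _ a]) auto
  next
    case (Suc s)
    then obtain i b where ib: "a = single i 1 + b" "mon_degree b = s + t"
      by (metis mon_split_Suc add_Suc)
    with Suc.IH obtain b' c where "b = b' + c" "mon_degree b' = s" "mon_degree c = t" by blast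
    with ib show ?case
      by (intro exI[of _ "single i 1 + b'"] exI[of _ c]) (auto simp: mon_degree_add add.assoc)
  qed
  have m: "single a (lookup f a) \<in> U" if a: "a \<in> keys f" for a
  proof -
    obtain b c where "a = b + c" "mon_degree b = s" "mon_degree c = t"
      using sp[of a] assms(1) a by (auto simp: is_form_def)
    moreover have "single b 1 * single c (lookup f a) \<in> U"
      by (rule assms(4)) (use calculation in \<open>auto simp: is_form_def\<close>)
    ultimately show ?thesis by (simp add: single_add_eq_mult)
  qed
  have "(\<Sum>a\<in>A. single a (lookup f a)) \<in> U"
    if "A \<subseteq> keys f" for A
    using finite_subset[OF that finite_keys] that
    by (induction rule: finite_induct) (auto intro: assms(2,3) m)
  then show ?thesis using mpoly_monomial_sum[of f] by (metis subset_refl)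
qed

lemma eval_scale:
  assumes "is_form t f"
  shows "eval_poly f (c *s x) = c ^ t * eval_poly f x"
  using assms
  by (induction rule: form_induct) (auto simp: algebra_simps)

section \<open>Polynomials vanishing on linear subspaces\<close>

lemma infinite_UNIV_alg_closed: "infinite (UNIV :: 'k::alg_closed_field set)"
proof
  assume fin: "finite (UNIV :: 'k set)"
  \<comment> \<open>Over a finite field this polynomial takes the value 1 everywhere, yet it has
    positive degree.\<close>
  define p :: "'k poly" where "p = (\<Prod>a\<in>UNIV. [:- a, 1:]) + 1"
  have "degree (\<Prod>a\<in>(UNIV :: 'k set). [:- a, 1:]) = card (UNIV :: 'k set)"
    by (subst degree_prod_eq_sum_degree) auto
  moreover have "card (UNIV :: 'k set) > 0" using fin by (simp add: card_gt_0_iff)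
  ultimately have "degree p > 0"
    unfolding p_def by (subst degree_add_eq_left) auto
  then obtain x where "poly p x = 0" using alg_closed_imp_poly_has_root by blast
  moreover have "poly (\<Prod>a\<in>(UNIV :: 'k set). [:- a, 1:]) x = 0"
    using fin by (simp add: poly_prod)
  ultimately show False by (simp add: p_def)
qed

lemma poly_cofinite_zero:
  fixes q :: "'k::alg_closed_field poly"
  assumes "finite S" "\<And>s. s \<notin> S \<Longrightarrow> poly q s = 0"
  shows "q = 0"
proof (rule ccontr)
  assume "q \<noteq> 0"
  then have "finite {s. poly q s = 0}" by (rule poly_roots_finite)
  then have "finite ({s. poly q s = 0} \<union> S)" using assms(1) by simp
  moreover have "{s. poly q s = 0} \<union> S = UNIV" using assms(2) by auto
  ultimately show False using infinite_UNIV_alg_closed by metis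
qed

text \<open>Induction on the variables in \<open>W\<close>. With all variables but \<open>i\<close>
  fixed, the sum is a univariate polynomial that vanishes on an infinite field; its coefficient at
  one exponent \<open>j\<close> is again such a sum, over \<open>W\<close>. The separation
  hypothesis survives because \<open>Aj\<close> fixes the exponent of \<open>i\<close>.\<close>

lemma monomials_independent:
  fixes c :: "('v::finite \<Rightarrow>\<^sub>0 nat) \<Rightarrow> 'k::alg_closed_field"
  assumes "finite W" "finite A"
    and "\<And>a b. a \<in> A \<Longrightarrow> b \<in> A \<Longrightarrow> (\<forall>i\<in>W. lookup a i = lookup b i) \<Longrightarrow> a = b"
    and "\<And>x::'k^'v. (\<Sum>a\<in>A. c a * (\<Prod>i\<in>W. (x $ i) ^ lookup a i)) = 0"
  shows "\<forall>a\<in>A. c a = 0"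
  using assms
proof (induction W arbitrary: A rule: finite_induct)
  case empty
  show ?case
  proof
    fix a assume a: "a \<in> A"
    then have "A = {a}" using empty.prems(2) by auto
    then show "c a = 0" using empty.prems(3)[of undefined] by simp
  qed
next
  case (insert i W)
  show ?case
  proof
    fix a0 assume a0: "a0 \<in> A"
    define j where "j = lookup a0 i"
    define Aj where "Aj = {a \<in> A. lookup a i = j}"
    have "\<forall>a\<in>Aj. c a = 0"
    proof (rule insert.IH)
      show "finite Aj" using insert.prems(1) by (simp add: Aj_def)
      show "a = b" if "a \<in> Aj" "b \<in> Aj" "\<forall>i\<in>W. lookup a i = lookup b i" for a b
        using that insert.prems(2)[of a b] by (auto simp: Aj_def)
      fix x :: "'k^'v"
      let ?m = "\<lambda>a. c a * (\<Prod>k\<in>W. (x $ k) ^ lookup a k)"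
      define q where "q = (\<Sum>a\<in>A. monom (?m a) (lookup a i))"
      have "poly q s = 0" for s
      proof -
        define y :: "'k^'v" where "y = (\<chi> k. if k = i then s else x $ k)"
        have "(\<Prod>k\<in>W. (y $ k) ^ lookup a k) = (\<Prod>k\<in>W. (x $ k) ^ lookup a k)" for a
          by (rule prod.cong) (use insert.hyps in \<open>auto simp: y_def\<close>)
        then have "poly q s = (\<Sum>a\<in>A. c a * (\<Prod>k\<in>insert i W. (y $ k) ^ lookup a k))"
          using insert.hyps by (simp add: q_def poly_sum poly_monom y_def algebra_simps)
        then show ?thesis using insert.prems(3) by simp
      qed
      then have "q = 0" by (intro poly_cofinite_zero[of "{}"]) auto
      then have "coeff q j = 0" by simp
      then show "(\<Sum>a\<in>Aj. ?m a) = 0"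
        using insert.prems(1) by (simp add: q_def coeff_sum Aj_def sum.inter_filter)
    qed
    then show "c a0 = 0" using a0 by (simp add: Aj_def j_def)
  qed
qed

lemma eval_zero_imp_zero:
  fixes f :: "('v::finite, 'k::alg_closed_field) mpoly"
  assumes "\<And>x. eval_poly f x = 0"
  shows "f = 0"
proof -
  have "\<forall>a\<in>keys f. lookup f a = 0"
    by (rule monomials_independent[of UNIV])
      (use assms in \<open>auto simp: eval_poly_def intro: poly_mapping_eqI\<close>)
  then show ?thesis by (metis keys_eq_empty ex_in_conv in_keys_iff poly_mapping_eqI lookup_zero)
qed

lemma vanishes_at_add: "vanishes_at f V \<Longrightarrow> vanishes_at g V \<Longrightarrow> vanishes_at (f + g) V"
  and vanishes_at_mult: "vanishes_at f V \<Longrightarrow> vanishes_at (g * f) V"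
  and vanishes_at_0: "vanishes_at 0 V"
  by (auto simp: vanishes_at_def)

text \<open>Along the scalar multiples of a point, \<open>f\<close> is a polynomial in the scalar
  whose coefficients are the values of its homogeneous components; over an infinite field they all
  vanish with it.\<close>

lemma vanishes_at_hcomp:
  fixes f :: "('v::finite, 'k::alg_closed_field) mpoly"
  assumes f: "vanishes_at f V" and V: "\<And>c x. x \<in> V \<Longrightarrow> c *s x \<in> V"
  shows "vanishes_at (hcomp t f) V"
  unfolding vanishes_at_def
proof
  fix x assume x: "x \<in> V"
  obtain N where N: "f = (\<Sum>u<N. hcomp u f)" by (rule hcomp_decomp)
  define q where "q = (\<Sum>u<N. monom (eval_poly (hcomp u f) x) u)"
  have "poly q c = 0" for c
  proof -
    have "poly q c = eval_poly (\<Sum>u<N. hcomp u f) (c *s x)"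
      by (simp add: q_def poly_sum poly_monom eval_scale[OF is_form_hcomp] mult.commute)
    also have "\<dots> = 0" using f V[OF x] N by (simp add: vanishes_at_def)
    finally show ?thesis .
  qed
  then have q0: "q = 0" by (intro poly_cofinite_zero[of "{}"]) auto
  have ch: "coeff q t = (if t < N then eval_poly (hcomp t f) x else 0)"
    by (simp add: q_def coeff_sum)
  have "hcomp t f = (if t < N then hcomp t f else 0)"
  proof -
    have "hcomp t f = hcomp t (\<Sum>u<N. hcomp u f)" using N by simp
    also have "\<dots> = (if t < N then hcomp t f else 0)"
      by (simp add: hcomp_sum hcomp_form[OF is_form_hcomp])
    finally show ?thesis .
  qed
  then show "eval_poly (hcomp t f) x = 0" using ch q0
    by (metis coeff_0 eval_0)
qed

lemma form_0_eq_Const: "is_form 0 f \<Longrightarrow> f = Const (lookup f 0)"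
  by (rule poly_mapping_eqI)
    (auto simp: is_form_def in_keys_iff Const_def lookup_single when_def mon_degree_eq_0_iff)

lemma linform_add:
  fixes l :: "('v::finite, 'k::comm_ring_1) mpoly"
  assumes "is_form 1 l"
  shows "eval_poly l (x + y) = eval_poly l x + eval_poly l y"
proof -
  have "t = 1 \<longrightarrow> eval_poly l (x + y) = eval_poly l x + eval_poly l y" if "is_form t l" for t
    using that
  proof (induction rule: form_induct)
    case (Var t i f)
    show ?case
    proof
      assume "Suc t = 1"
      then obtain c where "f = Const c" using Var(1) form_0_eq_Const by auto
      then show "eval_poly (Var i * f) (x + y) = eval_poly (Var i * f) x + eval_poly (Var i * f) y"
        by (simp add: algebra_simps)
    qed
  qed (auto simp: algebra_simps)
  then show ?thesis using assms by blast
qed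

lemma linform_scale:
  "is_form 1 l \<Longrightarrow> eval_poly l (c *s x) = c * eval_poly l x"
  using eval_scale[of 1 l c x] by simp

lemma linform_diff:
  fixes l :: "('v::finite, 'k::comm_ring_1) mpoly"
  assumes "is_form 1 l"
  shows "eval_poly l (x - y) = eval_poly l x - eval_poly l y"
  using linform_add[OF assms, of "x - y" y] by simp

lemma exists_linform:
  fixes V :: "('k::field ^ 'v::finite) set"
  assumes V: "vec.subspace V" and v: "v \<notin> V"
  obtains l where "is_form 1 l" "vanishes_at l V" "eval_poly l v = 1"
proof -
  obtain B where B: "B \<subseteq> V" "vec.independent B" "V \<subseteq> vec.span B"
    by (rule vec.basis_exists[of V]) auto
  have sB: "vec.span B = V" using B V by (metis vec.span_minimal subset_antisym)
  then have ind: "vec.independent (insert v B)" using B v by (intro vec.independent_insertI) auto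
  \<comment> \<open>The extension theorem is used for an endomorphism of the whole space, so the
    functional is read off in an arbitrary coordinate \<open>i0\<close>.\<close>
  obtain i0 :: 'v where True by blast
  obtain g where g: "Vector_Spaces.linear (*s) (*s) g"
    "\<forall>x\<in>insert v B. g x = (if x = v then axis i0 (1::'k) else (0::'k^'v))"
    using vec.linear_independent_extend[OF ind, of "\<lambda>x. if x = v then axis i0 (1::'k) else 0"] by blast
  define l :: "('v, 'k) mpoly" where "l = (\<Sum>i\<in>UNIV. Const (g (axis i 1) $ i0) * Var i)"
  have ev: "eval_poly l x = g x $ i0" for x
    by (subst linear_componentwise[OF g(1)]) (simp add: l_def mult.commute)
  have "is_form 1 l" unfolding l_def
    by (intro is_form_sum is_form_Const_mult) simp
  moreover have "g x = 0" if "x \<in> V" for x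
  proof -
    have "x \<in> vec.span B" using that sB by simp
    moreover have "g b = 0" if "b \<in> B" for b
      using g(2) v B(1) that by (metis insert_iff subsetD)
    ultimately show ?thesis by (metis vec.linear_eq_0_on_span[OF g(1)])
  qed
  ultimately show ?thesis using that[of l] g(2) by (simp add: ev vanishes_at_def axis_def)
qed

abbreviation ker_on :: "('k::field ^ 'v::finite) set \<Rightarrow> ('v, 'k) mpoly \<Rightarrow> ('k ^ 'v) set" where
  "ker_on V l \<equiv> {x \<in> V. eval_poly l x = 0}"

lemma subspace_ker_on:
  assumes "vec.subspace V" "is_form 1 l"
  shows "vec.subspace (ker_on V l)"
proof -
  have "eval_poly l 0 = 0" using linform_scale[OF assms(2), of 0 0] by simp
  then show ?thesis using assms(1)
    by (auto simp: vec.subspace_def linform_add[OF assms(2)] linform_scale[OF assms(2)])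
qed

lemma dim_ker_on:
  assumes V: "vec.subspace V" and l: "is_form 1 l" and v: "v \<in> V" "eval_poly l v \<noteq> 0"
  shows "vec.dim V = Suc (vec.dim (ker_on V l))"
proof -
  let ?K = "ker_on V l"
  have sK: "vec.span ?K = ?K" using subspace_ker_on[OF V l] by (simp only: vec.span_eq_iff)
  have "V \<subseteq> vec.span (insert v ?K)"
  proof
    fix x assume x: "x \<in> V"
    define c where "c = eval_poly l x / eval_poly l v"
    have "x - c *s v \<in> ?K"
      using V x v by (simp add: linform_diff[OF l] linform_scale[OF l] c_def vec.subspace_diff vec.subspace_scale)
    then have "c *s v + (x - c *s v) \<in> vec.span (insert v ?K)"
      by (intro vec.span_add vec.span_scale) (auto intro: vec.span_base)
    then show "x \<in> vec.span (insert v ?K)" by simp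
  qed
  moreover have "vec.span (insert v ?K) \<subseteq> V" using V v by (intro vec.span_minimal) auto
  ultimately have "vec.dim V = vec.dim (insert v ?K)" by (metis vec.dim_span subset_antisym)
  also have "\<dots> = Suc (vec.dim ?K)" using v by (simp add: vec.dim_insert sK)
  finally show ?thesis .
qed

lemma exists_linform_on:
  assumes V: "vec.subspace V" and "vec.dim V = Suc q"
  obtains l v where "is_form 1 l" "v \<in> V" "eval_poly l v = 1" "vec.dim (ker_on V l) = q"
proof -
  have "\<not> V \<subseteq> {0}" using assms(2) vec.dim_eq_0[of V] by auto
  then obtain v where v: "v \<in> V" "v \<notin> {0}" by auto
  obtain l where "is_form 1 l" "vanishes_at l {0}" "eval_poly l v = 1"
    using exists_linform[OF vec.subspace_single_0 v(2)] by blast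
  then show ?thesis using that[of l v] v dim_ker_on[OF V, of l v] assms(2) by auto
qed

text \<open>When \<open>l\<close> is linear with l(v) = 1, the map sending x to x - l(x) v is the
  projection onto the kernel of \<open>l\<close> along \<open>v\<close>. A polynomial and its
  pullback along this map agree modulo \<open>l\<close>; the quotient for \<open>Var i * f\<close>
  comes from the product rule for differences.\<close>

lemma translate_quotient:
  fixes f :: "('v::finite, 'k::field) mpoly"
  shows "\<exists>g. \<forall>x. eval_poly f x - eval_poly f (x - eval_poly l x *s v) = eval_poly l x * eval_poly g x"
proof (induction f rule: mpoly_induct)
  case (Const c)
  show ?case by (intro exI[of _ 0]) simp
next
  case (add f g)
  then obtain f' g' where
    f': "\<forall>x. eval_poly f x - eval_poly f (x - eval_poly l x *s v) = eval_poly l x * eval_poly f' x"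
    and g': "\<forall>x. eval_poly g x - eval_poly g (x - eval_poly l x *s v) = eval_poly l x * eval_poly g' x" by blast
  have "eval_poly (f + g) x - eval_poly (f + g) (x - eval_poly l x *s v) = eval_poly l x * eval_poly (f' + g') x" for x
    by (simp only: eval_add distrib_left f'[rule_format, of x, symmetric] g'[rule_format, of x, symmetric]) simp
  then show ?case by blast
next
  case (Var i f)
  then obtain g where g: "\<forall>x. eval_poly f x - eval_poly f (x - eval_poly l x *s v) = eval_poly l x * eval_poly g x" by blast
  have "eval_poly (Var i * f) x - eval_poly (Var i * f) (x - eval_poly l x *s v)
      = eval_poly l x * eval_poly (Var i * g + Const (v $ i) * (f - l * g)) x" for x
  proof -
    have e: "eval_poly f (x - eval_poly l x *s v) = eval_poly f x - eval_poly l x * eval_poly g x"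
      by (simp only: g[rule_format, of x, symmetric]) simp
    show ?thesis by (simp add: e) (simp add: algebra_simps)
  qed
  then show ?case by blast
qed

text \<open>This is I(V \<inter> {l = 0}) = I(V) + (l), the algebraic form of a hyperplane section.
  The pullback of \<open>f\<close> under the projection onto the kernel vanishes on
  \<open>V\<close>, and the rest is a multiple of \<open>l\<close>.\<close>

lemma vanishes_on_hyperplane:
  fixes f :: "('v::finite, 'k::field) mpoly"
  assumes V: "vec.subspace V" and l: "is_form 1 l" and v: "v \<in> V" "eval_poly l v = 1"
    and f: "vanishes_at f (ker_on V l)"
  obtains g where "vanishes_at (f - l * g) V"
proof -
  obtain g where g: "\<And>x. eval_poly f x - eval_poly f (x - eval_poly l x *s v) = eval_poly l x * eval_poly g x"
    using translate_quotient by blast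
  have "eval_poly (f - l * g) x = 0" if x: "x \<in> V" for x
  proof -
    have "x - eval_poly l x *s v \<in> ker_on V l"
      using V x v by (simp add: linform_diff[OF l] linform_scale[OF l] vec.subspace_diff vec.subspace_scale)
    then have "eval_poly f (x - eval_poly l x *s v) = 0" using f by (auto simp: vanishes_at_def)
    then show ?thesis using g[of x] by simp
  qed
  then show ?thesis using that by (auto simp: vanishes_at_def)
qed

text \<open>So \<open>l\<close> is a nonzerodivisor modulo I(V). On the line through
  \<open>x\<close> in direction \<open>v\<close>, which lies in \<open>V\<close>, the form
  \<open>l\<close> has a single zero; the restriction of \<open>f\<close>, a univariate polynomial,
  therefore has cofinitely many zeros.\<close>

lemma vanishes_at_cancel:
  fixes f :: "('v::finite, 'k::alg_closed_field) mpoly"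
  assumes V: "vec.subspace V" and l: "is_form 1 l" and v: "v \<in> V" "eval_poly l v \<noteq> 0"
    and f: "vanishes_at (l * f) V"
  shows "vanishes_at f V"
  unfolding vanishes_at_def
proof
  fix x assume x: "x \<in> V"
  have "\<exists>q. \<forall>s. eval_poly f (x + s *s v) = poly q s"
  proof (induction f rule: mpoly_induct)
    case (Const c)
    show ?case by (intro exI[of _ "[:c:]"]) simp
  next
    case (add f g)
    then obtain p q where "\<forall>s. eval_poly f (x + s *s v) = poly p s" "\<forall>s. eval_poly g (x + s *s v) = poly q s" by blast
    then show ?case by (intro exI[of _ "p + q"]) simp
  next
    case (Var i f)
    then obtain p where "\<forall>s. eval_poly f (x + s *s v) = poly p s" by blast
    then show ?case by (intro exI[of _ "[:x $ i, v $ i:] * p"]) (simp add: algebra_simps)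
  qed
  then obtain q where q: "\<And>s. eval_poly f (x + s *s v) = poly q s" by blast
  have "poly q s = 0" if "s \<notin> {- eval_poly l x / eval_poly l v}" for s
  proof -
    have "eval_poly l (x + s *s v) \<noteq> 0"
      using that v(2) by (simp add: linform_add[OF l] linform_scale[OF l] field_simps eq_neg_iff_add_eq_0)
    moreover have "x + s *s v \<in> V" using V x v by (simp add: vec.subspace_add vec.subspace_scale)
    then have "eval_poly (l * f) (x + s *s v) = 0" using f unfolding vanishes_at_def by blast
    ultimately show ?thesis using q by simp
  qed
  then have "q = 0" by (intro poly_cofinite_zero[of "{- eval_poly l x / eval_poly l v}"]) auto
  then show "eval_poly f x = 0" using q[of 0] by simp
qed

section \<open>Graded submodules of free modules are finitely generated\<close>

text \<open>A monotone subsequence exists in any case; a decreasing one is constant from the place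
  where it attains its least value.\<close>

lemma nat_seq_mono_subseq:
  fixes s :: "nat \<Rightarrow> nat"
  obtains r :: "nat \<Rightarrow> nat" where "strict_mono r" "mono (\<lambda>n. s (r n))"
proof -
  obtain f :: "nat \<Rightarrow> nat" where f: "strict_mono f" "monoseq (\<lambda>n. s (f n))" using seq_monosub by blast
  show ?thesis
  proof (cases "\<forall>m n. m \<le> n \<longrightarrow> s (f m) \<le> s (f n)")
    case True
    then show ?thesis using that[of f] f(1) by (simp add: mono_def)
  next
    case False
    then have dec: "\<And>m n. m \<le> n \<Longrightarrow> s (f n) \<le> s (f m)" using f(2) by (auto simp: monoseq_def)
    define v where "v = (LEAST y. y \<in> range (\<lambda>n. s (f n)))"
    have "v \<in> range (\<lambda>n. s (f n))" unfolding v_def by (rule LeastI_ex) auto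
    then obtain n0 where n0: "s (f n0) = v" by auto
    have c: "s (f (n + n0)) = v" for n
    proof (rule antisym)
      show "s (f (n + n0)) \<le> v" using dec[of n0 "n + n0"] n0 by simp
      show "v \<le> s (f (n + n0))" unfolding v_def by (rule Least_le) auto
    qed
    have "strict_mono (\<lambda>n. f (n + n0))" using f(1) by (auto simp: strict_mono_def)
    then show ?thesis using that[of "\<lambda>n. f (n + n0)"] c by (simp add: mono_def)
  qed
qed

lemma exponents_mono_subseq:
  fixes f :: "nat \<Rightarrow> ('v \<Rightarrow>\<^sub>0 nat)"
  assumes "finite W"
  shows "\<exists>r::nat \<Rightarrow> nat. strict_mono r \<and> (\<forall>i\<in>W. mono (\<lambda>n. lookup (f (r n)) i))"
  using assms
proof (induction W rule: finite_induct)
  case empty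
  show ?case by (intro exI[of _ id]) (auto simp: strict_mono_def)
next
  case (insert i W)
  then obtain r :: "nat \<Rightarrow> nat" where r: "strict_mono r" "\<And>j. j \<in> W \<Longrightarrow> mono (\<lambda>n. lookup (f (r n)) j)" by blast
  obtain r' :: "nat \<Rightarrow> nat" where r': "strict_mono r'" "mono (\<lambda>n. lookup (f (r (r' n))) i)"
    using nat_seq_mono_subseq[of "\<lambda>n. lookup (f (r n)) i"] by blast
  have "mono (\<lambda>n. lookup (f (r (r' n))) j)" if "j \<in> W" for j
    using r(2)[OF that] r'(1) by (auto simp: mono_def strict_mono_less_eq)
  then show ?case using r r' by (intro exI[of _ "r \<circ> r'"]) (auto simp: strict_mono_o strict_mono_def)
qed

text \<open>Otherwise some infinite sequence in \<open>E\<close> has no term dividing a later one;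
  but a subsequence that is monotone in each of the finitely many exponents contains such a
  divisibility.\<close>

lemma dickson:
  fixes E :: "('v::finite \<Rightarrow>\<^sub>0 nat) set"
  obtains M where "finite M" "M \<subseteq> E" "\<And>a. a \<in> E \<Longrightarrow> \<exists>m\<in>M. \<exists>c. a = m + c"
proof (rule ccontr)
  assume "\<not> thesis"
  then have ex: "\<exists>a\<in>E. \<forall>m\<in>M. \<forall>c. a \<noteq> m + c" if "finite M" "M \<subseteq> E" for M
    using that \<open>\<And>M. finite M \<Longrightarrow> M \<subseteq> E \<Longrightarrow> (\<And>a. a \<in> E \<Longrightarrow> \<exists>m\<in>M. \<exists>c. a = m + c) \<Longrightarrow> thesis\<close> by metis
  have "\<exists>f::nat \<Rightarrow> ('v \<Rightarrow>\<^sub>0 nat). \<forall>n. f n \<in> E \<and> (\<forall>m<n. \<forall>c. f n \<noteq> f m + c)"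
  proof (rule dependent_wellorder_choice)
    fix n :: nat and f :: "nat \<Rightarrow> ('v \<Rightarrow>\<^sub>0 nat)"
    assume "\<And>m. m < n \<Longrightarrow> f m \<in> E \<and> (\<forall>l<m. \<forall>c. f m \<noteq> f l + c)"
    then obtain a where "a \<in> E" "\<forall>m\<in>f ` {..<n}. \<forall>c. a \<noteq> m + c"
      using ex[of "f ` {..<n}"] by auto
    then show "\<exists>r. r \<in> E \<and> (\<forall>m<n. \<forall>c. r \<noteq> f m + c)" by auto
  qed auto
  then obtain f :: "nat \<Rightarrow> ('v \<Rightarrow>\<^sub>0 nat)" where f: "\<And>n m c. m < n \<Longrightarrow> f n \<noteq> f m + c" by blast
  obtain r :: "nat \<Rightarrow> nat" where r: "strict_mono r" "\<And>i. mono (\<lambda>n. lookup (f (r n)) i)"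
    using exponents_mono_subseq[of UNIV f] by auto
  have "f (r 1) = f (r 0) + (f (r 1) - f (r 0))"
    by (rule poly_mapping_eqI) (use monoD[OF r(2), of 0 1] in \<open>simp add: lookup_add lookup_minus\<close>)
  moreover have "r 0 < r 1" using r(1) by (simp add: strict_mono_def)
  ultimately show False using f by metis
qed

lemma lookup_single_mult:
  fixes f :: "('v::finite, 'k::comm_ring_1) mpoly"
  shows "lookup (single c \<alpha> * f) (c + m) = \<alpha> * lookup f m"
proof -
  have "single c \<alpha> * f
      = (\<Sum>b\<in>keys f. single (c + b) (\<alpha> * lookup f b))"
    by (subst mpoly_monomial_sum[of f]) (simp add: sum_distrib_left mult_single)
  then show ?thesis
    by (auto simp: lookup_sum lookup_single when_def in_keys_iff cong: if_cong)
qed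

section \<open>Free modules as coefficient functions, and their grading\<close>

definition smul :: "'a \<Rightarrow> (nat \<Rightarrow> 'a) \<Rightarrow> nat \<Rightarrow> 'a::comm_ring_1" where
  "smul a u = (\<lambda>k. a * u k)"

lemma smul_apply [simp]: "smul a u k = a * u k"
  by (simp add: smul_def)

interpretation fm: module "smul :: 'a \<Rightarrow> _ \<Rightarrow> (nat \<Rightarrow> 'a::comm_ring_1)"
  by unfold_locales (auto simp: fun_eq_iff algebra_simps)

lemma sum_apply: "(\<Sum>a\<in>A. f a) k = (\<Sum>a\<in>A. f a k :: 'a::comm_monoid_add)"
  by (induction A rule: infinite_finite_induct) auto

definition fmod :: "nat \<Rightarrow> (nat \<Rightarrow> 'a::comm_ring_1) set" where
  "fmod r = {u. \<forall>k\<ge>r. u k = 0}"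

lemma fmod_0: "0 \<in> fmod r"
  and fmod_add: "u \<in> fmod r \<Longrightarrow> v \<in> fmod r \<Longrightarrow> u + v \<in> fmod r"
  and fmod_diff: "u' \<in> fmod r \<Longrightarrow> v' \<in> fmod r \<Longrightarrow> u' - v' \<in> fmod r"
  and fmod_smul: "u'' \<in> fmod r \<Longrightarrow> smul a u'' \<in> fmod r"
  by (auto simp: fmod_def)

text \<open>
  The vectors of degree \<open>t\<close> in the free module of rank \<open>r\<close> whose \<open>k\<close>-th basis element has degree \<open>b k\<close>.
\<close>

definition hel :: "nat \<Rightarrow> (nat \<Rightarrow> nat) \<Rightarrow> nat \<Rightarrow> (nat \<Rightarrow> ('v::finite, 'k::comm_ring_1) mpoly) \<Rightarrow> bool" where
  "hel r b t u \<longleftrightarrow> (\<forall>k. if k < r \<and> b k \<le> t then is_form (t - b k) (u k) else u k = 0)"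

text \<open>The guard matters: for \<open>b k > t\<close> the truncated difference is 0, and
  \<open>hcomp\<close> would return the constant term instead of 0.\<close>

definition mcomp :: "(nat \<Rightarrow> nat) \<Rightarrow> nat \<Rightarrow> (nat \<Rightarrow> ('v::finite, 'k::comm_ring_1) mpoly) \<Rightarrow> nat \<Rightarrow> ('v, 'k) mpoly" where
  "mcomp b t u = (\<lambda>k. if b k \<le> t then hcomp (t - b k) (u k) else 0)"

lemma hel_fmod: "hel r b t u \<Longrightarrow> u \<in> fmod r"
  by (auto simp: hel_def fmod_def not_less[symmetric])

lemma hel_diff: "hel r b t u \<Longrightarrow> hel r b t v \<Longrightarrow> hel r b t (u - v)"
  by (auto simp: hel_def intro: is_form_diff)

lemma hel_smul: "is_form s a \<Longrightarrow> hel r b t u \<Longrightarrow> hel r b (s + t) (smul a u)"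
  unfolding hel_def
proof (intro allI)
  fix k
  assume a: "is_form s a" and u: "\<forall>k. if k < r \<and> b k \<le> t then is_form (t - b k) (u k) else u k = 0"
  show "if k < r \<and> b k \<le> s + t then is_form (s + t - b k) (smul a u k) else smul a u k = 0"
  proof (cases "k < r \<and> b k \<le> t")
    case True
    then have "is_form (t - b k) (u k)" using u by metis
    then have "is_form (s + (t - b k)) (a * u k)" using a is_form_mult by blast
    then show ?thesis using True by auto
  next
    case False
    then have "u k = 0" using u by metis
    then show ?thesis by simp
  qed
qed

lemma hel_constant_term:
  fixes u :: "nat \<Rightarrow> ('v::finite, 'k::comm_ring_1) mpoly"
  assumes "hel r b t u" "\<not> (k < r \<and> b k = t)"
  shows "eval_poly (u k) 0 = 0"
proof (rule ccontr)
  assume "eval_poly (u k) 0 \<noteq> 0"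
  then have 0: "0 \<in> keys (u k)" by (simp add: eval_at_0 in_keys_iff)
  then have "u k \<noteq> 0" by auto
  then have "k < r" "b k \<le> t" "is_form (t - b k) (u k)"
    using assms(1) unfolding hel_def by metis+
  then show False using 0 assms(2) by (auto simp: is_form_def)
qed

lemma hel_mcomp: "u \<in> fmod r \<Longrightarrow> hel r b t (mcomp b t u)"
  by (auto simp: hel_def mcomp_def fmod_def)

lemma mcomp_add: "mcomp b t (u + v) = mcomp b t u + mcomp b t v"
  by (auto simp: mcomp_def hcomp_add)

lemma mcomp_0 [simp]: "mcomp b t 0 = 0"
  by (auto simp: mcomp_def)

lemma mcomp_sum: "mcomp b t (sum f A) = (\<Sum>a\<in>A. mcomp b t (f a))"
proof (induction A rule: infinite_finite_induct)
  case (insert x F)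
  show ?case unfolding sum.insert[OF insert.hyps] mcomp_add insert.IH ..
qed (simp_all only: sum.infinite sum.empty mcomp_0 not_False_eq_True)

lemma mcomp_hel:
  assumes "hel r b s u"
  shows "mcomp b t u = (if s = t then u else 0)"
proof
  fix k
  have "if k < r \<and> b k \<le> s then is_form (s - b k) (u k) else u k = 0"
    using assms by (simp add: hel_def)
  then show "mcomp b t u k = (if s = t then u else 0) k"
    by (auto simp: mcomp_def hcomp_form split: if_splits)
qed

lemma mcomp_decomp:
  assumes "u \<in> fmod r"
  obtains N where "u = (\<Sum>t<N. mcomp b t u)"
proof -
  have "\<forall>k. \<exists>n. u k = (\<Sum>t<n. hcomp t (u k))" using hcomp_decomp by metis
  then obtain n where n: "\<And>k. u k = (\<Sum>t<n k. hcomp t (u k))" by metis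
  have z: "hcomp t (u k) = 0" if "t \<ge> n k" for t k
  proof -
    have "hcomp t (u k) = (\<Sum>s<n k. hcomp t (hcomp s (u k)))" by (subst n) (simp add: hcomp_sum)
    also have "\<dots> = 0" using that by (intro sum.neutral) (auto simp: hcomp_form[OF is_form_hcomp])
    finally show ?thesis .
  qed
  define N where "N = (\<Sum>k<r. n k + b k)"
  have "u k = (\<Sum>t<N. mcomp b t u) k" for k
  proof (cases "k < r")
    case True
    then have N: "n k + b k \<le> N" unfolding N_def by (intro member_le_sum) auto
    have "(\<Sum>t<N. mcomp b t u) k = (\<Sum>t\<in>{b k..<N}. hcomp (t - b k) (u k))"
      unfolding sum_apply mcomp_def
      by (rule sum.mono_neutral_cong_right) auto
    also have "\<dots> = (\<Sum>t\<in>{0..<N - b k}. hcomp t (u k))"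
      using sum.shift_bounds_nat_ivl[of "\<lambda>t. hcomp (t - b k) (u k)" 0 "b k" "N - b k"] N by simp
    also have "\<dots> = (\<Sum>t<n k. hcomp t (u k))"
      by (rule sum.mono_neutral_right) (use N z in auto)
    finally show ?thesis using n by metis
  next
    case False
    then have "u k = 0" using assms by (auto simp: fmod_def)
    then show ?thesis by (simp add: sum_apply mcomp_def cong: if_cong)
  qed
  then show ?thesis using that by blast
qed

lemma mcomp_smul_hel:
  assumes "hel r b s u"
  shows "mcomp b t (smul q u) = (if s \<le> t then smul (hcomp (t - s) q) u else 0)"
proof
  fix k
  show "mcomp b t (smul q u) k = (if s \<le> t then smul (hcomp (t - s) q) u else 0) k"
  proof (cases "k < r \<and> b k \<le> s")
    case True
    then have "is_form (s - b k) (u k)" using assms unfolding hel_def by metis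
    then show ?thesis using True by (auto simp: mcomp_def hcomp_form_mult)
  next
    case False
    then have "u k = 0" using assms unfolding hel_def by metis
    then show ?thesis by (simp add: mcomp_def)
  qed
qed

definition hsubmod :: "nat \<Rightarrow> (nat \<Rightarrow> nat) \<Rightarrow> (nat \<Rightarrow> ('v::finite, 'k::comm_ring_1) mpoly) set \<Rightarrow> bool" where
  "hsubmod r b U \<longleftrightarrow> U \<subseteq> fmod r \<and> fm.subspace U \<and> (\<forall>u\<in>U. \<forall>t. mcomp b t u \<in> U)"

text \<open>
  The leading term of a vector is taken in its last nonzero coordinate, with respect to the
  lexicographic order of exponents.
\<close>

definition lead :: "(nat \<Rightarrow> ('v::{finite,linorder}, 'k::zero) mpoly) \<Rightarrow> nat \<Rightarrow> ('v \<Rightarrow>\<^sub>0 nat) \<Rightarrow> bool" where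
  "lead u k a \<longleftrightarrow> a \<in> keys (u k) \<and> (\<forall>b\<in>keys (u k). b \<le> a) \<and> (\<forall>k'>k. u k' = 0)"

lemma exists_lead:
  assumes "u \<in> fmod r" "u \<noteq> 0"
  obtains k a where "k < r" "lead u k a"
proof -
  let ?S = "{k. u k \<noteq> 0}"
  have sub: "?S \<subseteq> {..<r}" using assms(1) by (auto simp: fmod_def) (meson not_less)
  have fin: "finite ?S" using sub by (rule finite_subset) simp
  have ne: "?S \<noteq> {}" using assms(2) by (auto simp: fun_eq_iff)
  define k where "k = Max ?S"
  have kS: "k \<in> ?S" unfolding k_def using fin ne by (rule Max_in)
  have z: "u k' = 0" if "k' > k" for k'
    using Max_ge[OF fin, of k'] that unfolding k_def by fastforce
  have kne: "keys (u k) \<noteq> {}" using kS by simp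
  have "lead u k (Max (keys (u k)))"
    using z kne by (simp add: lead_def)
  then show ?thesis using that kS sub by blast
qed

text \<open>Division by leading terms, as for Groebner bases. Dickson's lemma gives, for each
  position \<open>k\<close>, finitely many exponents that divide all leading exponents occurring at
  \<open>k\<close>; homogeneous elements with these leading terms generate. Only homogeneous
  elements are reduced: their degree bounds the exponents that can occur, which makes the reduction
  terminate.\<close>

theorem hsubmod_finitely_generated:
  fixes U :: "(nat \<Rightarrow> ('v::{finite,linorder}, 'k::field) mpoly) set"
  assumes U: "hsubmod r b U"
  obtains G where "finite G" "G \<subseteq> U" "\<And>g. g \<in> G \<Longrightarrow> \<exists>t. hel r b t g" "U = fm.span G"
proof -
  have Uf: "U \<subseteq> fmod r" and Us: "fm.subspace U" and Uc: "\<And>u t. u \<in> U \<Longrightarrow> mcomp b t u \<in> U"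
    using U by (auto simp: hsubmod_def)
  define E where "E k = {a. \<exists>u\<in>U. (\<exists>t. hel r b t u) \<and> lead u k a}" for k
  have "\<forall>k. \<exists>M. finite M \<and> M \<subseteq> E k \<and> (\<forall>a\<in>E k. \<exists>m\<in>M. \<exists>c. a = m + c)"
    by (metis dickson)
  then obtain M where M: "\<And>k. finite (M k)" "\<And>k. M k \<subseteq> E k"
    "\<And>k a. a \<in> E k \<Longrightarrow> \<exists>m\<in>M k. \<exists>c. a = m + c" by metis
  have "\<forall>k m. \<exists>g. m \<in> M k \<longrightarrow> g \<in> U \<and> (\<exists>t. hel r b t g) \<and> lead g k m"
    using M(2) unfolding E_def by blast
  then obtain gg where gg: "\<And>k m. m \<in> M k \<Longrightarrow> gg k m \<in> U"
    "\<And>k m. m \<in> M k \<Longrightarrow> \<exists>t. hel r b t (gg k m)" "\<And>k m. m \<in> M k \<Longrightarrow> lead (gg k m) k m" by metis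
  define G where "G = (\<Union>k<r. gg k ` M k)"
  have finG: "finite G" using M(1) by (simp add: G_def)
  have GU: "G \<subseteq> U" using gg(1) by (auto simp: G_def)
  have Gh: "\<exists>t. hel r b t g" if "g \<in> G" for g using that gg(2) by (auto simp: G_def)
  have hspan: "u \<in> fm.span G" if "u \<in> U" "hel r b t u" for t u
  proof -
    \<comment> \<open>The places at or below some term of \<open>v\<close>, in the order that
      compares positions first. The restriction to degree at most \<open>t\<close> makes the set
      finite, and cancelling the leading term of \<open>u\<close> removes \<open>(k, a)\<close> from
      it.\<close>
    define D where "D v = {(k', a'). k' < r \<and> mon_degree a' \<le> t \<and>
      (\<exists>k a. a \<in> keys (v k) \<and> (k' < k \<or> k' = k \<and> a' \<le> a))}"
      for v :: "nat \<Rightarrow> ('v, 'k) mpoly"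
    have finD: "finite (D v)" for v
    proof (rule finite_subset)
      show "D v \<subseteq> {..<r} \<times> {a. mon_degree a \<le> t}" by (auto simp: D_def)
      show "finite ({..<r} \<times> {a::'v \<Rightarrow>\<^sub>0 nat. mon_degree a \<le> t})" by (intro finite_cartesian_product finite_mon_degree_le) simp
    qed
    show ?thesis using that
    proof (induction "card (D u)" arbitrary: u rule: less_induct)
      case less
      show ?case
      proof (cases "u = 0")
        case True
        then show ?thesis by (simp add: fm.span_zero)
      next
        case False
        obtain k a where ka: "k < r" "lead u k a" using exists_lead False less.prems Uf by blast
        have "a \<in> E k" using less.prems ka unfolding E_def by blast
        then obtain m c where mc: "m \<in> M k" "a = m + c" using M(3) by blast
        let ?g = "gg k m"
        obtain s where s: "hel r b s ?g" using gg(2) mc by blast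
        have lg: "lead ?g k m" using gg(3) mc by blast
        have gU: "?g \<in> U" using gg(1) mc by blast
        have km: "lookup (?g k) m \<noteq> 0" using lg by (simp add: lead_def in_keys_iff)
        have "?g k \<noteq> 0" "u k \<noteq> 0" using lg ka by (auto simp: lead_def)
        then have fg: "is_form (s - b k) (?g k)" "b k \<le> s" and fu: "is_form (t - b k) (u k)" "b k \<le> t"
          using s less.prems(2) unfolding hel_def by metis+
        have mm: "mon_degree m = s - b k" "mon_degree a = t - b k"
          using fg fu lg ka by (auto simp: is_form_def lead_def)
        then have deg: "mon_degree c + s = t" using fg(2) fu(2) mc(2) by (simp add: mon_degree_add)
        define \<alpha> where "\<alpha> = lookup (u k) a / lookup (?g k) m"
        define w where "w = smul (single c \<alpha>) ?g"
        have hw: "hel r b t w" unfolding w_def deg[symmetric]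
          by (rule hel_smul[OF _ s]) (simp add: is_form_def)
        have wU: "w \<in> U" unfolding w_def using Us gU by (rule fm.subspace_scale)
        define u' where "u' = u - w"
        have u'U: "u' \<in> U" unfolding u'_def using Us less.prems(1) wU by (rule fm.subspace_diff)
        have hu': "hel r b t u'" unfolding u'_def using less.prems(2) hw by (rule hel_diff)
        have up: "u' k' = 0" if "k' > k" for k'
          using that ka lg by (simp add: u'_def w_def lead_def)
        have ac: "a = c + m" using mc(2) by (simp add: add.commute)
        have "lookup (w k) a = lookup (u k) a"
          unfolding w_def smul_apply ac lookup_single_mult using km ac by (simp add: \<alpha>_def)
        then have nk: "a \<notin> keys (u' k)"
          by (simp add: u'_def in_keys_iff lookup_minus)
        have lek: "b' \<le> a" if "b' \<in> keys (u' k)" for b'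
        proof -
          have "b' \<in> keys (u k) \<or> b' \<in> keys (w k)"
            using that by (auto simp: u'_def in_keys_iff lookup_minus)
          then show ?thesis
          proof
            assume "b' \<in> keys (u k)"
            then show ?thesis using ka by (simp add: lead_def)
          next
            assume "b' \<in> keys (w k)"
            then obtain b'' where "b' = c + b''" "b'' \<in> keys (?g k)"
              using keys_mult[of "single c \<alpha>" "?g k"]
              by (auto simp: w_def split: if_splits)
            then show ?thesis using lg ac by (auto simp: lead_def intro: add_left_mono)
          qed
        qed
        have ltk: "k'' < k \<or> k'' = k \<and> b' < a" if "b' \<in> keys (u' k'')" for k'' b'
        proof (cases k'' k rule: linorder_cases)
          case equal
          then show ?thesis using that lek[of b'] nk by (auto simp: order.strict_iff_order)
        next
          case greater
          then show ?thesis using that up by simp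
        qed simp
        have "D u' \<subset> D u"
        proof
          show "D u' \<subseteq> D u"
          proof clarify
            fix k' a'
            assume "(k', a') \<in> D u'"
            then obtain k'' b' where *: "k' < r" "mon_degree a' \<le> t" "b' \<in> keys (u' k'')"
              "k' < k'' \<or> k' = k'' \<and> a' \<le> b'" by (auto simp: D_def)
            have "k' < k \<or> k' = k \<and> a' \<le> a" using ltk[OF *(3)] *(4) by auto
            moreover have "a \<in> keys (u k)" using ka by (simp add: lead_def)
            ultimately show "(k', a') \<in> D u" using * unfolding D_def by blast
          qed
          have "(k, a) \<in> D u" using ka mm by (auto simp: D_def lead_def)
          moreover have "(k, a) \<notin> D u'"
          proof
            assume "(k, a) \<in> D u'"
            then obtain k'' b' where *: "b' \<in> keys (u' k'')"
              "k < k'' \<or> k = k'' \<and> a \<le> b'" by (auto simp: D_def)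
            then show False using ltk[OF *(1)] by auto
          qed
          ultimately show "D u' \<noteq> D u" by blast
        qed
        then have "card (D u') < card (D u)" using finD by (simp add: psubset_card_mono)
        then have "u' \<in> fm.span G" using less.hyps u'U hu' by blast
        moreover have "?g \<in> G" using mc ka by (auto simp: G_def)
        then have "w \<in> fm.span G" unfolding w_def by (intro fm.span_scale fm.span_base)
        ultimately have "u' + w \<in> fm.span G" by (rule fm.span_add)
        then show ?thesis by (simp add: u'_def)
      qed
    qed
  qed
  have "U \<subseteq> fm.span G"
  proof
    fix u assume u: "u \<in> U"
    obtain N where N: "u = (\<Sum>t<N. mcomp b t u)" using mcomp_decomp u Uf by blast
    have "(\<Sum>t<N. mcomp b t u) \<in> fm.span G"
      by (intro fm.span_sum hspan[of _ _]) (use Uc u hel_mcomp Uf in blast)+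
    then show "u \<in> fm.span G" using N by simp
  qed
  moreover have "fm.span G \<subseteq> U" using GU Us by (rule fm.span_minimal)
  ultimately show ?thesis using that finG GU Gh by blast
qed

text \<open>Generators are numbered because they become the columns of a matrix. The homogeneous
  coefficients in the last clause arise by taking the component of degree \<open>t\<close> of an
  arbitrary representation.\<close>

corollary hsubmod_generators:
  fixes U :: "(nat \<Rightarrow> ('v::{finite,linorder}, 'k::field) mpoly) set"
  assumes U: "hsubmod r b U"
  shows "\<exists>(n::nat) dg G. (\<forall>l<n. G l \<in> U \<and> hel r b (dg l) (G l))
    \<and> (\<forall>u\<in>U. \<exists>c. u = (\<Sum>l<n. smul (c l) (G l)))
    \<and> (\<forall>t. \<forall>u\<in>U. hel r b t u \<longrightarrow>
          (\<exists>c. (\<forall>l<n. if dg l \<le> t then is_form (t - dg l) (c l) else c l = 0)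
            \<and> u = (\<Sum>l<n. smul (c l) (G l))))"
proof -
  obtain H where H: "finite H" "H \<subseteq> U" "\<And>g. g \<in> H \<Longrightarrow> \<exists>t. hel r b t g" "U = fm.span H"
    using hsubmod_finitely_generated[OF U] by blast
  obtain G where G: "bij_betw G {..<card H} H"
    using ex_bij_betw_nat_finite[OF H(1)] by (auto simp: atLeast0LessThan)
  have GH: "G l \<in> H" if "l < card H" for l using G that by (auto simp: bij_betw_def)
  have "\<forall>l. \<exists>t. l < card H \<longrightarrow> hel r b t (G l)" using GH H(3) by blast
  then obtain dg where dg: "\<And>l. l < card H \<Longrightarrow> hel r b (dg l) (G l)" by metis
  have gen: "\<exists>c. u = (\<Sum>l<card H. smul (c l) (G l))" if u: "u \<in> U" for u
  proof -
    obtain q where "u = (\<Sum>g\<in>H. smul (q g) g)"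
      using u H(4) unfolding fm.span_finite[OF H(1)] by blast
    then have "u = (\<Sum>l<card H. smul (q (G l)) (G l))"
      using sum.reindex_bij_betw[OF G, of "\<lambda>g. smul (q g) g"] by simp
    then show ?thesis by (rule exI[of _ "\<lambda>l. q (G l)"])
  qed
  show ?thesis
  proof (intro exI[of _ "card H"] exI[of _ dg] exI[of _ G] conjI ballI allI impI)
    fix t u assume u: "u \<in> U" "hel r b t u"
    obtain c where c: "u = (\<Sum>l<card H. smul (c l) (G l))" using gen u by blast
    have "u = mcomp b t u" using mcomp_hel[OF u(2), of t] by simp
    also have "\<dots> = (\<Sum>l<card H. mcomp b t (smul (c l) (G l)))" by (subst c) (rule mcomp_sum)
    also have "\<dots> = (\<Sum>l<card H. smul (if dg l \<le> t then hcomp (t - dg l) (c l) else 0) (G l))"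
      by (rule sum.cong) (auto simp: mcomp_smul_hel[OF dg])
    finally show "\<exists>c. (\<forall>l<card H. if dg l \<le> t then is_form (t - dg l) (c l) else c l = 0)
        \<and> u = (\<Sum>l<card H. smul (c l) (G l))"
      by (intro exI[of _ "\<lambda>l. if dg l \<le> t then hcomp (t - dg l) (c l) else 0"]) simp
  qed (use GH H(2) dg gen in blast)+
qed

section \<open>Homogeneous ideals and the ascending chain condition\<close>

definition hideal :: "('v::finite, 'k::comm_ring_1) mpoly set \<Rightarrow> bool" where
  "hideal J \<longleftrightarrow> 0 \<in> J \<and> (\<forall>f\<in>J. \<forall>g\<in>J. f + g \<in> J) \<and> (\<forall>a. \<forall>f\<in>J. a * f \<in> J) \<and> (\<forall>t. \<forall>f\<in>J. hcomp t f \<in> J)"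

lemma hideal_0: "hideal J \<Longrightarrow> 0 \<in> J"
  and hideal_add: "hideal J \<Longrightarrow> f \<in> J \<Longrightarrow> g \<in> J \<Longrightarrow> f + g \<in> J"
  and hideal_mult: "hideal J \<Longrightarrow> f \<in> J \<Longrightarrow> a * f \<in> J"
  and hideal_hcomp: "hideal J \<Longrightarrow> f \<in> J \<Longrightarrow> hcomp t f \<in> J"
  by (auto simp: hideal_def)

lemma hideal_mult2: "hideal J \<Longrightarrow> f \<in> J \<Longrightarrow> f * a \<in> J"
  using hideal_mult[of J f a] by (simp add: mult.commute)

lemma hideal_uminus: "hideal J \<Longrightarrow> f \<in> J \<Longrightarrow> - f \<in> J"
  using hideal_mult[of J f "- 1"] by simp

lemma hideal_diff: "hideal J \<Longrightarrow> f \<in> J \<Longrightarrow> g \<in> J \<Longrightarrow> f - g \<in> J"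
  using hideal_add[of J f "- g"] hideal_uminus[of J g] by simp

lemma hideal_sum: "hideal J \<Longrightarrow> (\<And>a. a \<in> A \<Longrightarrow> f a \<in> J) \<Longrightarrow> sum f A \<in> J"
  by (induction A rule: infinite_finite_induct) (auto intro: hideal_0 hideal_add)

lemma hsubmod_of_hideal:
  assumes "hideal J"
  shows "hsubmod 1 (\<lambda>_. 0) {u \<in> fmod 1. u 0 \<in> J}"
  using assms
  by (auto simp: hsubmod_def fm.subspace_def fmod_def mcomp_def
      intro: hideal_0 hideal_add hideal_mult hideal_hcomp)

text \<open>The union of the chain is finitely generated, as a graded submodule of the free module
  of rank one, and finitely many generators lie in one member.\<close>

lemma hideal_acc:
  fixes J :: "nat \<Rightarrow> ('v::{finite,linorder}, 'k::field) mpoly set"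
  assumes J: "\<And>n. hideal (J n)" and inc: "\<And>n. J n \<subseteq> J (Suc n)"
  obtains n where "J (Suc n) = J n"
proof -
  have mono: "J m \<subseteq> J n" if "m \<le> n" for m n using inc that by (rule lift_Suc_mono_le)
  have UJ: "hideal (\<Union>n. J n)"
    unfolding hideal_def
  proof (intro conjI ballI allI)
    show "0 \<in> (\<Union>n. J n)" using hideal_0[OF J] by blast
    show "f + g \<in> (\<Union>n. J n)" if fg: "f \<in> (\<Union>n. J n)" "g \<in> (\<Union>n. J n)" for f g
    proof -
      obtain m where "f \<in> J m" using fg(1) by blast
      moreover obtain n where "g \<in> J n" using fg(2) by blast
      ultimately have "f \<in> J (max m n)" "g \<in> J (max m n)" using mono by (meson max.cobounded1 max.cobounded2 subsetD)+
      then show ?thesis using hideal_add[OF J] by blast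
    qed
    show "a * f \<in> (\<Union>n. J n)" if "f \<in> (\<Union>n. J n)" for a f using that hideal_mult[OF J] by blast
    show "hcomp t f \<in> (\<Union>n. J n)" if "f \<in> (\<Union>n. J n)" for t f using that hideal_hcomp[OF J] by blast
  qed
  let ?U = "{u \<in> fmod 1. u 0 \<in> (\<Union>n. J n)}"
  obtain n :: nat and dg G where G: "\<forall>l<n. G l \<in> ?U \<and> hel 1 (\<lambda>_. 0) (dg l) (G l)"
    "\<forall>u\<in>?U. \<exists>c. u = (\<Sum>l<n. smul (c l) (G l))"
    using hsubmod_generators[OF hsubmod_of_hideal[OF UJ]] by (elim exE conjE) (rule that)
  have "\<forall>l. \<exists>m. l < n \<longrightarrow> G l 0 \<in> J m" using G(1) by blast
  then obtain m where m: "\<And>l. l < n \<Longrightarrow> G l 0 \<in> J (m l)" by metis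
  define N where "N = (\<Sum>l<n. m l)"
  have GN: "G l 0 \<in> J N" if "l < n" for l
  proof -
    have "m l \<le> N" unfolding N_def using that by (intro member_le_sum) auto
    then show ?thesis using m[OF that] mono by blast
  qed
  have "J (Suc N) \<subseteq> J N"
  proof
    fix f assume f: "f \<in> J (Suc N)"
    define u where "u = (\<lambda>k::nat. if k = 0 then f else 0)"
    have "u \<in> ?U" using f by (auto simp: fmod_def u_def)
    then obtain c where c: "u = (\<Sum>l<n. smul (c l) (G l))" using G(2) by (elim ballE exE) auto
    have "f = u 0" by (simp add: u_def)
    also have "u 0 = (\<Sum>l<n. smul (c l) (G l)) 0" by (rule arg_cong[OF c])
    also have "\<dots> = (\<Sum>l<n. c l * G l 0)" by (simp only: sum_apply smul_apply)
    also have "\<dots> \<in> J N" using GN by (intro hideal_sum[OF J] hideal_mult[OF J]) simp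
    finally show "f \<in> J N" .
  qed
  then show ?thesis using that inc by blast
qed

text \<open>The relation puts the larger ideal below, so that a minimal element is an ideal maximal
  for inclusion.\<close>

lemma wf_hideal: "wf {(A, B :: ('v::{finite,linorder}, 'k::field) mpoly set). hideal A \<and> hideal B \<and> B \<subset> A}"
  unfolding wf_iff_no_infinite_down_chain
proof
  assume "\<exists>f. \<forall>i. (f (Suc i), f i) \<in> {(A, B :: ('v, 'k) mpoly set). hideal A \<and> hideal B \<and> B \<subset> A}"
  then obtain f :: "nat \<Rightarrow> ('v, 'k) mpoly set"
    where f: "\<forall>i. (f (Suc i), f i) \<in> {(A, B). hideal A \<and> hideal B \<and> B \<subset> A}" by (rule exE)
  have "hideal (f (Suc i)) \<and> hideal (f i) \<and> f i \<subset> f (Suc i)" for i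
    using f[rule_format, of i] unfolding mem_Collect_eq prod.case .
  note f' = this
  show False
    by (rule hideal_acc[of f]) (use f' in blast)+
qed

section \<open>Graded free resolutions\<close>

lemma mcomp_combination:
  assumes "\<And>l. l < n \<Longrightarrow> hel r b (dg l) (G l)"
  shows "mcomp b t (\<Sum>l<n. smul (v l) (G l)) = (\<Sum>l<n. smul (mcomp dg t v l) (G l))"
  unfolding mcomp_sum
proof (rule sum.cong)
  fix l assume "l \<in> {..<n}"
  then have "hel r b (dg l) (G l)" using assms by simp
  then show "mcomp b t (smul (v l) (G l)) = smul (mcomp dg t v l) (G l)"
    by (simp only: mcomp_smul_hel mcomp_def[of dg]) (auto simp: fun_eq_iff)
qed simp

lemma smul_add_left: "smul (a + b) u = smul a u + smul b u"
  by (rule fm.scale_left_distrib)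

lemma hsubmod_kernel:
  assumes "\<And>l. l < n \<Longrightarrow> hel r b (dg l) (G l)"
  shows "hsubmod n dg {v \<in> fmod n. (\<Sum>l<n. smul (v l) (G l)) = 0}"
  unfolding hsubmod_def
proof (intro conjI ballI allI)
  let ?K = "{v \<in> fmod n. (\<Sum>l<n. smul (v l) (G l)) = 0}"
  show "?K \<subseteq> fmod n" by blast
  show "fm.subspace ?K"
    unfolding fm.subspace_def
  proof (intro conjI ballI allI CollectI)
    show "0 \<in> fmod n" by (rule fmod_0)
    show "(\<Sum>l<n. smul ((0::nat \<Rightarrow> _) l) (G l)) = 0"
      by (rule sum.neutral) (simp add: fun_eq_iff)
    fix u v assume uv: "u \<in> ?K" "v \<in> ?K"
    show "u + v \<in> fmod n" using uv fmod_add by blast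
    have "(\<Sum>l<n. smul ((u + v) l) (G l)) = (\<Sum>l<n. smul (u l) (G l)) + (\<Sum>l<n. smul (v l) (G l))"
      by (simp only: plus_fun_apply smul_add_left sum.distrib)
    also have "\<dots> = 0" using uv by (simp only: mem_Collect_eq add_0)
    finally show "(\<Sum>l<n. smul ((u + v) l) (G l)) = 0" .
  next
    fix a u assume u: "u \<in> ?K"
    show "smul a u \<in> fmod n" using u fmod_smul by blast
    have "(\<Sum>l<n. smul (smul a u l) (G l)) = smul a (\<Sum>l<n. smul (u l) (G l))"
      by (simp only: fm.scale_sum_right fm.scale_scale smul_apply)
    also have "\<dots> = 0" using u by (simp only: mem_Collect_eq fm.scale_zero_right)
    finally show "(\<Sum>l<n. smul (smul a u l) (G l)) = 0" .
  qed
  fix u t assume u: "u \<in> ?K"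
  have "mcomp dg t u \<in> fmod n" using u hel_mcomp hel_fmod by blast
  moreover have "(\<Sum>l<n. smul (mcomp dg t u l) (G l)) = 0"
    using mcomp_combination[of n r b dg G t u] assms u by (simp only: mem_Collect_eq mcomp_0)
  ultimately show "mcomp dg t u \<in> ?K" by blast
qed

lemma free_mod_eq: "free_mod F i = fmod (rk F i)"
  by (simp add: free_mod_def fmod_def)

definition col :: "('v, 'k::comm_ring_1) graded_free_seq \<Rightarrow> nat \<Rightarrow> nat \<Rightarrow> nat \<Rightarrow> ('v, 'k) mpoly" where
  "col F i l = (\<lambda>k. if k < rk F i then entry F i k l else 0)"

lemma bd_eq_combination: "bd F i u = (\<Sum>l<rk F (Suc i). smul (u l) (col F i l))"
  by (auto simp: fun_eq_iff bd_def sum_apply col_def mult.commute)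

text \<open>Generators of the syzygy module of each step become the basis of the next free module;
  finite generation keeps all ranks finite. This existence statement gives the \<open>SOME\<close>
  in \<open>betti\<close> its meaning.\<close>

theorem exists_graded_free_resolution:
  fixes I :: "('v::{finite,linorder}, 'k::field) mpoly set"
  assumes I: "hideal I"
  shows "\<exists>F :: ('v, 'k) graded_free_seq. graded_free_resolution F I"
proof -
  \<comment> \<open>A state consists of the rank \<open>r\<close> and the degrees \<open>b\<close>
    of the current free module, the graded submodule \<open>U\<close> that the next map must have as
    image, and the columns \<open>E\<close> of the map into the previous module. Initially
    \<open>U\<close> is \<open>I\<close> inside R.\<close>
  define P where "P n = (\<lambda>(r, b, U :: (nat \<Rightarrow> ('v, 'k) mpoly) set, E :: nat \<Rightarrow> nat \<Rightarrow> ('v, 'k) mpoly). hsubmod r b U \<and> (n = 0 \<longrightarrow> r = 1 \<and> b 0 = 0 \<and> U = {u \<in> fmod 1. u 0 \<in> I}))" for n :: nat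
  define Q where "Q n = (\<lambda>(r, b, U :: (nat \<Rightarrow> ('v, 'k) mpoly) set, E :: nat \<Rightarrow> nat \<Rightarrow> ('v, 'k) mpoly) (r', b', U', E').
      (\<forall>l<r'. E' l \<in> U \<and> hel r b (b' l) (E' l))
      \<and> (\<forall>u\<in>U. \<exists>c. u = (\<Sum>l<r'. smul (c l) (E' l)))
      \<and> U' = {v \<in> fmod r'. (\<Sum>l<r'. smul (v l) (E' l)) = 0})" for n :: nat
  have "\<exists>f. \<forall>n. P n (f n) \<and> Q n (f n) (f (Suc n))"
  proof (rule dependent_nat_choice)
    show "\<exists>x. P 0 x"
      using hsubmod_of_hideal[OF I]
      by (intro exI[of _ "(1, \<lambda>_. 0, {u \<in> fmod 1. u 0 \<in> I}, undefined)"]) (simp add: P_def)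
    fix x n assume "P n x"
    moreover obtain r b U E where x: "x = (r, b, U, E)" by (cases x)
    ultimately have U: "hsubmod r b U" by (simp add: P_def)
    obtain r' :: nat and b' E' where G: "\<forall>l<r'. E' l \<in> U \<and> hel r b (b' l) (E' l)"
      "\<forall>u\<in>U. \<exists>c. u = (\<Sum>l<r'. smul (c l) (E' l))"
      using hsubmod_generators[OF U] by (elim exE conjE) (rule that)
    have "hsubmod r' b' {v \<in> fmod r'. (\<Sum>l<r'. smul (v l) (E' l)) = 0}"
      by (rule hsubmod_kernel) (use G in blast)
    then show "\<exists>y. P (Suc n) y \<and> Q n x y"
      using G unfolding x
      by (intro exI[of _ "(r', b', {v \<in> fmod r'. (\<Sum>l<r'. smul (v l) (E' l)) = 0}, E')"])
        (simp only: P_def Q_def prod.case, blast)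
  qed
  then obtain f where f: "\<forall>n. P n (f n) \<and> Q n (f n) (f (Suc n))" by (rule exE)
  define r where "r i = fst (f i)" for i
  define b where "b i = fst (snd (f i))" for i
  define U where "U i = fst (snd (snd (f i)))" for i
  define E where "E i = snd (snd (snd (f i)))" for i
  have fi: "f i = (r i, b i, U i, E i)" for i by (simp add: r_def b_def U_def E_def)
  have hU: "hsubmod (r i) (b i) (U i)" for i
    using conjunct1[OF f[rule_format, of i]] unfolding fi P_def by simp
  have init: "r 0 = 1" "b 0 0 = 0" "U 0 = {u \<in> fmod 1. u 0 \<in> I}"
    using conjunct1[OF f[rule_format, of 0]] unfolding fi P_def by simp_all
  have step: "\<forall>l<r (Suc i). E (Suc i) l \<in> U i \<and> hel (r i) (b i) (b (Suc i) l) (E (Suc i) l)"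
    "\<forall>u\<in>U i. \<exists>c. u = (\<Sum>l<r (Suc i). smul (c l) (E (Suc i) l))"
    "U (Suc i) = {v \<in> fmod (r (Suc i)). (\<Sum>l<r (Suc i). smul (v l) (E (Suc i) l)) = 0}" for i
    using conjunct2[OF f[rule_format, of i]] unfolding fi[of i] fi[of "Suc i"] Q_def prod.case by blast+
  define F :: "('v, 'k) graded_free_seq" where
    "F = \<lparr>rk = r, bdeg = b, entry = (\<lambda>i k l. E (Suc i) l k)\<rparr>"
  have F: "rk F = r" "bdeg F = b" "\<And>i k l. entry F i k l = E (Suc i) l k" by (simp_all add: F_def)
  have c: "col F i l = E (Suc i) l" if "l < r (Suc i)" for i l
  proof -
    have "E (Suc i) l \<in> fmod (r i)" using step(1) that hel_fmod by blast
    then show ?thesis by (auto simp: col_def F fmod_def fun_eq_iff not_less)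
  qed
  have bd: "bd F i u = (\<Sum>l<r (Suc i). smul (u l) (E (Suc i) l))" for i u
    unfolding bd_eq_combination F by (rule sum.cong) (simp_all only: c lessThan_iff)
  have im: "bd F i ` free_mod F (Suc i) = U i" for i
  proof
    have Us: "fm.subspace (U i)" using hU by (simp add: hsubmod_def)
    show "bd F i ` free_mod F (Suc i) \<subseteq> U i"
      unfolding bd by (intro image_subsetI fm.subspace_sum[OF Us] fm.subspace_scale[OF Us]) (use step(1) in blast)
    show "U i \<subseteq> bd F i ` free_mod F (Suc i)"
    proof
      fix u assume "u \<in> U i"
      then obtain q where q: "u = (\<Sum>l<r (Suc i). smul (q l) (E (Suc i) l))" using step(2) by blast
      define v where "v l = (if l < r (Suc i) then q l else 0)" for l
      have "u = bd F i v" unfolding q bd by (rule sum.cong) (simp_all add: v_def)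
      moreover have "v \<in> free_mod F (Suc i)" by (simp add: free_mod_def v_def F)
      ultimately show "u \<in> bd F i ` free_mod F (Suc i)" by blast
    qed
  qed
  have "graded_free_resolution F I"
    unfolding graded_free_resolution_def
  proof (intro conjI allI impI)
    show "rk F 0 = 1" "bdeg F 0 0 = 0" using init by (simp_all add: F)
    fix i k l assume kl: "k < rk F i" "l < rk F (Suc i)"
    then have "hel (r i) (b i) (b (Suc i) l) (E (Suc i) l)" using step(1) by (simp add: F)
    then show "if bdeg F i k \<le> bdeg F (Suc i) l then is_form (bdeg F (Suc i) l - bdeg F i k) (entry F i k l)
        else entry F i k l = 0"
      using kl unfolding hel_def F by metis
  next
    have "(\<lambda>u. u 0) ` U 0 = I"
    proof
      show "(\<lambda>u. u 0) ` U 0 \<subseteq> I" using init by auto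
      show "I \<subseteq> (\<lambda>u. u 0) ` U 0"
      proof
        fix g assume "g \<in> I"
        then have "(\<lambda>k::nat. if k = 0 then g else 0) \<in> U 0" by (simp add: init fmod_def)
        then show "g \<in> (\<lambda>u. u 0) ` U 0" by (rule rev_image_eqI) simp
      qed
    qed
    then show "(\<lambda>u. u 0) ` bd F 0 ` free_mod F 1 = I" using im[of 0] by simp
    show "{u \<in> free_mod F (Suc i). bd F i u = 0} = bd F (Suc i) ` free_mod F (Suc (Suc i))" for i
      unfolding im unfolding step(3) free_mod_eq bd F by (rule refl)
  qed
  then show ?thesis by blast
qed

locale resolution =
  fixes F :: "('v::{finite,linorder}, 'k::alg_closed_field) graded_free_seq"
    and I :: "('v, 'k) mpoly set"
  assumes resolution: "graded_free_resolution F I"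
begin

abbreviation deg_el :: "nat \<Rightarrow> nat \<Rightarrow> (nat \<Rightarrow> ('v, 'k) mpoly) \<Rightarrow> bool" where
  "deg_el i \<equiv> hel (rk F i) (bdeg F i)"

abbreviation Fmod :: "nat \<Rightarrow> (nat \<Rightarrow> ('v, 'k) mpoly) set" where
  "Fmod i \<equiv> fmod (rk F i)"

lemma rk_0: "rk F 0 = 1" and bdeg_0: "bdeg F 0 0 = 0"
  using resolution by (auto simp: graded_free_resolution_def)

lemma hel_col: "l < rk F (Suc i) \<Longrightarrow> deg_el i (bdeg F (Suc i) l) (col F i l)"
  using resolution unfolding graded_free_resolution_def hel_def col_def by (auto split: if_splits)

lemma bd_add: "bd F i (u + v) = bd F i u + bd F i v"
  by (simp only: bd_eq_combination plus_fun_apply smul_add_left sum.distrib)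

lemma bd_smul: "bd F i (smul a u) = smul a (bd F i u)"
  by (simp only: bd_eq_combination fm.scale_sum_right fm.scale_scale smul_apply)

lemma bd_diff: "bd F i (u - v) = bd F i u - bd F i v"
proof -
  have "bd F i u = bd F i ((u - v) + v)" by (simp only: diff_add_cancel)
  also have "\<dots> = bd F i (u - v) + bd F i v" by (rule bd_add)
  finally show ?thesis by (simp only: add_diff_cancel_right')
qed

lemma bd_fmod: "bd F i u \<in> Fmod i"
  by (simp add: bd_def fmod_def)

lemma bd_mcomp: "mcomp (bdeg F i) t (bd F i u) = bd F i (mcomp (bdeg F (Suc i)) t u)"
  unfolding bd_eq_combination by (rule mcomp_combination[OF hel_col])

lemma bd_hel:
  assumes "deg_el (Suc i) t u"
  shows "deg_el i t (bd F i u)"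
proof -
  have "u = mcomp (bdeg F (Suc i)) t u" using mcomp_hel[OF assms, of t] by simp
  then have "bd F i u = mcomp (bdeg F i) t (bd F i u)" using bd_mcomp by metis
  then show ?thesis using hel_mcomp[OF bd_fmod] by metis
qed

lemma exact:
  assumes "u \<in> Fmod (Suc i)" "bd F i u = 0"
  obtains v where "v \<in> Fmod (Suc (Suc i))" "bd F (Suc i) v = u"
proof -
  have "u \<in> {u \<in> free_mod F (Suc i). bd F i u = 0}" using assms by (simp add: free_mod_eq)
  then have "u \<in> bd F (Suc i) ` free_mod F (Suc (Suc i))"
    using resolution unfolding graded_free_resolution_def by metis
  then show ?thesis using that by (auto simp: free_mod_eq)
qed

lemma bd_bd:
  assumes "u \<in> Fmod (Suc (Suc i))"
  shows "bd F i (bd F (Suc i) u) = 0"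
proof -
  have "bd F (Suc i) u \<in> bd F (Suc i) ` free_mod F (Suc (Suc i))" using assms by (simp add: free_mod_eq)
  then have "bd F (Suc i) u \<in> {u \<in> free_mod F (Suc i). bd F i u = 0}"
    using resolution unfolding graded_free_resolution_def by metis
  then show ?thesis by simp
qed

lemma augmentation:
  assumes "a \<in> I"
  obtains v where "v \<in> Fmod 1" "bd F 0 v 0 = a"
proof -
  have "a \<in> (\<lambda>u. u 0) ` bd F 0 ` free_mod F 1"
    using assms resolution unfolding graded_free_resolution_def by metis
  then show ?thesis using that by (auto simp: free_mod_eq)
qed

lemma augmentation_mem: "v \<in> Fmod 1 \<Longrightarrow> bd F 0 v 0 \<in> I"
  using resolution unfolding graded_free_resolution_def free_mod_eq by blast

end

section \<open>Homology of a resolution restricted to a linear subspace\<close>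

definition vanv :: "('k::field ^ 'v::finite) set \<Rightarrow> (nat \<Rightarrow> ('v, 'k) mpoly) \<Rightarrow> bool" where
  "vanv V u \<longleftrightarrow> (\<forall>k. vanishes_at (u k) V)"

lemma vanv_add: "vanv V u \<Longrightarrow> vanv V v \<Longrightarrow> vanv V (u + v)"
  and vanv_diff: "vanv V u \<Longrightarrow> vanv V v \<Longrightarrow> vanv V (u - v)"
  and vanv_smul: "vanv V u \<Longrightarrow> vanv V (smul a u)"
  and vanv_0: "vanv V 0"
  by (auto simp: vanv_def vanishes_at_def)

lemma vanv_mono: "vanv V u \<Longrightarrow> W \<subseteq> V \<Longrightarrow> vanv W u"
  by (auto simp: vanv_def vanishes_at_def)

lemma vanv_smul_vanishing: "vanishes_at a V \<Longrightarrow> vanv V (smul a u)"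
  by (auto simp: vanv_def vanishes_at_def)

lemma vanv_mcomp:
  fixes V :: "('k::alg_closed_field ^ 'v::finite) set"
  assumes "vec.subspace V" "vanv V u"
  shows "vanv V (mcomp b t u)"
  using assms by (auto simp: vanv_def mcomp_def vanishes_at_0 vec.subspace_scale intro!: vanishes_at_hcomp)

lemma vanv_on_hyperplane:
  fixes V :: "('k::field ^ 'v::finite) set"
  assumes V: "vec.subspace V" and l: "is_form 1 l" and v: "v \<in> V" "eval_poly l v = 1"
    and u: "vanv (ker_on V l) u" "u \<in> fmod r"
  obtains z where "z \<in> fmod r" "vanv V (u - smul l z)"
proof -
  have "\<exists>g. vanishes_at (u k - l * g) V \<and> (r \<le> k \<longrightarrow> g = 0)" for k
  proof (cases "r \<le> k")
    case True
    then show ?thesis using u(2) by (auto simp: fmod_def vanishes_at_0)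
  next
    case False
    then show ?thesis
      using vanishes_on_hyperplane[OF V l v, of "u k"] u(1) unfolding vanv_def by metis
  qed
  then obtain z where z: "\<And>k. vanishes_at (u k - l * z k) V" "\<And>k. r \<le> k \<Longrightarrow> z k = 0" by metis
  show ?thesis by (rule that[of z]) (use z in \<open>auto simp: fmod_def vanv_def\<close>)
qed

lemma vanv_cancel:
  fixes V :: "('k::alg_closed_field ^ 'v::finite) set"
  assumes "vec.subspace V" "is_form 1 l" "v \<in> V" "eval_poly l v \<noteq> 0" "vanv V (smul l u)"
  shows "vanv V u"
  using assms vanishes_at_cancel[OF assms(1-4)] unfolding vanv_def smul_apply by blast

text \<open>Realizes \<open>V\<close> as a hyperplane section of a space one dimension larger, so
  that an induction can descend on the codimension.\<close>

lemma exists_superspace: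
  fixes V :: "('k::field ^ 'v::finite) set"
  assumes V: "vec.subspace V" "V \<noteq> UNIV"
  obtains V1 l v where "vec.subspace V1" "is_form 1 l" "v \<in> V1" "eval_poly l v = 1" "V = ker_on V1 l"
    "vec.dim V1 = Suc (vec.dim V)"
proof -
  obtain v where v: "v \<notin> V" using V by blast
  obtain l where l: "is_form 1 l" "vanishes_at l V" "eval_poly l v = 1"
    using exists_linform[OF V(1) v] by blast
  define V1 where "V1 = vec.span (insert v V)"
  have sV: "vec.span V = V" using V(1) by (simp only: vec.span_eq_iff)
  have sub: "vec.subspace V1" "v \<in> V1" "V \<subseteq> V1"
    by (auto simp: V1_def vec.subspace_span intro: vec.span_base)
  have "ker_on V1 l \<subseteq> V"
  proof
    fix x assume x: "x \<in> ker_on V1 l"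
    then obtain c where c: "x - c *s v \<in> V"
      by (auto simp: V1_def vec.span_breakdown_eq sV)
    then have "eval_poly l (x - c *s v) = 0" using l(2) unfolding vanishes_at_def by blast
    then have "c = 0" using x l(3) by (simp add: linform_diff[OF l(1)] linform_scale[OF l(1)])
    then show "x \<in> V" using c by simp
  qed
  moreover have "V \<subseteq> ker_on V1 l" using sub(3) l(2) by (auto simp: vanishes_at_def)
  ultimately have VK: "V = ker_on V1 l" by (rule subset_antisym[rotated])
  then have "vec.dim V1 = Suc (vec.dim V)" using dim_ker_on[OF sub(1) l(1) sub(2)] l(3) by simp
  then show ?thesis using that sub l VK by blast
qed

text \<open>If I + I(V) contains all forms of degree at least s, then I^c + I(V) contains those of
  degree at least c s. The set \<open>K\<close> stands for any ideal containing I(V) and the c-fold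
  products; the induction on \<open>c\<close> splits off a factor of degree \<open>s\<close> and
  replaces \<open>K\<close> by its colon set with respect to some \<open>a\<close> in
  \<open>I\<close>.\<close>

lemma form_mem_of_products:
  fixes K :: "('v::finite, 'k::field) mpoly set"
  assumes "\<And>t f. s \<le> t \<Longrightarrow> is_form t f \<Longrightarrow> \<exists>a\<in>I. \<exists>b. vanishes_at b V \<and> f = a + b"
    and "0 \<in> K" "\<And>f g. f \<in> K \<Longrightarrow> g \<in> K \<Longrightarrow> f + g \<in> K" "\<And>a f. f \<in> K \<Longrightarrow> a * f \<in> K"
    and "\<And>b. vanishes_at b V \<Longrightarrow> b \<in> K"
    and "\<And>as. length as = c \<Longrightarrow> set as \<subseteq> I \<Longrightarrow> prod_list as \<in> K"
    and "is_form t f" "c * s \<le> t"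
  shows "f \<in> K"
  using assms(2-8)
proof (induction c arbitrary: K f t)
  case 0
  have "1 \<in> K" using 0(5)[of "[]"] by simp
  then show ?case using 0(3)[of 1 f] by simp
next
  case (Suc c)
  have t: "is_form (s + (t - s)) f" "c * s \<le> t - s" using Suc.prems by auto
  show ?case
  proof (rule form_split[OF t(1) Suc.prems(1,2)])
    fix m g :: "('v, 'k) mpoly" assume mg: "is_form s m" "is_form (t - s) g"
    obtain a b where ab: "a \<in> I" "vanishes_at b V" "m = a + b" using assms(1)[OF order_refl mg(1)] by blast
    have "g \<in> {h. a * h \<in> K}"
    proof (rule Suc.IH[OF _ _ _ _ _ mg(2) t(2)])
      show "0 \<in> {h. a * h \<in> K}" using Suc.prems(1) by simp
      show "f + g \<in> {h. a * h \<in> K}" if "f \<in> {h. a * h \<in> K}" "g \<in> {h. a * h \<in> K}" for f g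
        using that Suc.prems(2) by (simp add: distrib_left)
      show "q * f \<in> {h. a * h \<in> K}" if "f \<in> {h. a * h \<in> K}" for q f
        using that Suc.prems(3)[of "a * f" q] by (simp add: mult.left_commute)
      show "b \<in> {h. a * h \<in> K}" if "vanishes_at b V" for b
        using that Suc.prems(3)[OF Suc.prems(4)] by simp
      show "prod_list as \<in> {h. a * h \<in> K}" if "length as = c" "set as \<subseteq> I" for as
        using that ab(1) Suc.prems(5)[of "a # as"] by simp
    qed
    then have "a * g \<in> K" by simp
    moreover have "g * b \<in> K" using Suc.prems(3)[OF Suc.prems(4)[OF ab(2)]] .
    ultimately have "a * g + g * b \<in> K" by (rule Suc.prems(2))
    then show "m * g \<in> K" by (simp add: ab(3) algebra_simps)
  qed
qed

text \<open>
  For a linear subspace \<open>V\<close>, cycles modulo boundaries is the homology of \<open>F \<otimes> R/I(V)\<close>, lifted to \<open>F\<close>: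
  both are submodules of \<open>F\<^sub>j\<close> containing \<open>I(V)F\<^sub>j\<close>, the vectors whose coordinates vanish on \<open>V\<close>.
\<close>

context resolution
begin

definition cyc :: "('k, 'v) vec set \<Rightarrow> nat \<Rightarrow> (nat \<Rightarrow> ('v, 'k) mpoly) set" where
  "cyc V j = {u \<in> Fmod j. \<forall>i. j = Suc i \<longrightarrow> vanv V (bd F i u)}"

definition bnd :: "('k, 'v) vec set \<Rightarrow> nat \<Rightarrow> (nat \<Rightarrow> ('v, 'k) mpoly) set" where
  "bnd V j = {bd F j g + h | g h. g \<in> Fmod (Suc j) \<and> h \<in> Fmod j \<and> vanv V h}"

lemma bndI: "g \<in> Fmod (Suc j) \<Longrightarrow> h \<in> Fmod j \<Longrightarrow> vanv V h \<Longrightarrow> u = bd F j g + h \<Longrightarrow> u \<in> bnd V j"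
  unfolding bnd_def by blast

lemma bndE:
  assumes "u \<in> bnd V j"
  obtains g h where "g \<in> Fmod (Suc j)" "h \<in> Fmod j" "vanv V h" "u = bd F j g + h"
  using assms unfolding bnd_def by blast

lemma bd_0: "bd F i 0 = 0"
  by (simp add: bd_def fun_eq_iff)

lemma vanv_bd: "vanv V u \<Longrightarrow> vanv V (bd F i u)"
  by (auto simp: vanv_def vanishes_at_def bd_def)

lemma subspace_bnd: "fm.subspace (bnd V j)"
  unfolding fm.subspace_def
proof (intro conjI ballI allI)
  show "0 \<in> bnd V j"
  proof (rule bndI)
    show "0 = bd F j 0 + 0" by (simp only: bd_0 add_0)
  qed (simp_all only: fmod_0 vanv_0)
  fix u v assume "u \<in> bnd V j" "v \<in> bnd V j"
  then obtain g h g' h' where *: "g \<in> Fmod (Suc j)" "h \<in> Fmod j" "vanv V h" "u = bd F j g + h"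
    "g' \<in> Fmod (Suc j)" "h' \<in> Fmod j" "vanv V h'" "v = bd F j g' + h'" by (metis bndE)
  show "u + v \<in> bnd V j"
  proof (rule bndI)
    show "u + v = bd F j (g + g') + (h + h')" unfolding * bd_add by (simp only: ac_simps)
  qed (use * in \<open>blast intro: fmod_add vanv_add\<close>)+
next
  fix u a assume "u \<in> bnd V j"
  then obtain g h where *: "g \<in> Fmod (Suc j)" "h \<in> Fmod j" "vanv V h" "u = bd F j g + h" by (metis bndE)
  show "smul a u \<in> bnd V j"
  proof (rule bndI)
    show "smul a u = bd F j (smul a g) + smul a h" unfolding * bd_smul by (rule fm.scale_right_distrib)
  qed (use * in \<open>blast intro: fmod_smul vanv_smul\<close>)+
qed

lemma vanv_imp_bnd: "u \<in> Fmod j \<Longrightarrow> vanv V u \<Longrightarrow> u \<in> bnd V j"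
  by (rule bndI[of 0]) (simp_all only: fmod_0 bd_0 add_0)

lemma hsubmod_cyc:
  assumes V: "vec.subspace V"
  shows "hsubmod (rk F j) (bdeg F j) (cyc V j)"
  unfolding hsubmod_def fm.subspace_def
proof (intro conjI ballI allI)
  show "cyc V j \<subseteq> Fmod j" by (auto simp: cyc_def)
  show "0 \<in> cyc V j" by (simp only: cyc_def mem_Collect_eq fmod_0 vanv_0 bd_0) simp
  show "u + v \<in> cyc V j" if "u \<in> cyc V j" "v \<in> cyc V j" for u v
    using that by (auto simp only: cyc_def mem_Collect_eq bd_add intro: fmod_add vanv_add)
  show "smul a u \<in> cyc V j" if "u \<in> cyc V j" for u a
    using that by (auto simp only: cyc_def mem_Collect_eq bd_smul intro: fmod_smul vanv_smul)
  show "mcomp (bdeg F j) t u \<in> cyc V j" if u: "u \<in> cyc V j" for u t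
    unfolding cyc_def
  proof (intro CollectI conjI allI impI)
    show "mcomp (bdeg F j) t u \<in> Fmod j" using u unfolding cyc_def by (intro hel_fmod[OF hel_mcomp]) blast
    fix i assume j: "j = Suc i"
    then have "vanv V (bd F i u)" using u by (simp add: cyc_def)
    then show "vanv V (bd F i (mcomp (bdeg F j) t u))"
      unfolding j bd_mcomp[symmetric] by (rule vanv_mcomp[OF V])
  qed
qed

lemma bnd_homogeneous:
  assumes V: "vec.subspace V" and u: "u \<in> bnd V j" "deg_el j t u"
  obtains g h where "deg_el (Suc j) t g" "h \<in> Fmod j" "vanv V h" "u = bd F j g + h"
proof -
  obtain g h where *: "g \<in> Fmod (Suc j)" "h \<in> Fmod j" "vanv V h" "u = bd F j g + h" using u(1) by (rule bndE)
  have "u = mcomp (bdeg F j) t u" using mcomp_hel[OF u(2), of t] by simp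
  also have "\<dots> = bd F j (mcomp (bdeg F (Suc j)) t g) + mcomp (bdeg F j) t h"
    unfolding *(4) mcomp_add bd_mcomp ..
  finally show ?thesis
    by (rule that[rotated -1]) (use * hel_mcomp hel_fmod vanv_mcomp[OF V] in blast)+
qed

text \<open>Vanishing on the whole space means being zero, so this is exactness of \<open>F\<close>.
  It ends the induction on the codimension in positive homological degree.\<close>

lemma cyc_UNIV_imp_bnd:
  assumes "u \<in> cyc UNIV (Suc i)"
  shows "u \<in> bnd V (Suc i)"
proof -
  have "bd F i u k = 0" for k
    using assms by (intro eval_zero_imp_zero) (simp add: cyc_def vanv_def vanishes_at_def)
  then have "bd F i u = 0" by (simp add: fun_eq_iff)
  then obtain v where v: "v \<in> Fmod (Suc (Suc i))" "bd F (Suc i) v = u"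
    using exact assms unfolding cyc_def by blast
  show ?thesis by (rule bndI[OF v(1) fmod_0 vanv_0]) (simp only: v(2) add_0_right)
qed

text \<open>
  A power of \<open>I\<close> kills the homology: \<open>I\<close> kills that of \<open>F\<close>, and the long exact sequence of a hyperplane
  section \<open>V = V\<^sub>1 \<inter> {l = 0}\<close> places \<open>H\<^sub>j(V)\<close> between \<open>H\<^sub>j(V\<^sub>1)\<close> and \<open>H\<^sub>j\<^sub>-\<^sub>1(V\<^sub>1)\<close>.
\<close>

lemma power_kills_homology:
  assumes "vec.subspace V"
  shows "\<exists>c. \<forall>as. length as = c \<longrightarrow> set as \<subseteq> I \<longrightarrow> (\<forall>u\<in>cyc V j. smul (prod_list as) u \<in> bnd V j)"
  using assms
proof (induction "CARD('v) - vec.dim V" arbitrary: V j rule: less_induct)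
  case less
  note V = less.prems
  show ?case
  proof (cases j)
    case 0
    \<comment> \<open>\<open>I\<close> kills R/I: if \<open>a\<close> is the image of
      \<open>v\<close>, then \<open>smul a u\<close> is the image of \<open>smul (u 0) v\<close>, as
      the free module in homological degree 0 has rank one.\<close>
    have "smul a u \<in> bnd V 0" if au: "a \<in> I" "u \<in> cyc V 0" for a u
    proof -
      obtain v where v: "v \<in> Fmod 1" "bd F 0 v 0 = a" using augmentation au(1) by blast
      have "smul a u = bd F 0 (smul (u 0) v) + 0"
      proof
        fix k
        show "smul a u k = (bd F 0 (smul (u 0) v) + 0) k"
        proof (cases k)
          case 0
          then show ?thesis using v(2) by (simp add: bd_smul mult.commute)
        next
          case (Suc k')
          then have "u k = 0" "bd F 0 v k = 0" using au(2) bd_fmod[of 0 v] by (auto simp: cyc_def fmod_def rk_0)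
          then show ?thesis by (simp add: bd_smul)
        qed
      qed
      then show ?thesis by (rule bndI[rotated 3]) (use v(1) in \<open>simp_all only: fmod_smul fmod_0 vanv_0 One_nat_def\<close>)
    qed
    then have "smul (prod_list as) u \<in> bnd V j" if "length as = 1" "set as \<subseteq> I" "u \<in> cyc V j" for as u
      using that 0 by (cases as) auto
    then show ?thesis by blast
  next
    case (Suc i)
    show ?thesis
    proof (cases "V = UNIV")
      case True
      then have "smul (prod_list as) u \<in> bnd V j" if "length as = 0" "u \<in> cyc V j" for as u
        using that cyc_UNIV_imp_bnd[of u i V] Suc by (simp add: smul_def)
      then show ?thesis by blast
    next
      case False
      obtain V1 l v where V1: "vec.subspace V1" "is_form 1 l" "v \<in> V1" "eval_poly l v = 1"
        "V = ker_on V1 l" "vec.dim V1 = Suc (vec.dim V)" by (rule exists_superspace[OF V False])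
      have "vec.dim V1 \<le> CARD('v)" by (rule dim_subset_UNIV_cart_gen)
      then have m: "CARD('v) - vec.dim V1 < CARD('v) - vec.dim V" unfolding V1(6) by linarith
      obtain c1 where c1: "\<forall>as. length as = c1 \<longrightarrow> set as \<subseteq> I \<longrightarrow> (\<forall>u\<in>cyc V1 i. smul (prod_list as) u \<in> bnd V1 i)"
        using less.hyps[OF m V1(1), of i] by (rule exE)
      obtain c2 where c2: "\<forall>as. length as = c2 \<longrightarrow> set as \<subseteq> I \<longrightarrow> (\<forall>u\<in>cyc V1 j. smul (prod_list as) u \<in> bnd V1 j)"
        using less.hyps[OF m V1(1), of j] by (rule exE)
      have "smul (prod_list as) u \<in> bnd V j" if as: "length as = c1 + c2" "set as \<subseteq> I" and u: "u \<in> cyc V j" for as u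
      proof -
        define a1 where "a1 = prod_list (take c1 as)"
        define a2 where "a2 = prod_list (drop c1 as)"
        have a: "prod_list as = a1 * a2"
          unfolding a1_def a2_def by (simp only: prod_list.append[symmetric] append_take_drop_id)
        have k1: "smul a1 w \<in> bnd V1 i" if "w \<in> cyc V1 i" for w
          unfolding a1_def by (rule c1[rule_format, OF _ _ that]) (use as set_take_subset[of c1 as] in auto)
        have k2: "smul a2 w \<in> bnd V1 j" if "w \<in> cyc V1 j" for w
          unfolding a2_def by (rule c2[rule_format, OF _ _ that]) (use as set_drop_subset[of c1 as] in auto)
        have uF: "u \<in> Fmod j" and "vanv (ker_on V1 l) (bd F i u)" using u Suc V1(5) by (auto simp: cyc_def)
        \<comment> \<open>\<open>z\<close> represents the image of \<open>u\<close> under the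
          connecting map: modulo I(V1) the boundary of \<open>u\<close> is divisible by
          \<open>l\<close>, with quotient \<open>z\<close>. It is a cycle because \<open>l\<close>
          can be cancelled.\<close>
        then obtain z where z: "z \<in> Fmod i" "vanv V1 (bd F i u - smul l z)"
          using vanv_on_hyperplane[OF V1(1-4) _ bd_fmod] by blast
        have "z \<in> cyc V1 i"
          unfolding cyc_def
        proof (intro CollectI conjI allI impI z(1))
          fix i' assume i: "i = Suc i'"
          have "bd F i' (bd F i u - smul l z) = bd F i' (bd F i u) - smul l (bd F i' z)"
            by (simp only: bd_diff bd_smul)
          also have "bd F i' (bd F i u) = 0" using bd_bd uF Suc i by simp
          finally have e: "smul l (bd F i' z) = 0 - bd F i' (bd F i u - smul l z)" by (simp only: diff_0 minus_minus)
          have "vanv V1 (smul l (bd F i' z))" unfolding e by (intro vanv_diff vanv_0 vanv_bd z(2))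
          then show "vanv V1 (bd F i' z)" using vanv_cancel[OF V1(1-3)] V1(4) by simp
        qed
        then obtain g h where gh: "g \<in> Fmod j" "h \<in> Fmod i" "vanv V1 h" "smul a1 z = bd F i g + h"
          using k1 bndE Suc by metis
        \<comment> \<open>Multiplication by \<open>a1\<close> kills the class of \<open>z\<close>,
          so subtracting \<open>smul l g\<close> turns \<open>smul a1 u\<close> into a cycle over
          \<open>V1\<close>; on \<open>V\<close> the correction is invisible because
          \<open>l\<close> vanishes there.\<close>
        define y where "y = smul a1 u - smul l g"
        have "bd F i y = smul a1 (bd F i u) - smul l (bd F i g)" by (simp only: y_def bd_diff bd_smul)
        also have "\<dots> = smul a1 (bd F i u - smul l z) + smul l h"
        proof
          fix k
          have "a1 * z k = bd F i g k + h k" using fun_cong[OF gh(4), of k] by simp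
          then have "l * (a1 * z k) = l * (bd F i g k + h k)" by simp
          then show "(smul a1 (bd F i u) - smul l (bd F i g)) k = (smul a1 (bd F i u - smul l z) + smul l h) k"
            by (simp add: algebra_simps)
        qed
        finally have "vanv V1 (bd F i y)" using z(2) gh(3) by (simp only: vanv_add vanv_smul)
        then have "y \<in> cyc V1 j"
          using Suc uF gh(1) by (auto simp: cyc_def y_def intro!: fmod_diff fmod_smul)
        then obtain g2 h2 where gh2: "g2 \<in> Fmod (Suc j)" "h2 \<in> Fmod j" "vanv V1 h2" "smul a2 y = bd F j g2 + h2"
          using k2 bndE by metis
        show ?thesis
        proof (rule bndI[OF gh2(1)])
          show "h2 + smul l (smul a2 g) \<in> Fmod j" by (intro fmod_add gh2 fmod_smul gh)
          have "vanishes_at l V" using V1(5) by (simp add: vanishes_at_def)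
          then show "vanv V (h2 + smul l (smul a2 g))"
            using vanv_mono[OF gh2(3), of V] V1(5) by (intro vanv_add vanv_smul_vanishing) auto
          show "smul (prod_list as) u = bd F j g2 + (h2 + smul l (smul a2 g))"
          proof
            fix k
            have "bd F j g2 k + h2 k = a2 * (a1 * u k - l * g k)" using fun_cong[OF gh2(4), of k] by (simp add: y_def)
            then show "smul (prod_list as) u k = (bd F j g2 + (h2 + smul l (smul a2 g))) k"
              by (simp add: a add.assoc[symmetric]) (simp add: algebra_simps)
          qed
        qed
      qed
      then show ?thesis by blast
    qed
  qed
qed

text \<open>Forms of degree at least c s kill the homology, since they lie in I^c + I(V). The cycles
  have finitely many homogeneous generators, of degrees \<open>dg l\<close>; beyond c s plus the sum
  of these degrees, every coefficient has degree at least c s.\<close>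

lemma homology_bounded:
  assumes V: "vec.subspace V"
    and fin: "\<And>t f. s \<le> t \<Longrightarrow> is_form t f \<Longrightarrow> \<exists>a\<in>I. \<exists>b. vanishes_at b V \<and> f = a + b"
  obtains t1 where "\<And>t u. t1 \<le> t \<Longrightarrow> u \<in> cyc V j \<Longrightarrow> deg_el j t u \<Longrightarrow> u \<in> bnd V j"
proof -
  obtain c where c: "\<And>as u. length as = c \<Longrightarrow> set as \<subseteq> I \<Longrightarrow> u \<in> cyc V j \<Longrightarrow> smul (prod_list as) u \<in> bnd V j"
    using power_kills_homology[OF V] by metis
  have kill: "smul f u \<in> bnd V j" if "is_form t f" "c * s \<le> t" and u: "u \<in> cyc V j" for t f u
  proof -
    have "f \<in> {f. smul f u \<in> bnd V j}"
    proof (rule form_mem_of_products[where s = s and I = I and V = V, OF _ _ _ _ _ _ that(1,2)])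
      show "\<exists>a\<in>I. \<exists>b. vanishes_at b V \<and> f = a + b" if "s \<le> t" "is_form t f" for t f using fin that .
      show "0 \<in> {f. smul f u \<in> bnd V j}"
        using fm.subspace_0[OF subspace_bnd] by (simp add: smul_def zero_fun_def)
      show "f + g \<in> {f. smul f u \<in> bnd V j}" if "f \<in> {f. smul f u \<in> bnd V j}" "g \<in> {f. smul f u \<in> bnd V j}" for f g
        using that fm.subspace_add[OF subspace_bnd] by (simp only: smul_add_left mem_Collect_eq)
      show "a * f \<in> {f. smul f u \<in> bnd V j}" if "f \<in> {f. smul f u \<in> bnd V j}" for a f
        using that fm.subspace_scale[OF subspace_bnd] by (simp only: fm.scale_scale[symmetric] mem_Collect_eq)
      show "b \<in> {f. smul f u \<in> bnd V j}" if "vanishes_at b V" for b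
        using that u by (auto simp: cyc_def intro!: vanv_imp_bnd vanv_smul_vanishing fmod_smul)
      show "prod_list as \<in> {f. smul f u \<in> bnd V j}" if "length as = c" "set as \<subseteq> I" for as
        using c that u by blast
    qed
    then show ?thesis by simp
  qed
  obtain n :: nat and dg G where G: "\<forall>l<n. G l \<in> cyc V j \<and> deg_el j (dg l) (G l)"
    "\<forall>t. \<forall>u\<in>cyc V j. deg_el j t u \<longrightarrow> (\<exists>c. (\<forall>l<n. if dg l \<le> t then is_form (t - dg l) (c l) else c l = 0)
        \<and> u = (\<Sum>l<n. smul (c l) (G l)))"
    using hsubmod_generators[OF hsubmod_cyc[OF V, of j]] by (elim exE conjE) (rule that)
  show ?thesis
  proof (rule that[of "c * s + (\<Sum>l<n. dg l)"])
    fix t u assume t: "c * s + (\<Sum>l<n. dg l) \<le> t" and u: "u \<in> cyc V j" "deg_el j t u"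
    obtain q where q: "\<forall>l<n. if dg l \<le> t then is_form (t - dg l) (q l) else q l = 0"
      "u = (\<Sum>l<n. smul (q l) (G l))" using G(2) u by blast
    have "smul (q l) (G l) \<in> bnd V j" if l: "l < n" for l
    proof -
      have "dg l \<le> (\<Sum>l<n. dg l)" by (rule member_le_sum) (use l in auto)
      then have "is_form (t - dg l) (q l)" "c * s \<le> t - dg l" using q(1) l t by fastforce+
      then show ?thesis using kill G(1) l by blast
    qed
    then show "u \<in> bnd V j" unfolding q(2) by (intro fm.subspace_sum[OF subspace_bnd]) simp
  qed
qed

text \<open>
  If \<open>H\<^sub>j(V)\<close> has a nonzero element \<open>f\<close> of highest degree \<open>t\<close>, then \<open>l f = 0\<close>, so that \<open>f\<close> is the image of a
  nonzero element of degree \<open>t + 1\<close> under the connecting map from \<open>H\<^sub>j\<^sub>+\<^sub>1(V \<inter> {l = 0})\<close>.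
\<close>

lemma homology_degree_bound:
  assumes V: "vec.subspace V" "vec.dim V = q"
    and fin: "\<And>t f. s \<le> t \<Longrightarrow> is_form t f \<Longrightarrow> \<exists>a\<in>I. \<exists>b. vanishes_at b V \<and> f = a + b"
    and tor: "\<And>t u. t0 + q \<le> t \<Longrightarrow> u \<in> cyc {0} (j + q) \<Longrightarrow> deg_el (j + q) t u \<Longrightarrow> u \<in> bnd {0} (j + q)"
    and "t0 \<le> t" "u \<in> cyc V j" "deg_el j t u"
  shows "u \<in> bnd V j"
  using assms
proof (induction q arbitrary: V j t0 t u)
  case 0
  \<comment> \<open>Nothing is left to cut, and the claim is the Tor hypothesis.\<close>
  then have "V = {0}" using vec.dim_eq_0[of V] vec.subspace_0[of V] by auto
  then show ?case using 0 by simp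
next
  case (Suc q)
  obtain l v where l: "is_form 1 l" "v \<in> V" "eval_poly l v = 1" "vec.dim (ker_on V l) = q"
    by (rule exists_linform_on[OF Suc.prems(1,2)])
  let ?W = "ker_on V l"
  have W: "vec.subspace ?W" by (rule subspace_ker_on[OF Suc.prems(1) l(1)])
  \<comment> \<open>The sums \<open>j + q\<close> and \<open>t0 + q\<close> are unchanged when
    \<open>q\<close> drops by one while \<open>j\<close> and \<open>t0\<close> grow by one, so the
    Tor hypothesis carries over to the section.\<close>
  have D: "w \<in> bnd ?W (Suc j)" if "t0 + 1 \<le> t'" "w \<in> cyc ?W (Suc j)" "deg_el (Suc j) t' w" for t' w
  proof (rule Suc.IH[OF W l(4) _ _ that])
    show "\<exists>a\<in>I. \<exists>b. vanishes_at b ?W \<and> f = a + b" if "s \<le> t" "is_form t f" for t f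
      using Suc.prems(3)[OF that] unfolding vanishes_at_def by blast
    show "u \<in> bnd {0} (Suc j + q)" if "t0 + 1 + q \<le> t" "u \<in> cyc {0} (Suc j + q)" "deg_el (Suc j + q) t u" for t u
      using Suc.prems(4)[of t u] that by simp
  qed
  obtain t1 where t1: "\<And>t u. t1 \<le> t \<Longrightarrow> u \<in> cyc V j \<Longrightarrow> deg_el j t u \<Longrightarrow> u \<in> bnd V j"
    by (rule homology_bounded[OF Suc.prems(1), of s j]) (use Suc.prems(3) in blast)+
  \<comment> \<open>Descending induction on \<open>t\<close>, starting at the degree
    \<open>t1\<close> from which the homology vanishes.\<close>
  show ?case using Suc.prems(5-7)
  proof (induction "t1 - t" arbitrary: t u rule: less_induct)
    case less
    show ?case
    proof (cases "t1 \<le> t")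
      case True
      then show ?thesis using t1 less.prems by blast
    next
      case False
      have uF: "u \<in> Fmod j" using less.prems(2) by (simp add: cyc_def)
      have "smul l u \<in> cyc V j"
        using less.prems(2) by (auto simp: cyc_def bd_smul intro!: fmod_smul vanv_smul)
      moreover have hlu: "deg_el j (Suc t) (smul l u)" using hel_smul[OF l(1) less.prems(3)] by simp
      \<comment> \<open>In degree \<open>t + 1\<close> the class of \<open>smul l u\<close> is
        already zero. The vector \<open>g\<close> that bounds it is a cycle over the section, where
        \<open>l\<close> vanishes.\<close>
      ultimately have "smul l u \<in> bnd V j" using less.hyps[of "Suc t" "smul l u"] False less.prems(1) by simp
      then obtain g h where gh: "deg_el (Suc j) (Suc t) g" "h \<in> Fmod j" "vanv V h" "smul l u = bd F j g + h"
        using bnd_homogeneous[OF Suc.prems(1) _ hlu] by metis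
      have e: "bd F j g = smul l u - h" by (simp only: gh(4) add_diff_cancel_right')
      have "vanv ?W (bd F j g)" unfolding e
      proof (intro vanv_diff vanv_smul_vanishing)
        show "vanishes_at l ?W" by (simp add: vanishes_at_def)
        show "vanv ?W h" by (rule vanv_mono[OF gh(3)]) auto
      qed
      then have "g \<in> cyc ?W (Suc j)" using hel_fmod[OF gh(1)] by (simp add: cyc_def)
      then have "g \<in> bnd ?W (Suc j)" using D[OF _ _ gh(1)] less.prems(1) by simp
      then obtain g' h' where gh': "g' \<in> Fmod (Suc (Suc j))" "h' \<in> Fmod (Suc j)" "vanv ?W h'" "g = bd F (Suc j) g' + h'"
        by (rule bndE)
      \<comment> \<open>\<open>g\<close> bounds over the section, so modulo boundaries and I(V) it
        is \<open>l\<close> times \<open>z\<close>. Hence \<open>u\<close> and the boundary of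
        \<open>z\<close>, both multiplied by \<open>l\<close>, agree modulo I(V), and
        \<open>l\<close> cancels.\<close>
      obtain z where z: "z \<in> Fmod (Suc j)" "vanv V (h' - smul l z)"
        using vanv_on_hyperplane[OF Suc.prems(1) l(1-3) gh'(3,2)] by blast
      have "bd F j (h' - smul l z) = bd F j g - smul l (bd F j z)"
        unfolding gh'(4) bd_add bd_diff bd_smul bd_bd[OF gh'(1)] by (simp only: add_0)
      then have "smul l (u - bd F j z) = bd F j (h' - smul l z) + h"
        unfolding e by (simp add: fun_eq_iff algebra_simps)
      moreover have "vanv V (bd F j (h' - smul l z) + h)" by (intro vanv_add vanv_bd z gh)
      ultimately have "vanv V (smul l (u - bd F j z))" by simp
      then have "vanv V (u - bd F j z)" using vanv_cancel[OF Suc.prems(1) l(1,2)] l(3) by simp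
      then show ?thesis
      proof (rule bndI[OF z(1), rotated])
        show "u - bd F j z \<in> Fmod j" by (intro fmod_diff uF bd_fmod)
        show "u = bd F j z + (u - bd F j z)" by (simp add: fun_eq_iff)
      qed
    qed
  qed
qed

text \<open>The case j = 0 of the degree bound: every element of F_0 = R is a cycle, and the
  boundaries are I + I(V).\<close>

theorem quotient_degree_bound:
  assumes V: "vec.subspace V" "vec.dim V = p"
    and fin: "\<And>t f. s \<le> t \<Longrightarrow> is_form t f \<Longrightarrow> \<exists>a\<in>I. \<exists>b. vanishes_at b V \<and> f = a + b"
    and tor: "\<And>t u. d + p \<le> t \<Longrightarrow> u \<in> cyc {0} p \<Longrightarrow> deg_el p t u \<Longrightarrow> u \<in> bnd {0} p"
    and f: "d \<le> t" "is_form t f"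
  shows "\<exists>a\<in>I. \<exists>b. vanishes_at b V \<and> f = a + b"
proof -
  define u where "u = (\<lambda>k::nat. if k = 0 then f else 0)"
  have h: "deg_el 0 t u" using f by (simp add: hel_def u_def rk_0 bdeg_0)
  then have c: "u \<in> cyc V 0" using hel_fmod by (simp add: cyc_def)
  have "u \<in> bnd V 0"
    by (rule homology_degree_bound[where s = s and ?t0.0 = d, OF V _ _ f(1) c h]) (use fin tor in simp_all)
  then obtain g w where gw: "g \<in> Fmod (Suc 0)" "vanv V w" "u = bd F 0 g + w" by (metis bndE)
  have "u 0 = bd F 0 g 0 + w 0" using fun_cong[OF gw(3), of 0] by simp
  then have "f = bd F 0 g 0 + w 0" by (simp add: u_def)
  then show ?thesis using augmentation_mem gw unfolding vanv_def One_nat_def by blast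
qed

text \<open>Over the zero subspace, vanishing means having zero constant term, so
  \<open>cyc {0}\<close> and \<open>bnd {0}\<close> describe the homology of F \<otimes> k. A
  preimage there is lifted by constant polynomials.\<close>

lemma tensor_acyclic_imp_bnd:
  assumes ac: "tensor_cycles F (Suc i) t \<subseteq> tensor_boundaries F (Suc i) t"
    and u: "u \<in> cyc {0} (Suc i)" "deg_el (Suc i) t u"
  shows "u \<in> bnd {0} (Suc i)"
proof -
  let ?j = "Suc i"
  define w where "w k = lookup (u k) 0" for k
  have "w k = 0" if "\<not> (k < rk F ?j \<and> bdeg F ?j k = t)" for k
    using hel_constant_term[OF u(2) that] by (simp add: w_def eval_at_0)
  then have wp: "w \<in> tensor_piece F ?j t" by (simp add: tensor_piece_def)
  have "tensor_bd F i w k = 0" for k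
  proof -
    have "eval_poly (bd F i u k) 0 = 0" using u(1) by (simp add: cyc_def vanv_def vanishes_at_def)
    moreover have "eval_poly (bd F i u k) 0 = tensor_bd F i w k"
      by (simp add: bd_def tensor_bd_def w_def eval_at_0[symmetric])
    ultimately show ?thesis by simp
  qed
  then have "tensor_bd F i w = 0" by (simp add: fun_eq_iff)
  then have "w \<in> tensor_cycles F ?j t" using wp by (simp add: tensor_cycles_def)
  then obtain v where v: "w = tensor_bd F ?j v" "v \<in> tensor_piece F (Suc ?j) t"
    using ac by (auto simp: tensor_boundaries_def)
  define g where "g k = (Const (v k) :: ('v, 'k) mpoly)" for k
  have g: "g \<in> Fmod (Suc ?j)" using v(2) by (simp add: g_def fmod_def tensor_piece_def)
  have "eval_poly ((u - bd F ?j g) k) 0 = 0" for k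
  proof -
    have "eval_poly (bd F ?j g k) 0 = tensor_bd F ?j v k"
      by (simp add: bd_def tensor_bd_def g_def eval_at_0[symmetric])
    moreover have "eval_poly (u k) 0 = tensor_bd F ?j v k" using v(1) by (simp add: w_def eval_at_0 fun_eq_iff)
    ultimately show ?thesis by simp
  qed
  then have "vanv {0} (u - bd F ?j g)" by (simp add: vanv_def vanishes_at_def)
  then show ?thesis
  proof (rule bndI[OF g, rotated])
    show "u - bd F ?j g \<in> Fmod ?j" using u(1) bd_fmod by (simp add: cyc_def fmod_diff)
    show "u = bd F ?j g + (u - bd F ?j g)" by (simp add: fun_eq_iff)
  qed
qed

end

section \<open>The projective Nullstellensatz\<close>

interpretation kv: vector_space "\<lambda>(c::'k::field) (f::('v, 'k) mpoly). Const c * f"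
  by unfold_locales (simp_all add: Const_add Const_mult algebra_simps)

lemma hideal_Const_cancel:
  fixes M :: "('v::finite, 'k::field) mpoly set"
  assumes "hideal M" "c \<noteq> 0" "Const c * f \<in> M"
  shows "f \<in> M"
proof -
  have "Const (1 / c) * (Const c * f) = f"
    using assms(2) by (simp only: mult.assoc[symmetric] Const_mult[symmetric]) simp
  then show ?thesis using hideal_mult[OF assms(1,3)] by metis
qed

lemma subspace_hideal: "hideal (J :: ('v::finite, 'k::field) mpoly set) \<Longrightarrow> kv.subspace J"
  by (auto simp: kv.subspace_def intro: hideal_0 hideal_add hideal_mult)

text \<open>Gaussian elimination in the quotient by \<open>J\<close>: some member of the family
  involves \<open>b\<close> and is used to remove \<open>b\<close> from all the others.
  \<open>e\<close> is an indexed family, so that equal members count as dependent.\<close>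

lemma dependent_modulo:
  fixes J :: "('v, 'k::field) mpoly set"
  assumes J: "kv.subspace J" and "finite B" "finite X" "card B < card X"
    and "\<And>x. x \<in> X \<Longrightarrow> \<exists>s\<in>kv.span B. e x - s \<in> J"
  shows "\<exists>c. (\<exists>x\<in>X. c x \<noteq> 0) \<and> (\<Sum>x\<in>X. Const (c x) * e x) \<in> J"
  using assms(2-)
proof (induction B arbitrary: X e rule: finite_induct)
  case empty
  then obtain x where x: "x \<in> X" by fastforce
  have "e x \<in> J" using empty.prems(3)[OF x] by simp
  moreover have "(\<Sum>y\<in>X. Const (if y = x then 1 else 0) * e y) = (\<Sum>y\<in>X. if y = x then e y else 0)"
    by (rule sum.cong) auto
  ultimately have "(\<Sum>y\<in>X. Const (if y = x then 1 else 0) * e y) \<in> J"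
    using x empty.prems(1) by simp
  then show ?case using x by (intro exI[of _ "\<lambda>y. if y = x then 1 else 0"]) auto
next
  case (insert b B)
  have "\<exists>k. \<exists>s\<in>kv.span B. e x - Const k * b - s \<in> J" if x: "x \<in> X" for x
  proof -
    obtain s where s: "s \<in> kv.span (insert b B)" "e x - s \<in> J" using insert.prems(3)[OF x] by blast
    obtain k where "s - Const k * b \<in> kv.span B" using s(1) by (auto simp: kv.span_breakdown_eq)
    then show ?thesis using s(2) by (intro exI[of _ k] bexI[of _ "s - Const k * b"]) simp_all
  qed
  then obtain k s where ks: "\<And>x. x \<in> X \<Longrightarrow> s x \<in> kv.span B" "\<And>x. x \<in> X \<Longrightarrow> e x - Const (k x) * b - s x \<in> J"
    by metis
  show ?case
  proof (cases "\<forall>x\<in>X. k x = 0")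
    case True
    then show ?thesis using insert.hyps insert.prems ks
      by (intro insert.IH) (auto intro!: bexI[of _ "s _"])
  next
    case False
    then obtain x0 where x0: "x0 \<in> X" "k x0 \<noteq> 0" by blast
    define r where "r x = k x / k x0" for x
    define e' where "e' x = e x - Const (r x) * e x0" for x
    have "\<exists>t\<in>kv.span B. e' x - t \<in> J" if x: "x \<in> X - {x0}" for x
    proof
      show "s x - Const (r x) * s x0 \<in> kv.span B"
        using ks(1) x x0 by (intro kv.span_diff kv.span_scale) auto
      have rk: "Const (r x) * Const (k x0) = (Const (k x) :: ('v, 'k) mpoly)"
        using x0 by (simp add: r_def Const_mult[symmetric])
      have "e' x - (s x - Const (r x) * s x0)
          = (e x - Const (k x) * b - s x) - Const (r x) * (e x0 - Const (k x0) * b - s x0)"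
        by (simp add: e'_def rk[symmetric] algebra_simps)
      also have "\<dots> \<in> J" using x x0
        by (intro kv.subspace_diff[OF J ks(2)[of x] kv.subspace_scale[OF J ks(2)[of x0]]]) auto
      finally show "e' x - (s x - Const (r x) * s x0) \<in> J" .
    qed
    moreover have "card B < card (X - {x0})" "finite (X - {x0})"
      using insert.prems insert.hyps x0 by auto
    ultimately obtain c where c: "\<exists>x\<in>X - {x0}. c x \<noteq> 0" "(\<Sum>x\<in>X - {x0}. Const (c x) * e' x) \<in> J"
      using insert.IH[of "X - {x0}" e'] by blast
    \<comment> \<open>The coefficient of the pivot \<open>x0\<close> is forced by substituting the
      definition of \<open>e'\<close>.\<close>
    define c' where "c' x = (if x = x0 then - (\<Sum>x\<in>X - {x0}. c x * r x) else c x)" for x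
    have Const_sum: "Const (\<Sum>x\<in>A. f x) = (\<Sum>x\<in>A. Const (f x) :: ('v, 'k) mpoly)" for A and f :: "'b \<Rightarrow> 'k"
      by (induction A rule: infinite_finite_induct) (auto simp: Const_add)
    have "(\<Sum>x\<in>X. Const (c' x) * e x) = Const (c' x0) * e x0 + (\<Sum>x\<in>X - {x0}. Const (c' x) * e x)"
      using insert.prems(1) x0(1) by (rule sum.remove)
    also have "(\<Sum>x\<in>X - {x0}. Const (c' x) * e x) = (\<Sum>x\<in>X - {x0}. Const (c x) * e x)"
      by (rule sum.cong) (auto simp: c'_def)
    also have "Const (c' x0) * e x0 = - (\<Sum>x\<in>X - {x0}. Const (c x) * Const (r x) * e x0)"
      by (simp add: c'_def Const_minus Const_sum sum_distrib_right Const_mult)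
    also have "\<dots> + (\<Sum>x\<in>X - {x0}. Const (c x) * e x) = (\<Sum>x\<in>X - {x0}. Const (c x) * e' x)"
      by (simp add: e'_def algebra_simps sum_subtractf)
    finally have "(\<Sum>x\<in>X. Const (c' x) * e x) \<in> J" using c(2) by simp
    moreover have "\<exists>x\<in>X. c' x \<noteq> 0" using c(1) by (auto simp: c'_def)
    ultimately show ?thesis by blast
  qed
qed

lemma span_image_mult:
  fixes s :: "('v, 'k::field) mpoly"
  assumes "s \<in> kv.span B"
  shows "a * s \<in> kv.span ((*) a ` B)"
  using assms
proof (induction rule: kv.span_induct_alt)
  case base
  show ?case by (simp add: kv.span_zero)
next
  case (step c x y)
  have "Const c * (a * x) + a * y \<in> kv.span ((*) a ` B)"
    using step(1) by (intro kv.span_add[OF kv.span_scale[OF kv.span_base] step(2)]) blast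
  then show ?case by (simp add: distrib_left mult.left_commute)
qed

lemma forms_spanned:
  obtains B :: "('v::finite, 'k::field) mpoly set" where "finite B" "\<And>f. is_form t f \<Longrightarrow> f \<in> kv.span B"
proof
  let ?B = "(\<lambda>a. single a 1) ` {a::'v \<Rightarrow>\<^sub>0 nat. mon_degree a \<le> t} :: ('v, 'k) mpoly set"
  show "finite ?B" using finite_mon_degree_le by blast
  fix f :: "('v, 'k) mpoly" assume f: "is_form t f"
  have "(\<Sum>a\<in>keys f. Const (lookup f a) * single a 1) \<in> kv.span ?B"
    using f by (intro kv.span_sum kv.span_scale kv.span_base) (auto simp: is_form_def)
  then show "f \<in> kv.span ?B" using mpoly_monomial_sum[of f] by (simp add: Const_def mult_single)
qed

text \<open>In degree \<open>t\<close> the forms are spanned modulo \<open>J\<close> by the products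
  of \<open>B\<close> with a power of \<open>l\<close>, so the dimension of R/J in degree
  \<open>t\<close> is at most \<open>card B\<close>.\<close>

lemma forms_dependent_modulo:
  fixes J :: "('v::finite, 'k::field) mpoly set"
  assumes J: "hideal J"
    and step: "\<And>t f. t0 \<le> t \<Longrightarrow> is_form (Suc t) f \<Longrightarrow> \<exists>g. is_form t g \<and> f - l * g \<in> J"
    and B: "finite B" "\<And>f. is_form t0 f \<Longrightarrow> \<exists>s\<in>kv.span B. f - s \<in> J"
    and t: "t0 \<le> t" and X: "finite X" "card B < card X" and e: "\<And>x. x \<in> X \<Longrightarrow> is_form t (e x)"
  shows "\<exists>c. (\<exists>x\<in>X. c x \<noteq> 0) \<and> (\<Sum>x\<in>X. Const (c x) * e x) \<in> J"
proof -
  have "\<exists>C. finite C \<and> card C \<le> card B \<and> (\<forall>f. is_form t f \<longrightarrow> (\<exists>s\<in>kv.span C. f - s \<in> J))"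
    using t
  proof (induction t rule: dec_induct)
    case base
    then show ?case using B by blast
  next
    case (step t)
    then obtain C where C: "finite C" "card C \<le> card B" "\<And>f. is_form t f \<Longrightarrow> \<exists>s\<in>kv.span C. f - s \<in> J" by blast
    have "\<exists>s\<in>kv.span ((*) l ` C). f - s \<in> J" if f: "is_form (Suc t) f" for f
    proof -
      obtain g where g: "is_form t g" "f - l * g \<in> J" using assms(2)[OF step.hyps(1) f] by blast
      obtain s where s: "s \<in> kv.span C" "g - s \<in> J" using C(3) g(1) by blast
      have "(f - l * g) + l * (g - s) \<in> J" using g(2) s(2) by (intro hideal_add[OF J] hideal_mult[OF J])
      then have "f - l * s \<in> J" by (simp add: algebra_simps)
      then show ?thesis using span_image_mult[OF s(1)] by blast
    qed
    moreover have "card ((*) l ` C) \<le> card B" using card_image_le[OF C(1), of "(*) l"] C(2) by simp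
    ultimately show ?case using C(1) by (intro exI[of _ "(*) l ` C"]) simp
  qed
  then obtain C where C: "finite C" "card C \<le> card B" "\<And>f. is_form t f \<Longrightarrow> \<exists>s\<in>kv.span C. f - s \<in> J" by blast
  show ?thesis
    by (rule dependent_modulo[OF subspace_hideal[OF J] C(1) X(1)]) (use C X e in auto)
qed

lemma hideal_sum_ideals:
  assumes "hideal A" "hideal B"
  shows "hideal {f + g | f g. f \<in> A \<and> g \<in> B}"
  unfolding hideal_def
proof (intro conjI ballI allI)
  let ?S = "{f + g | f g. f \<in> A \<and> g \<in> B}"
  have SI: "h \<in> ?S" if "f \<in> A" "g \<in> B" "h = f + g" for f g h using that by blast
  show "0 \<in> ?S" by (rule SI[OF hideal_0[OF assms(1)] hideal_0[OF assms(2)]]) simp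
  fix h assume "h \<in> ?S"
  then obtain f g where h: "f \<in> A" "g \<in> B" "h = f + g" by blast
  show "h + h' \<in> ?S" if hS: "h' \<in> ?S" for h'
  proof -
    obtain f' g' where h': "f' \<in> A" "g' \<in> B" "h' = f' + g'" using hS by blast
    show ?thesis
      by (rule SI[OF hideal_add[OF assms(1) h(1) h'(1)] hideal_add[OF assms(2) h(2) h'(2)]])
        (simp add: h(3) h'(3) add_ac)
  qed
  show "a * h \<in> ?S" for a
    by (rule SI[OF hideal_mult[OF assms(1) h(1)] hideal_mult[OF assms(2) h(2)]]) (simp add: h(3) distrib_left)
  show "hcomp t h \<in> ?S" for t
    by (rule SI[OF hideal_hcomp[OF assms(1) h(1)] hideal_hcomp[OF assms(2) h(2)]]) (simp add: h(3) hcomp_add)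
qed

lemma hideal_principal:
  assumes "is_form s f"
  shows "hideal (range ((*) f))"
  unfolding hideal_def
proof (intro conjI ballI allI)
  have RI: "h \<in> range ((*) f)" if "h = f * r" for h r using that by blast
  show "0 \<in> range ((*) f)" by (rule RI[of _ 0]) simp
  fix h assume "h \<in> range ((*) f)"
  then obtain r where h: "h = f * r" by blast
  show "h + h' \<in> range ((*) f)" if hS: "h' \<in> range ((*) f)" for h'
  proof -
    obtain r' where "h' = f * r'" using hS by blast
    then show ?thesis using h by (intro RI[of _ "r + r'"]) (simp add: distrib_left)
  qed
  show "a * h \<in> range ((*) f)" for a by (rule RI[of _ "a * r"]) (simp add: h mult.left_commute)
  show "hcomp t h \<in> range ((*) f)" for t
    by (rule RI[of _ "if s \<le> t then hcomp (t - s) r else 0"]) (simp add: h hcomp_mult_form[OF assms])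
qed

text \<open>The sum in the last hypothesis is l^D q(y/l), which splits into factors y - a l and
  powers of \<open>l\<close>. A prime ideal without powers of \<open>l\<close> must contain one of
  the former. \<open>D\<close> may exceed the degree of \<open>q\<close>; the excess contributes
  factors \<open>l\<close>.\<close>

lemma hideal_linear_factor:
  fixes M :: "('v::finite, 'k::alg_closed_field) mpoly set"
  assumes M: "hideal M" and l: "is_form 1 l" and y: "is_form 1 y" and lM: "\<And>n. l ^ n \<notin> M"
    and prime: "\<And>f g m n. is_form m f \<Longrightarrow> is_form n g \<Longrightarrow> f * g \<in> M \<Longrightarrow> f \<in> M \<or> g \<in> M"
    and "q \<noteq> 0" "degree q \<le> D" "(\<Sum>i\<le>D. Const (coeff q i) * (y ^ i * l ^ (D - i))) \<in> M"
  shows "\<exists>a. y - Const a * l \<in> M"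
  using assms(6-)
proof (induction D arbitrary: q)
  case 0
  then have "Const (coeff q 0) \<in> M" "coeff q 0 \<noteq> 0" by (auto elim: degree_eq_zeroE)
  then have "1 \<in> M" using hideal_Const_cancel[OF M, of "coeff q 0" 1] by simp
  then show ?case using lM[of 0] by simp
next
  case (Suc D)
  show ?case
  proof (cases "degree q = 0")
    case True
    then obtain c where c: "q = [:c:]" "c \<noteq> 0" using Suc.prems(1) by (auto elim: degree_eq_zeroE)
    have "(\<Sum>i\<le>Suc D. Const (coeff q i) * (y ^ i * l ^ (Suc D - i))) = (\<Sum>i\<le>Suc D. if i = 0 then Const c * l ^ Suc D else 0)"
      by (rule sum.cong) (auto simp: c coeff_pCons split: nat.split)
    then have "Const c * l ^ Suc D \<in> M" using Suc.prems(3) by simp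
    then have "l ^ Suc D \<in> M" by (rule hideal_Const_cancel[OF M c(2)])
    then show ?thesis using lM by blast
  next
    case False
    then obtain a where "poly q a = 0" using alg_closed_imp_poly_has_root[of q] by blast
    then obtain q' where q': "q = [:- a, 1:] * q'" by (metis poly_eq_0_iff_dvd dvdE)
    have q0: "q' \<noteq> 0" using q' Suc.prems(1) by auto
    have "degree q = Suc (degree q')" unfolding q' using q0 by (subst degree_mult_eq) auto
    then have d: "degree q' \<le> D" using Suc.prems(2) by simp
    let ?H = "\<Sum>i\<le>D. Const (coeff q' i) * (y ^ i * l ^ (D - i))"
    have cq: "Const (coeff q i) = Const (coeff (pCons 0 q') i) - Const a * (Const (coeff q' i) :: ('v, 'k) mpoly)" for i
      unfolding q' by (simp add: Const_mult[symmetric] Const_minus[symmetric] Const_add[symmetric] diff_conv_add_uminus del: add_uminus_conv_diff)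
    have s1: "(\<Sum>i\<le>Suc D. Const (coeff (pCons 0 q') i) * (y ^ i * l ^ (Suc D - i))) = y * ?H"
      by (subst sum.atMost_Suc_shift) (simp add: sum_distrib_left mult_ac)
    have s2: "(\<Sum>i\<le>Suc D. Const (coeff q' i) * (y ^ i * l ^ (Suc D - i))) = l * ?H"
    proof -
      have "coeff q' (Suc D) = 0" using d by (intro coeff_eq_0) simp
      then have "(\<Sum>i\<le>Suc D. Const (coeff q' i) * (y ^ i * l ^ (Suc D - i))) = (\<Sum>i\<le>D. Const (coeff q' i) * (y ^ i * l ^ (Suc D - i)))"
        by simp
      also have "\<dots> = (\<Sum>i\<le>D. l * (Const (coeff q' i) * (y ^ i * l ^ (D - i))))"
        by (rule sum.cong) (auto simp: Suc_diff_le mult_ac)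
      finally show ?thesis by (simp add: sum_distrib_left)
    qed
    have "(\<Sum>i\<le>Suc D. Const (coeff q i) * (y ^ i * l ^ (Suc D - i)))
        = (\<Sum>i\<le>Suc D. Const (coeff (pCons 0 q') i) * (y ^ i * l ^ (Suc D - i)))
          - Const a * (\<Sum>i\<le>Suc D. Const (coeff q' i) * (y ^ i * l ^ (Suc D - i)))"
      unfolding cq left_diff_distrib sum_subtractf sum_distrib_left mult.assoc ..
    also have "\<dots> = (y - Const a * l) * ?H" unfolding s1 s2 by (simp add: algebra_simps)
    finally have "(y - Const a * l) * ?H \<in> M" using Suc.prems(3) by simp
    moreover have "is_form 1 (y - Const a * l)" using l y by (intro is_form_diff is_form_Const_mult)
    moreover have "is_form D ?H"
    proof (intro is_form_sum is_form_Const_mult)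
      fix i assume "i \<in> {..D}"
      then show "is_form D (y ^ i * l ^ (D - i))"
        using is_form_mult[OF is_form_power[OF y, of i] is_form_power[OF l, of "D - i"]] by simp
    qed
    ultimately have "y - Const a * l \<in> M \<or> ?H \<in> M" using prime by blast
    then show ?thesis using Suc.IH[OF q0 d] by blast
  qed
qed

text \<open>
  An ideal that is maximal among the homogeneous ideals without a power of the irrelevant ideal is the
  ideal of a point: it is prime, and modulo it each coordinate is a multiple of a single linear form, as
  \<open>R/M\<close> has bounded dimension in every degree.
\<close>

theorem projective_nullstellensatz:
  fixes J :: "('v::{finite,linorder}, 'k::alg_closed_field) mpoly set"
  assumes J: "hideal J" and zero: "\<And>x. (\<forall>f\<in>J. eval_poly f x = 0) \<Longrightarrow> x = 0"
  shows "\<exists>s. \<forall>t\<ge>s. \<forall>f. is_form t f \<longrightarrow> f \<in> J"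
proof (rule ccontr)
  assume contr: "\<nexists>s. \<forall>t\<ge>s. \<forall>f. is_form t f \<longrightarrow> f \<in> J"
  define Bad where "Bad = {M. hideal M \<and> J \<subseteq> M \<and> (\<nexists>s. \<forall>t\<ge>s. \<forall>f. is_form t f \<longrightarrow> f \<in> M)}"
  have "J \<in> Bad" using J contr by (simp add: Bad_def)
  then obtain M where MB: "M \<in> Bad" and max0: "\<And>A. (A, M) \<in> {(A, B). hideal A \<and> hideal B \<and> B \<subset> A} \<Longrightarrow> A \<notin> Bad"
    by (rule wfE_min[OF wf_hideal]) (rule that)
  have M: "hideal M" "J \<subseteq> M" "\<nexists>s. \<forall>t\<ge>s. \<forall>f. is_form t f \<longrightarrow> f \<in> M" using MB by (auto simp: Bad_def)
  \<comment> \<open>By maximality, adding \<open>f\<close> to \<open>M\<close> captures all forms of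
    large degree, so these are multiples of \<open>f\<close> modulo \<open>M\<close>.\<close>
  have max: "\<exists>s. \<forall>t\<ge>s. \<forall>g. is_form t g \<longrightarrow> (\<exists>r. g - f * r \<in> M)" if f: "is_form n f" "f \<notin> M" for n f
  proof -
    let ?A = "{a + b | a b. a \<in> M \<and> b \<in> range ((*) f)}"
    have A: "hideal ?A" using M(1) hideal_principal[OF f(1)] by (rule hideal_sum_ideals)
    have "a \<in> ?A" if "a \<in> M" for a
      by (rule CollectI, rule exI[of _ a], rule exI[of _ "f * 0"], intro conjI) (simp, rule that, rule rangeI)
    moreover have "f \<in> ?A"
      by (rule CollectI, rule exI[of _ 0], rule exI[of _ "f * 1"], intro conjI) (simp, rule hideal_0[OF M(1)], rule rangeI)
    ultimately have "M \<subset> ?A" using f(2) by blast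
    then have "?A \<notin> Bad" using max0 A M(1) by simp
    moreover have "J \<subseteq> ?A" using M(2) \<open>M \<subset> ?A\<close> by blast
    ultimately obtain s where s: "\<forall>t\<ge>s. \<forall>g. is_form t g \<longrightarrow> g \<in> ?A" using A unfolding Bad_def by blast
    have "\<exists>r. g - f * r \<in> M" if "s \<le> t" "is_form t g" for t g
    proof -
      have "g \<in> ?A" using s that by blast
      then obtain a r where "a \<in> M" "g = a + f * r" by blast
      then show ?thesis by (intro exI[of _ r]) simp
    qed
    then show ?thesis by blast
  qed
  have prime: "f \<in> M \<or> g \<in> M" if f: "is_form m f" and g: "is_form n g" and fg: "f * g \<in> M" for f g m n
  proof (rule ccontr)
    assume "\<not> (f \<in> M \<or> g \<in> M)"
    then have nM: "f \<notin> M" "g \<notin> M" by auto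
    obtain s1 where s1: "\<forall>t\<ge>s1. \<forall>h. is_form t h \<longrightarrow> (\<exists>r. h - f * r \<in> M)" using max[OF f nM(1)] by blast
    obtain s2 where s2: "\<forall>t\<ge>s2. \<forall>h. is_form t h \<longrightarrow> (\<exists>r. h - g * r \<in> M)" using max[OF g nM(2)] by blast
    \<comment> \<open>A form of degree at least \<open>s1 + s2\<close> is a sum of products
      \<open>u * w\<close> in which, modulo \<open>M\<close>, one factor is a multiple of
      \<open>f\<close> and the other one of \<open>g\<close>; but \<open>f * g\<close> lies in
      \<open>M\<close>.\<close>
    have "h \<in> M" if t: "s1 + s2 \<le> t" and h: "is_form t h" for t h
    proof -
      have "is_form (s1 + (t - s1)) h" using t h by simp
      then show ?thesis
      proof (rule form_split[OF _ hideal_0[OF M(1)] hideal_add[OF M(1)]])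
        fix u w :: "('v, 'k) mpoly" assume "is_form s1 u" "is_form (t - s1) w"
        then obtain r r' where r: "u - f * r \<in> M" "w - g * r' \<in> M"
          using s1 s2 t by (metis order_refl le_diff_conv2 add.commute add_leD1)
        have "w * (u - f * r) + (f * r) * (w - g * r') + (r * r') * (f * g) \<in> M"
          by (rule hideal_add[OF M(1) hideal_add[OF M(1) hideal_mult[OF M(1) r(1)] hideal_mult[OF M(1) r(2)]]
                hideal_mult[OF M(1) fg]])
        then show "u * w \<in> M" by (simp add: algebra_simps)
      qed
    qed
    then show False using M(3) by blast
  qed
  have one: "1 \<notin> M"
  proof
    assume "1 \<in> M"
    then have "f \<in> M" for f using hideal_mult[OF M(1), of 1 f] by simp
    then show False using M(3) by blast
  qed
  obtain i where i: "Var i \<notin> M"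
  proof -
    have "\<exists>i. Var i \<notin> M"
    proof (rule ccontr)
      assume a: "\<nexists>i. Var i \<notin> M"
      have "t \<ge> 1 \<longrightarrow> f \<in> M" if "is_form t f" for t f
        using that
      proof (induction rule: form_induct)
        case (Var t j f)
        then show ?case using a hideal_mult2[OF M(1), of "Var j" f] by blast
      qed (auto intro: hideal_0[OF M(1)] hideal_add[OF M(1)])
      then show False using M(3) by blast
    qed
    then show ?thesis using that by blast
  qed
  define l :: "('v, 'k) mpoly" where "l = Var i"
  have l: "is_form 1 l" by (simp add: l_def)
  have lM: "l ^ n \<notin> M" for n
  proof (induction n)
    case 0
    then show ?case using one by simp
  next
    case (Suc n)
    then show ?case using prime[OF l is_form_power[OF l, of n]] i by (auto simp: l_def)
  qed
  obtain t0 where t0: "\<forall>t\<ge>t0. \<forall>g. is_form t g \<longrightarrow> (\<exists>r. g - l * r \<in> M)"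
    using max[OF l] i l_def by blast
  have step: "\<exists>g. is_form t g \<and> f - l * g \<in> M" if t: "t0 \<le> t" and f: "is_form (Suc t) f" for t f
  proof -
    obtain r where "f - l * r \<in> M" using t0 f le_SucI[OF t] by blast
    then have "hcomp (Suc t) (f - l * r) \<in> M" by (rule hideal_hcomp[OF M(1)])
    then have "f - l * hcomp t r \<in> M" using f by (simp add: hcomp_diff hcomp_form hcomp_mult_form[OF l])
    then show ?thesis using is_form_hcomp by blast
  qed
  obtain B :: "('v, 'k) mpoly set" where B: "finite B" "\<And>f. is_form t0 f \<Longrightarrow> f \<in> kv.span B"
    using forms_spanned by blast
  have "\<exists>a. Var j - Const a * l \<in> M" for j
  proof -
    \<comment> \<open>There are \<open>D + 1\<close> products of degree \<open>D\<close>, more than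
      \<open>card B\<close>, and the dimension bound applies because
      \<open>D \<ge> t0\<close>.\<close>
    define D where "D = max t0 (card B)"
    have e: "is_form D (Var j ^ k * l ^ (D - k))" if "k \<in> {..D}" for k
      using is_form_mult[OF is_form_power[OF is_form_Var(1), of k j] is_form_power[OF l, of "D - k"]] that by simp
    have "\<exists>c. (\<exists>k\<in>{..D}. c k \<noteq> 0) \<and> (\<Sum>k\<le>D. Const (c k) * (Var j ^ k * l ^ (D - k))) \<in> M"
    proof (rule forms_dependent_modulo[OF M(1) step B(1) _ _ _ _ e])
      show "\<exists>s\<in>kv.span B. f - s \<in> M" if "is_form t0 f" for f
        using B(2)[OF that] hideal_0[OF M(1)] by (intro bexI[of _ f]) auto
    qed (auto simp: D_def)
    then obtain c k where c: "k \<le> D" "c k \<noteq> 0" "(\<Sum>k\<le>D. Const (c k) * (Var j ^ k * l ^ (D - k))) \<in> M" by blast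
    define q where "q = (\<Sum>k\<le>D. monom (c k) k)"
    have cq: "coeff q k = (if k \<le> D then c k else 0)" for k by (simp add: q_def coeff_sum)
    show ?thesis
    proof (rule hideal_linear_factor[OF M(1) l is_form_Var(1) lM prime])
      show "q \<noteq> 0" using cq[of k] c by auto
      show "degree q \<le> D" by (rule degree_le) (simp add: cq)
      show "(\<Sum>k\<le>D. Const (coeff q k) * (Var j ^ k * l ^ (D - k))) \<in> M" using c(3) by (simp add: cq)
    qed
  qed
  then obtain a where a: "\<And>j. Var j - Const (a j) * l \<in> M" by metis
  define x :: "('k, 'v) vec" where "x = (\<chi> j. a j)"
  \<comment> \<open>Modulo \<open>M\<close> every coordinate is a multiple of \<open>l\<close>, so a
    form of degree \<open>t\<close> is its value at \<open>x\<close> times \<open>l ^ t\<close>. As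
    \<open>M\<close> contains no power of \<open>l\<close>, elements of \<open>J\<close> vanish at
    \<open>x\<close>.\<close>
  have red: "f - Const (eval_poly f x) * l ^ t \<in> M" if "is_form t f" for t f
    using that
  proof (induction rule: form_induct)
    case (add t f g)
    then have "(f - Const (eval_poly f x) * l ^ t) + (g - Const (eval_poly g x) * l ^ t) \<in> M" by (rule hideal_add[OF M(1)])
    then show ?case by (simp add: Const_add algebra_simps)
  next
    case (Var t j f)
    have "f * (Var j - Const (a j) * l) + Const (a j) * l * (f - Const (eval_poly f x) * l ^ t) \<in> M"
      by (rule hideal_add[OF M(1) hideal_mult[OF M(1) a] hideal_mult[OF M(1) Var(2)]])
    then show ?case by (simp add: Const_mult x_def algebra_simps)
  qed (auto intro: hideal_0[OF M(1)])
  have "eval_poly f x = 0" if "f \<in> J" for f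
  proof -
    have "eval_poly (hcomp t f) x = 0" for t
    proof (rule ccontr)
      assume n: "eval_poly (hcomp t f) x \<noteq> 0"
      have "hcomp t f \<in> M" using that M(2) hideal_hcomp[OF M(1)] by blast
      then have "hcomp t f - (hcomp t f - Const (eval_poly (hcomp t f) x) * l ^ t) \<in> M"
        using red[OF is_form_hcomp] by (rule hideal_diff[OF M(1)])
      then have "Const (eval_poly (hcomp t f) x) * l ^ t \<in> M" by simp
      then have "l ^ t \<in> M" by (rule hideal_Const_cancel[OF M(1) n])
      then show False using lM by blast
    qed
    moreover obtain N where "f = (\<Sum>t<N. hcomp t f)" by (rule hcomp_decomp)
    ultimately show ?thesis by (metis (no_types, lifting) eval_sum sum.neutral)
  qed
  \<comment> \<open>But \<open>Var i\<close> is congruent to \<open>a i\<close> times itself, so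
    \<open>a i = 0\<close> puts \<open>Var i\<close> into \<open>M\<close>.\<close>
  then have "x = 0" using zero by blast
  then have "a i = 0" by (simp add: x_def vec_eq_iff)
  then show False using a[of i] i by simp
qed

section \<open>Points and linear subspaces of projective space\<close>

lemma proj_point:
  assumes "P \<in> proj_space"
  obtains x where "x \<noteq> 0" "x \<in> P" "\<And>y. y \<in> P \<Longrightarrow> \<exists>c. y = c *s x" "P = vec.span {x}"
proof -
  have P: "vec.subspace P" "vec.dim P = 1" using assms by (auto simp: proj_space_def)
  obtain B where B: "B \<subseteq> P" "vec.independent B" "P \<subseteq> vec.span B" "card B = vec.dim P"
    by (rule vec.basis_exists[of P])
  obtain x where x: "B = {x}" using B(4) P(2) by (auto simp: card_1_singleton_iff)
  have sp: "P = vec.span {x}" using B x P(1) by (metis vec.span_minimal subset_antisym)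
  show ?thesis
  proof (rule that[OF _ _ _ sp])
    show "x \<noteq> 0" using B(2) x vec.dependent_zero[of B] by auto
    show "x \<in> P" using B(1) x by simp
    show "\<exists>c. y = c *s x" if "y \<in> P" for y using that sp by (auto simp: vec.span_singleton)
  qed
qed

lemma span_in_proj_space: "x \<noteq> 0 \<Longrightarrow> vec.span {x} \<in> proj_space"
  by (simp add: proj_space_def vec.subspace_span)

lemma proj_space_subspace: "P \<in> proj_space \<Longrightarrow> vec.subspace P"
  by (simp add: proj_space_def)

lemma proj_point_unique:
  assumes "P \<in> proj_space" "Q \<in> proj_space" "x \<in> P" "x \<in> Q" "x \<noteq> 0"
  shows "P = Q"
proof -
  have "vec.span {x} = S" if S: "S \<in> proj_space" "x \<in> S" for S
  proof -
    have s: "vec.span {x} \<subseteq> S" using S by (intro vec.span_minimal) (auto simp: proj_space_def)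
    show ?thesis
    proof (rule vec.subspace_dim_equal[OF _ _ s])
      show "vec.dim S \<le> vec.dim (vec.span {x})" using S assms(5) by (simp add: proj_space_def)
    qed (use S in \<open>simp_all add: proj_space_def vec.subspace_span\<close>)
  qed
  then show ?thesis using assms by metis
qed

lemma vanishes_at_form:
  assumes P: "P \<in> proj_space" "x \<in> P" "x \<noteq> 0" and f: "is_form t f"
  shows "vanishes_at f P \<longleftrightarrow> eval_poly f x = 0"
proof
  assume "eval_poly f x = 0"
  show "vanishes_at f P"
    unfolding vanishes_at_def
  proof
    fix y assume "y \<in> P"
    obtain z where z: "\<And>y. y \<in> P \<Longrightarrow> \<exists>c. y = c *s z" by (rule proj_point[OF P(1)]) blast
    obtain a b where ab: "x = a *s z" "y = b *s z" using z P(2) \<open>y \<in> P\<close> by metis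
    have "a \<noteq> 0" using ab(1) P(3) by auto
    then have "y = (b / a) *s x" using ab by simp
    then show "eval_poly f y = 0" using \<open>eval_poly f x = 0\<close> by (simp add: eval_scale[OF f])
  qed
qed (use P in \<open>simp add: vanishes_at_def\<close>)

lemma proj_point_outside_subspace:
  assumes "P \<in> proj_space" "vec.subspace V" "\<not> P \<subseteq> V"
  obtains l where "is_form 1 l" "vanishes_at l V" "\<not> vanishes_at l P"
proof -
  obtain x where x: "x \<in> P" "x \<notin> V" using assms(3) by blast
  obtain l where l: "is_form 1 l" "vanishes_at l V" "eval_poly l x = 1"
    by (rule exists_linform[OF assms(2) x(2)])
  have "\<not> vanishes_at l P" using l(3) x(1) unfolding vanishes_at_def by (metis zero_neq_one)
  then show ?thesis by (rule that[OF l(1,2)])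
qed

lemma linear_separation:
  assumes P: "P \<in> proj_space" and Q: "Q \<in> proj_space" "Q \<noteq> P"
  obtains l where "is_form 1 l" "vanishes_at l P" "\<not> vanishes_at l Q"
proof (rule proj_point_outside_subspace[OF Q(1) proj_space_subspace[OF P]])
  obtain x where "x \<noteq> 0" "x \<in> Q" by (rule proj_point[OF Q(1)]) blast
  then show "\<not> Q \<subseteq> P" using proj_point_unique[OF P Q(1)] Q(2) by blast
qed

lemma algebraic_set_subset: "algebraic_set X \<Longrightarrow> X \<subseteq> proj_space"
  by (auto simp: algebraic_set_def zero_locus_def)

text \<open>The homogeneous components of a polynomial that vanishes on a union of lines vanish
  there too, so sums of forms give the full vanishing ideal.\<close>

lemma mem_ideal_of:
  fixes X :: "('k::alg_closed_field ^ 'v::finite) set set"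
  assumes X: "X \<subseteq> proj_space"
  shows "f \<in> ideal_of X \<longleftrightarrow> (\<forall>P\<in>X. vanishes_at f P)"
proof
  assume "f \<in> ideal_of X"
  then obtain h and N :: nat where "f = (\<Sum>m<N. h m)" "\<forall>m. h m \<in> ideal_forms X m" by (auto simp: ideal_of_def)
  then show "\<forall>P\<in>X. vanishes_at f P" by (auto simp: ideal_forms_def vanishes_at_def)
next
  assume f: "\<forall>P\<in>X. vanishes_at f P"
  obtain N where N: "f = (\<Sum>t<N. hcomp t f)" by (rule hcomp_decomp)
  have "hcomp t f \<in> ideal_forms X t" for t
    unfolding ideal_forms_def
  proof (intro CollectI conjI ballI is_form_hcomp)
    fix P assume "P \<in> X"
    then show "vanishes_at (hcomp t f) P"
      using f X by (intro vanishes_at_hcomp) (auto intro: vec.subspace_scale[OF proj_space_subspace])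
  qed
  then show "f \<in> ideal_of X" using N unfolding ideal_of_def by blast
qed

lemma hideal_vanishing:
  fixes X :: "('k::alg_closed_field ^ 'v::finite) set set"
  assumes "\<And>P. P \<in> X \<Longrightarrow> vec.subspace P"
  shows "hideal {f. \<forall>P\<in>X. vanishes_at f P}"
  using assms unfolding hideal_def
  by (auto intro: vanishes_at_0 vanishes_at_add vanishes_at_mult vanishes_at_hcomp vec.subspace_scale)

lemma hideal_ideal_of:
  fixes X :: "('k::alg_closed_field ^ 'v::finite) set set"
  assumes "X \<subseteq> proj_space"
  shows "hideal (ideal_of X)"
proof -
  have "ideal_of X = {f. \<forall>P\<in>X. vanishes_at f P}" using mem_ideal_of[OF assms] by blast
  then show ?thesis using hideal_vanishing[of X] assms proj_space_subspace by auto
qed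

text \<open>An algebraic set is recovered from its ideal. This transfers well-foundedness from
  homogeneous ideals to closed sets, which thus admit Noetherian induction.\<close>

lemma ideal_of_strict_antimono:
  fixes A B :: "('k::alg_closed_field ^ 'v::finite) set set"
  assumes A: "algebraic_set A" and B: "algebraic_set B" and AB: "A \<subset> B"
  shows "ideal_of B \<subset> ideal_of A"
proof -
  have mA: "f \<in> ideal_of A \<longleftrightarrow> (\<forall>P\<in>A. vanishes_at f P)" for f
    by (rule mem_ideal_of[OF algebraic_set_subset[OF A]])
  have mB: "f \<in> ideal_of B \<longleftrightarrow> (\<forall>P\<in>B. vanishes_at f P)" for f
    by (rule mem_ideal_of[OF algebraic_set_subset[OF B]])
  obtain S where S: "A = zero_locus S" using A unfolding algebraic_set_def by blast
  obtain P where P: "P \<in> B" "P \<notin> A" using AB by blast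
  have "P \<in> proj_space" using P(1) algebraic_set_subset[OF B] by blast
  then obtain f where f: "f \<in> S" "\<not> vanishes_at f P" using P(2) unfolding S zero_locus_def by blast
  have "f \<in> ideal_of A" unfolding mA using f(1) unfolding S zero_locus_def by blast
  moreover have "f \<notin> ideal_of B" unfolding mB using f(2) P(1) by blast
  moreover have "ideal_of B \<subseteq> ideal_of A" using AB mA mB by blast
  ultimately show ?thesis by blast
qed

lemma algebraic_linear:
  fixes V :: "('k::field ^ 'v::finite) set"
  assumes V: "vec.subspace V"
  shows "algebraic_set {P \<in> proj_space. P \<subseteq> V}"
proof -
  have "{P \<in> proj_space. P \<subseteq> V} = zero_locus {l. is_form 1 l \<and> vanishes_at l V}"
  proof
    show "{P \<in> proj_space. P \<subseteq> V} \<subseteq> zero_locus {l. is_form 1 l \<and> vanishes_at l V}"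
      by (auto simp: zero_locus_def vanishes_at_def)
    show "zero_locus {l. is_form 1 l \<and> vanishes_at l V} \<subseteq> {P \<in> proj_space. P \<subseteq> V}"
    proof
      fix P assume P: "P \<in> zero_locus {l. is_form 1 l \<and> vanishes_at l V}"
      then have "P \<in> proj_space" by (simp add: zero_locus_def)
      moreover have "P \<subseteq> V"
      proof (rule ccontr)
        assume "\<not> P \<subseteq> V"
        then obtain l where "is_form 1 l" "vanishes_at l V" "\<not> vanishes_at l P"
          by (rule proj_point_outside_subspace[OF \<open>P \<in> proj_space\<close> V])
        then show False using P by (simp add: zero_locus_def)
      qed
      ultimately show "P \<in> {P \<in> proj_space. P \<subseteq> V}" by simp
    qed
  qed
  then show ?thesis
    unfolding algebraic_set_def by (intro exI[of _ "{l. is_form 1 l \<and> vanishes_at l V}"] conjI) auto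
qed

lemma algebraic_point:
  assumes P: "P \<in> proj_space"
  shows "algebraic_set {P}"
proof -
  have "Q = P" if Q: "Q \<in> proj_space" "Q \<subseteq> P" for Q
  proof -
    obtain x where "x \<noteq> 0" "x \<in> Q" by (rule proj_point[OF Q(1)]) blast
    then show ?thesis using proj_point_unique[OF Q(1) P] Q(2) by blast
  qed
  then have "{P} = {Q \<in> proj_space. Q \<subseteq> P}" using P by blast
  then show ?thesis using algebraic_linear[OF proj_space_subspace[OF P]] by simp
qed

text \<open>An irreducible closed subset is a point, since otherwise a point inside it would give a
  chain of length one. Noetherian induction handles the reducible closed subsets.\<close>

lemma finite_of_dimension_0:
  fixes Y :: "('k::alg_closed_field ^ 'v::{finite,linorder}) set set"
  assumes "algebraic_set Y" and dim: "has_dimension Y 0"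
  shows "finite Y"
proof -
  have irr: "\<exists>P. Z = {P}" if Z: "irreducible_set Z" "Z \<subseteq> Y" for Z
  proof -
    obtain P where P: "P \<in> Z" using Z by (auto simp: irreducible_set_def)
    have "P \<in> proj_space" using P Z algebraic_set_subset by (auto simp: irreducible_set_def)
    then have i: "irreducible_set {P}" unfolding irreducible_set_def using algebraic_point by blast
    have "Z = {P}"
    proof (rule ccontr)
      assume "Z \<noteq> {P}"
      then have "irreducible_chain Y 1 (\<lambda>n. if n = 0 then {P} else Z)"
        using P Z i by (auto simp: irreducible_chain_def)
      then show False using dim by (fastforce simp: has_dimension_def)
    qed
    then show ?thesis by blast
  qed
  have "algebraic_set A \<longrightarrow> A \<subseteq> Y \<longrightarrow> finite A" for A
  proof (induction A rule: wf_induct_rule[OF wf_inv_image[OF wf_hideal, of ideal_of]])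
    case (1 A)
    show ?case
    proof (intro impI)
      assume A: "algebraic_set A" "A \<subseteq> Y"
      have IH: "finite B" if B: "algebraic_set B" "B \<subset> A" for B
      proof -
        have "(B, A) \<in> inv_image {(A, B). hideal A \<and> hideal B \<and> B \<subset> A} ideal_of"
          using ideal_of_strict_antimono[OF B(1) A(1) B(2)]
            hideal_ideal_of[OF algebraic_set_subset[OF A(1)]] hideal_ideal_of[OF algebraic_set_subset[OF B(1)]]
          by (simp add: inv_image_def)
        then show ?thesis using 1 B A(2) by blast
      qed
      show "finite A"
      proof (cases "A = {} \<or> irreducible_set A")
        case True
        then show ?thesis using irr A(2) by auto
      next
        case False
        then obtain B C where "algebraic_set B" "algebraic_set C" "A = B \<union> C" "A \<noteq> B" "A \<noteq> C"
          using A(1) unfolding irreducible_set_def by blast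
        then show ?thesis using IH[of B] IH[of C] by auto
      qed
    qed
  qed
  then show ?thesis using assms(1) by blast
qed

text \<open>A form that is nonzero at the old points is perturbed by a multiple of one that is
  nonzero at the new point; each point excludes at most one scalar, and the field is
  infinite.\<close>

lemma linear_form_avoiding_points:
  fixes T :: "('k::alg_closed_field ^ 'v::finite) set set"
  assumes "finite T" "T \<subseteq> proj_space"
  obtains l where "is_form 1 l" "\<And>P. P \<in> T \<Longrightarrow> \<not> vanishes_at l P"
proof -
  have "\<exists>l. is_form 1 l \<and> (\<forall>P\<in>T. \<not> vanishes_at l P)"
    using assms
  proof (induction T rule: finite_induct)
    case empty
    then show ?case by (intro exI[of _ 0]) simp
  next
    case (insert P T)
    then obtain l where l: "is_form 1 l" "\<And>Q. Q \<in> T \<Longrightarrow> \<not> vanishes_at l Q" by auto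
    obtain x where x: "x \<noteq> 0" "x \<in> P" using insert.prems proj_point by (metis insert_subset)
    obtain l' where l': "is_form 1 l'" "eval_poly l' x = 1"
      using exists_linform[OF vec.subspace_single_0, of x] x(1) by blast
    have "\<exists>y. y \<in> Q \<and> y \<noteq> 0" if "Q \<in> T" for Q using that insert.prems proj_point by (metis insert_subset subsetD)
    then obtain y where y: "\<And>Q. Q \<in> T \<Longrightarrow> y Q \<in> Q \<and> y Q \<noteq> 0" by metis
    have ly: "eval_poly l (y Q) \<noteq> 0" if "Q \<in> T" for Q
      using l that y insert.prems vanishes_at_form[of Q "y Q" 1 l] by blast
    \<comment> \<open>The excluded scalars. The first one uses that \<open>l'\<close> takes the
      value 1 at \<open>x\<close>. If \<open>l'\<close> vanishes at \<open>y Q\<close>, division by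
      zero yields a harmless extra value, as \<open>l\<close> is nonzero there.\<close>
    let ?S = "insert (- eval_poly l x) ((\<lambda>Q. - eval_poly l (y Q) / eval_poly l' (y Q)) ` T)"
    have "finite ?S" using insert.hyps by simp
    then obtain c where c: "c \<notin> ?S" using infinite_UNIV_alg_closed ex_new_if_finite by blast
    have "\<not> vanishes_at (l + Const c * l') Q" if "Q \<in> insert P T" for Q
    proof (cases "Q = P")
      case True
      have "eval_poly (l + Const c * l') x \<noteq> 0" using c l'(2) by (auto simp: eq_neg_iff_add_eq_0 add.commute)
      then show ?thesis using True x by (auto simp: vanishes_at_def)
    next
      case False
      then have Q: "Q \<in> T" using that by simp
      have "eval_poly (l + Const c * l') (y Q) \<noteq> 0"
      proof
        assume e: "eval_poly (l + Const c * l') (y Q) = 0"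
        then have n: "eval_poly l' (y Q) \<noteq> 0" using ly[OF Q] by auto
        have "c * eval_poly l' (y Q) = - eval_poly l (y Q)" using e by (simp add: eq_neg_iff_add_eq_0 add.commute)
        then have "c = - eval_poly l (y Q) / eval_poly l' (y Q)" using n by (metis nonzero_mult_div_cancel_right)
        then show False using c Q by blast
      qed
      then show ?thesis using y[OF Q] by (auto simp: vanishes_at_def)
    qed
    moreover have "is_form 1 (l + Const c * l')" using l(1) l'(1) by (intro is_form_add is_form_Const_mult)
    ultimately show ?case by blast
  qed
  then show ?thesis using that by blast
qed

lemma span_forms:
  fixes B :: "('v::finite, 'k::field) mpoly set"
  assumes "\<And>b. b \<in> B \<Longrightarrow> is_form t b" "s \<in> kv.span B"
  shows "is_form t s"
proof -
  have "kv.subspace {f :: ('v, 'k) mpoly. is_form t f}"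
    by (auto simp: kv.subspace_def intro: is_form_add is_form_Const_mult)
  then have "kv.span B \<subseteq> {f. is_form t f}" using assms(1) by (intro kv.span_minimal) auto
  then show ?thesis using assms(2) by blast
qed

text \<open>A form on \<open>V\<close> is a form on the hyperplane section plus \<open>l\<close>
  times a form of one degree less on \<open>V\<close>, and Pascal's rule adds the two counts.
  Truncated subtraction gives the right boundary values: 1 for t = 0, even if q = 0, and 0 for t > 0
  and q = 0.\<close>

lemma forms_on_subspace_spanned:
  fixes V :: "('k::alg_closed_field ^ 'v::finite) set"
  assumes "vec.subspace V" "vec.dim V = q"
  shows "\<exists>B. finite B \<and> card B \<le> (t + q - 1) choose t \<and> (\<forall>b\<in>B. is_form t b) \<and>
      (\<forall>f. is_form t f \<longrightarrow> (\<exists>s\<in>kv.span B. vanishes_at (f - s) V))"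
  using assms
proof (induction "t + q" arbitrary: t q V rule: less_induct)
  case less
  show ?case
  proof (cases t)
    case 0
    have "\<exists>s\<in>kv.span {1}. vanishes_at (f - s) V" if "is_form t f" for f
    proof
      have "f = Const (lookup f 0) * 1" using form_0_eq_Const[of f] that 0 by simp
      moreover have "Const (lookup f 0) * 1 \<in> kv.span {1}"
        by (intro kv.span_scale kv.span_base) simp
      ultimately show "f \<in> kv.span {1}" by metis
    qed (simp add: vanishes_at_0)
    then show ?thesis using 0 by (intro exI[of _ "{1}"]) simp
  next
    case t: (Suc t')
    show ?thesis
    proof (cases q)
      case 0
      then have V: "V \<subseteq> {0}" using less.prems vec.dim_eq_0[of V] by simp
      have "vanishes_at f V" if "is_form t f" for f
        using V eval_scale[OF that, of 0 0] t by (auto simp: vanishes_at_def)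
      then show ?thesis by (intro exI[of _ "{}"]) simp
    next
      case q: (Suc q')
      obtain l v where l: "is_form 1 l" "v \<in> V" "eval_poly l v = 1" "vec.dim (ker_on V l) = q'"
        by (rule exists_linform_on[OF less.prems[unfolded q]])
      note sub = subspace_ker_on[OF less.prems(1) l(1)]
      have "t + q' < t + q" using q by simp
      from less.hyps[OF this sub l(4)] obtain B1 where
        B1: "finite B1" "card B1 \<le> (t + q' - 1) choose t" "\<forall>b\<in>B1. is_form t b"
        "\<forall>f. is_form t f \<longrightarrow> (\<exists>s\<in>kv.span B1. vanishes_at (f - s) (ker_on V l))" by (elim exE conjE)
      have "t' + q < t + q" using t by simp
      from less.hyps[OF this less.prems] obtain B2 where
        B2: "finite B2" "card B2 \<le> (t' + q - 1) choose t'" "\<forall>b\<in>B2. is_form t' b"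
        "\<forall>f. is_form t' f \<longrightarrow> (\<exists>s\<in>kv.span B2. vanishes_at (f - s) V)" by (elim exE conjE)
      let ?B = "B1 \<union> (*) l ` B2"
      have "card ?B \<le> card B1 + card B2"
        using card_Un_le[of B1 "(*) l ` B2"] card_image_le[OF B2(1), of "(*) l"] by linarith
      also have "\<dots> \<le> (t' + q' choose Suc t') + (t' + q' choose t')"
        using B1(2) B2(2) by (simp add: t q)
      also have "\<dots> = (t + q - 1) choose t" by (simp add: t q)
      finally have "card ?B \<le> (t + q - 1) choose t" .
      moreover have "\<exists>s\<in>kv.span ?B. vanishes_at (f - s) V" if f: "is_form t f" for f
      proof -
        obtain s1 where s1: "s1 \<in> kv.span B1" "vanishes_at (f - s1) (ker_on V l)" using B1(4) f by blast
        have fs: "is_form t (f - s1)" using f span_forms[OF _ s1(1)] B1(3) by (blast intro: is_form_diff)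
        obtain g where g: "vanishes_at (f - s1 - l * g) V" by (rule vanishes_on_hyperplane[OF less.prems(1) l(1-3) s1(2)])
        have "vanishes_at (hcomp t (f - s1 - l * g)) V"
          by (rule vanishes_at_hcomp[OF g]) (rule vec.subspace_scale[OF less.prems(1)])
        then have g': "vanishes_at (f - s1 - l * hcomp t' g) V"
          using hcomp_form[OF fs, of t] by (simp add: hcomp_diff hcomp_mult_form[OF l(1)] t)
        obtain s2 where s2: "s2 \<in> kv.span B2" "vanishes_at (hcomp t' g - s2) V"
          using B2(4) is_form_hcomp by blast
        show ?thesis
        proof
          have "s1 \<in> kv.span ?B" using s1(1) kv.span_mono[of B1 ?B] by blast
          moreover have "l * s2 \<in> kv.span ?B"
            using span_image_mult[OF s2(1), of l] kv.span_mono[of "(*) l ` B2" ?B] by blast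
          ultimately show "s1 + l * s2 \<in> kv.span ?B" by (rule kv.span_add)
          have "f - (s1 + l * s2) = (f - s1 - l * hcomp t' g) + l * (hcomp t' g - s2)" by (simp add: algebra_simps)
          then show "vanishes_at (f - (s1 + l * s2)) V" using g' s2(2) by (simp only: vanishes_at_add vanishes_at_mult)
        qed
      qed
      moreover have "\<forall>b\<in>?B. is_form t b" using B1(3) B2(3) is_form_mult[OF l(1)] t by auto
      ultimately show ?thesis using B1(1) B2(1) by (intro exI[of _ ?B]) simp
    qed
  qed
qed

section \<open>Lengths of zero-dimensional schemes\<close>

lemma not_vanishes_nonzero: "\<not> vanishes_at g P \<Longrightarrow> g \<noteq> 0"
  by (auto simp: vanishes_at_def)

lemma not_vanishes_mult:
  assumes P: "P \<in> proj_space" and "is_form m f" "is_form n g" "\<not> vanishes_at f P" "\<not> vanishes_at g P"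
  shows "\<not> vanishes_at (f * g) P"
proof -
  obtain x where x: "x \<noteq> 0" "x \<in> P" by (rule proj_point[OF P]) blast
  have "eval_poly f x \<noteq> 0" "eval_poly g x \<noteq> 0"
    using vanishes_at_form[OF P x(2,1)] assms(2-) by blast+
  then show ?thesis using x(2) by (auto simp: vanishes_at_def)
qed

lemma not_vanishes_power:
  assumes "P \<in> proj_space" "is_form 1 l" "\<not> vanishes_at l P"
  shows "\<not> vanishes_at (l ^ n) P"
proof -
  obtain x where x: "x \<noteq> 0" "x \<in> P" by (rule proj_point[OF assms(1)]) blast
  have "eval_poly l x \<noteq> 0" using vanishes_at_form[OF assms(1) x(2,1) assms(2)] assms(3) by blast
  then show ?thesis using x(2) by (auto simp: vanishes_at_def)
qed

lemma local_ringI: "is_form m f \<Longrightarrow> is_form m g \<Longrightarrow> \<not> vanishes_at g P \<Longrightarrow> Fract f g \<in> local_ring P"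
  unfolding local_ring_def by blast

lemma ideal_stalkI:
  "f \<in> J \<Longrightarrow> is_form m f \<Longrightarrow> is_form m g \<Longrightarrow> \<not> vanishes_at g P \<Longrightarrow> Fract f g \<in> ideal_stalk J P"
  unfolding ideal_stalk_def by blast

lemma Const_in_local_ring:
  fixes P :: "('k::field ^ 'v::{finite,linorder}) set"
  assumes "P \<in> proj_space"
  shows "Fract (Const c) 1 \<in> local_ring P"
proof -
  obtain x where "x \<in> P" by (rule proj_point[OF assms]) blast
  then have "\<not> vanishes_at 1 P" by (auto simp: vanishes_at_def)
  then show ?thesis by (intro local_ringI[of 0]) simp_all
qed

definition is_chain :: "('v, 'k) mpoly set \<Rightarrow> ('k::field ^ 'v::{finite,linorder}) set \<Rightarrow> nat \<Rightarrow> (nat \<Rightarrow> ('v, 'k) mpoly fract set) \<Rightarrow> bool" where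
  "is_chain J P n M \<longleftrightarrow> (\<forall>i\<le>n. is_ideal_in (local_ring P) (M i) \<and> ideal_stalk J P \<subseteq> M i) \<and> (\<forall>i<n. M i \<subset> M (Suc i))"

lemma chain_mono:
  assumes "is_chain J P n M" "i \<le> j" "j \<le> n"
  shows "M i \<subseteq> M j"
  using assms(2,3)
proof (induction j rule: dec_induct)
  case (step j)
  then have "M j \<subset> M (Suc j)" using assms(1) by (simp add: is_chain_def)
  then show ?case using step by auto
qed simp

text \<open>Expanding a fraction by a form of \<open>J\<close> that does not vanish at
  \<open>P\<close> moves its numerator into \<open>J\<close>.\<close>

lemma stalk_outside_support:
  fixes P :: "('k::field ^ 'v::{finite,linorder}) set"
  assumes P: "P \<in> proj_space" and J: "hideal J" and f: "f \<in> J" "is_form m f" "\<not> vanishes_at f P"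
  shows "local_ring P \<subseteq> ideal_stalk J P"
proof
  fix u assume "u \<in> local_ring P"
  then obtain a b n where ab: "u = Fract a b" "is_form n a" "is_form n b" "\<not> vanishes_at b P"
    by (auto simp: local_ring_def)
  have "Fract (a * f) (b * f) \<in> ideal_stalk J P"
    by (rule ideal_stalkI[of _ _ "n + m"])
      (use ab f J P in \<open>simp_all add: hideal_mult is_form_mult not_vanishes_mult[of P n b m f]\<close>)
  moreover have "Fract (a * f) (b * f) = u"
    using ab not_vanishes_nonzero[OF f(3)] not_vanishes_nonzero[OF ab(4)] by (simp add: eq_fract)
  ultimately show "u \<in> ideal_stalk J P" by simp
qed

lemma Fract_sum:
  assumes "(d::'a::idom) \<noteq> 0"
  shows "Fract (sum f X) d = (\<Sum>x\<in>X. Fract (f x) d)"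
proof (induction X rule: infinite_finite_induct)
  case (insert x X)
  have "Fract (f x) d + Fract (sum f X) d = Fract (f x + sum f X) d"
    using assms by (simp add: eq_fract algebra_simps)
  then show ?case using insert by simp
qed (use assms in \<open>simp_all add: Zero_fract_def eq_fract\<close>)

text \<open>Setting of the length bound: multiplication by \<open>l\<close> maps degree t of R/J
  onto degree t + 1 for t \<ge> t0, and \<open>B\<close> spans degree \<open>t0\<close>. Then
  \<open>card B\<close> bounds the dimension of R/J in all degrees from \<open>t0\<close>
  on.\<close>

context
  fixes J :: "('v::{finite,linorder}, 'k::field) mpoly set" and l :: "('v, 'k) mpoly" and t0 :: nat
    and B :: "('v, 'k) mpoly set"
  assumes J: "hideal J" and l: "is_form 1 l"
    and step: "\<And>t f. t0 \<le> t \<Longrightarrow> is_form (Suc t) f \<Longrightarrow> \<exists>g. is_form t g \<and> f - l * g \<in> J"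
    and B: "finite B" "\<And>f. is_form t0 f \<Longrightarrow> \<exists>s\<in>kv.span B. f - s \<in> J"
begin

definition support :: "('k, 'v) vec set set" where
  "support = {P \<in> proj_space. \<forall>m f. f \<in> J \<longrightarrow> is_form m f \<longrightarrow> vanishes_at f P}"

lemma support_proj: "P \<in> support \<Longrightarrow> P \<in> proj_space"
  by (simp add: support_def)

text \<open>For a coordinate that is nonzero at \<open>P\<close>, the power of degree
  \<open>t0 + 1\<close> is a multiple of \<open>l\<close> modulo \<open>J\<close>, and all forms of
  \<open>J\<close> vanish at \<open>P\<close>.\<close>

lemma l_nonvanishing:
  assumes "P \<in> support"
  shows "\<not> vanishes_at l P"
proof
  assume v: "vanishes_at l P"
  have P: "P \<in> proj_space" using assms by (rule support_proj)
  obtain x where x: "x \<noteq> 0" "x \<in> P" by (rule proj_point[OF P]) blast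
  obtain i where i: "x $ i \<noteq> 0" using x(1) by (auto simp: vec_eq_iff)
  have f: "is_form (Suc t0) (Var i ^ Suc t0 :: ('v, 'k) mpoly)" by (rule is_form_power) simp
  obtain g where g: "is_form t0 g" "Var i ^ Suc t0 - l * g \<in> J" using step[OF order_refl f] by blast
  have "is_form (Suc t0) (Var i ^ Suc t0 - l * g)" using f is_form_mult[OF l g(1)] by (intro is_form_diff) simp_all
  then have "vanishes_at (Var i ^ Suc t0 - l * g) P" using assms g(2) unfolding support_def by blast
  then have "eval_poly (Var i ^ Suc t0 - l * g) x = 0" "eval_poly l x = 0"
    using x(2) v unfolding vanishes_at_def by blast+
  then show False using i by simp
qed

text \<open>Let the linear form \<open>h0\<close> vanish at \<open>Q\<close> but not at
  \<open>P\<close>. The forms \<open>h0 ^ i * l ^ (K - i)\<close> are dependent modulo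
  \<open>J\<close>; dividing the relation by the lowest power \<open>h0 ^ a\<close> that occurs
  leaves \<open>g\<close>, whose only term surviving at \<open>Q\<close> is a multiple of a power of
  \<open>l\<close>. So \<open>h0 ^ a\<close> lies in \<open>J\<close> locally at
  \<open>Q\<close>.\<close>

lemma separate_points:
  assumes P: "P \<in> proj_space" and Q: "Q \<in> support" and PQ: "P \<noteq> Q"
  obtains h n g m where "is_form n h" "\<not> vanishes_at h P" "is_form m g" "\<not> vanishes_at g Q" "g * h \<in> J"
proof -
  have Qp: "Q \<in> proj_space" using Q by (rule support_proj)
  obtain h0 where h0: "is_form 1 h0" "vanishes_at h0 Q" "\<not> vanishes_at h0 P"
    by (rule linear_separation[OF Qp P PQ])
  define K where "K = max t0 (card B)"
  have e: "is_form K (h0 ^ i * l ^ (K - i))" if "i \<in> {..K}" for i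
    using is_form_mult[OF is_form_power[OF h0(1), of i] is_form_power[OF l, of "K - i"]] that by simp
  have "\<exists>c. (\<exists>i\<in>{..K}. c i \<noteq> 0) \<and> (\<Sum>i\<le>K. Const (c i) * (h0 ^ i * l ^ (K - i))) \<in> J"
    by (rule forms_dependent_modulo[OF J step B _ _ _ e]) (auto simp: K_def)
  then obtain c i0 where c: "i0 \<le> K" "c i0 \<noteq> 0" "(\<Sum>i\<le>K. Const (c i) * (h0 ^ i * l ^ (K - i))) \<in> J" by blast
  define a where "a = (LEAST i. c i \<noteq> 0)"
  have ca: "c a \<noteq> 0" unfolding a_def using c(2) by (rule LeastI)
  have cz: "c i = 0" if "i < a" for i using that not_less_Least unfolding a_def by blast
  have aK: "a \<le> K" using Least_le[of "\<lambda>i. c i \<noteq> 0" i0] c(1,2) unfolding a_def by simp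
  define g where "g = (\<Sum>i\<in>{a..K}. Const (c i) * (h0 ^ (i - a) * l ^ (K - i)))"
  have "g * h0 ^ a = (\<Sum>i\<in>{a..K}. Const (c i) * (h0 ^ i * l ^ (K - i)))"
    unfolding g_def sum_distrib_right
  proof (rule sum.cong)
    fix i assume "i \<in> {a..K}"
    then have "h0 ^ i = h0 ^ (i - a) * h0 ^ a" by (simp add: power_add[symmetric])
    then show "Const (c i) * (h0 ^ (i - a) * l ^ (K - i)) * h0 ^ a = Const (c i) * (h0 ^ i * l ^ (K - i))"
      by (simp add: mult_ac)
  qed simp
  also have "\<dots> = (\<Sum>i\<le>K. Const (c i) * (h0 ^ i * l ^ (K - i)))"
    by (rule sum.mono_neutral_left) (use cz in auto)
  finally have gJ: "g * h0 ^ a \<in> J" using c(3) by simp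
  have gf: "is_form (K - a) g" unfolding g_def
  proof (intro is_form_sum is_form_Const_mult)
    fix i assume "i \<in> {a..K}"
    then show "is_form (K - a) (h0 ^ (i - a) * l ^ (K - i))"
      using is_form_mult[OF is_form_power[OF h0(1), of "i - a"] is_form_power[OF l, of "K - i"]] by simp
  qed
  obtain x where x: "x \<noteq> 0" "x \<in> Q" by (rule proj_point[OF Qp]) blast
  have hx: "eval_poly h0 x = 0" using h0(2) x(2) by (auto simp: vanishes_at_def)
  have lx: "eval_poly l x \<noteq> 0" using l_nonvanishing[OF Q] vanishes_at_form[OF Qp x(2,1) l] by blast
  have "eval_poly g x = (\<Sum>i\<in>{a..K}. if i = a then c a * eval_poly l x ^ (K - a) else 0)"
    unfolding g_def eval_sum by (rule sum.cong) (auto simp: hx)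
  then have "eval_poly g x \<noteq> 0" using aK ca lx by simp
  then have gQ: "\<not> vanishes_at g Q" using x(2) by (auto simp: vanishes_at_def)
  show ?thesis
    by (rule that[OF is_form_power[OF h0(1)] not_vanishes_power[OF P h0(1,3)] gf gQ gJ])
qed

text \<open>\<open>h\<close> is the product of the forms that separate \<open>P\<close> from the
  single points of \<open>T\<close>.\<close>

lemma separate_from_finite:
  assumes P: "P \<in> proj_space" and T: "finite T" "T \<subseteq> support" "P \<notin> T"
  shows "\<exists>h n. is_form n h \<and> \<not> vanishes_at h P \<and>
    (\<forall>Q\<in>T. \<exists>g m. is_form m g \<and> \<not> vanishes_at g Q \<and> g * h \<in> J)"
  using T
proof (induction T rule: finite_induct)
  case empty
  obtain x where "x \<in> P" by (rule proj_point[OF P]) blast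
  then show ?case by (intro exI[of _ 1] exI[of _ 0]) (auto simp: vanishes_at_def)
next
  case (insert Q T)
  then obtain h n where h: "is_form n h" "\<not> vanishes_at h P"
    "\<forall>Q\<in>T. \<exists>g m. is_form m g \<and> \<not> vanishes_at g Q \<and> g * h \<in> J" by auto
  have Q: "Q \<in> support" "P \<noteq> Q" using insert.prems by auto
  obtain h' n' g' m' where h': "is_form n' h'" "\<not> vanishes_at h' P" "is_form m' g'" "\<not> vanishes_at g' Q" "g' * h' \<in> J"
    by (rule separate_points[OF P Q])
  have "\<exists>g m. is_form m g \<and> \<not> vanishes_at g Q' \<and> g * (h * h') \<in> J" if "Q' \<in> insert Q T" for Q'
  proof (cases "Q' = Q")
    case True
    have "h * (g' * h') \<in> J" using h'(5) by (rule hideal_mult[OF J])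
    then show ?thesis using h' True by (intro exI[of _ g'] exI[of _ m']) (simp add: mult_ac)
  next
    case False
    then obtain g m where "is_form m g" "\<not> vanishes_at g Q'" "g * h \<in> J" using h(3) \<open>Q' \<in> insert Q T\<close> by blast
    moreover have "(g * h) * h' \<in> J" using \<open>g * h \<in> J\<close> by (rule hideal_mult2[OF J])
    ultimately show ?thesis by (intro exI[of _ g] exI[of _ m]) (simp add: mult_ac)
  qed
  then show ?case
    using is_form_mult[OF h(1) h'(1)] not_vanishes_mult[OF P h(1) h'(1) h(2) h'(2)] by blast
qed

text \<open>
  The strict inclusions of the chains give forms of one common degree that are linearly independent
  modulo \<open>J\<close>: the form of the step \<open>M\<^sub>P\<^sub>,\<^sub>i \<subset> M\<^sub>P\<^sub>,\<^sub>i\<^sub>+\<^sub>1\<close> lies in \<open>J\<close> locally at all points other than \<open>P\<close>.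
\<close>

lemma sum_chain_lengths_le:
  assumes T: "finite T" "T \<subseteq> support"
    and M: "\<And>P. P \<in> T \<Longrightarrow> 0 < n P \<Longrightarrow> is_chain J P (n P) (M P)"
  shows "(\<Sum>P\<in>T. n P) \<le> card B"
proof (rule ccontr)
  assume contr: "\<not> (\<Sum>P\<in>T. n P) \<le> card B"
  define X where "X = (SIGMA P:T. {..<n P})"
  have X: "finite X" "card B < card X"
    using T(1) contr by (simp_all add: X_def)
  have Tp: "P \<in> proj_space" if "P \<in> T" for P using that T(2) support_proj by blast
  have "\<exists>u f g m. u \<in> M P (Suc i) \<and> u \<notin> M P i \<and> u = Fract f g \<and> is_form m f \<and> is_form m g \<and> \<not> vanishes_at g P"
    if Pi: "(P, i) \<in> X" for P i
  proof -
    have "P \<in> T" "i < n P" using Pi by (auto simp: X_def)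
    then have "M P i \<subset> M P (Suc i)" "M P (Suc i) \<subseteq> local_ring P"
      using M[of P] by (auto simp: is_chain_def is_ideal_in_def)
    then obtain u where u: "u \<in> M P (Suc i)" "u \<notin> M P i" "u \<in> local_ring P" by blast
    then show ?thesis unfolding local_ring_def by blast
  qed
  then have "\<forall>x. \<exists>u f g m. x \<in> X \<longrightarrow> u \<in> M (fst x) (Suc (snd x)) \<and> u \<notin> M (fst x) (snd x) \<and> u = Fract f g \<and>
      is_form m f \<and> is_form m g \<and> \<not> vanishes_at g (fst x)"
    by (metis prod.collapse)
  then obtain u f g m where ufg: "\<And>x. x \<in> X \<Longrightarrow> u x \<in> M (fst x) (Suc (snd x)) \<and> u x \<notin> M (fst x) (snd x) \<and>
      u x = Fract (f x) (g x) \<and> is_form (m x) (f x) \<and> is_form (m x) (g x) \<and> \<not> vanishes_at (g x) (fst x)" by metis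
  have "\<exists>h k. P \<in> T \<longrightarrow> is_form k h \<and> \<not> vanishes_at h P \<and>
    (\<forall>Q\<in>T - {P}. \<exists>g m. is_form m g \<and> \<not> vanishes_at g Q \<and> g * h \<in> J)" for P
  proof (cases "P \<in> T")
    case True
    have "finite (T - {P})" "T - {P} \<subseteq> support" "P \<notin> T - {P}" using T by auto
    from separate_from_finite[OF Tp[OF True] this] show ?thesis
      by (elim exE) (intro exI impI, assumption)
  qed blast
  then obtain h k where hk: "\<And>P. P \<in> T \<Longrightarrow> is_form (k P) (h P) \<and> \<not> vanishes_at (h P) P \<and>
    (\<forall>Q\<in>T - {P}. \<exists>g m. is_form m g \<and> \<not> vanishes_at g Q \<and> g * h P \<in> J)" by metis
  define d where "d x = m x + k (fst x)" for x
  define K where "K = t0 + (\<Sum>x\<in>X. d x)"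
  have dK: "d x \<le> K" if "x \<in> X" for x
    using member_le_sum[of x X d] that X(1) by (simp add: K_def)
  have tK: "t0 \<le> K" by (simp only: K_def le_add1)
  \<comment> \<open>The numerator of the step, times a form that is a unit at its own point and lies
    in \<open>J\<close> locally at the others, filled up by powers of \<open>l\<close> to the common
    degree \<open>K\<close>.\<close>
  define e where "e x = f x * h (fst x) * l ^ (K - d x)" for x
  have ef: "is_form K (e x)" if x: "x \<in> X" for x
  proof -
    have "fst x \<in> T" using x by (auto simp: X_def)
    then have "is_form (m x + k (fst x) + (K - d x)) (e x)"
      unfolding e_def using ufg[OF x] hk by (intro is_form_mult is_form_power[OF l]) auto
    then show ?thesis using dK[OF x] by (simp add: d_def)
  qed
  have "\<exists>c. (\<exists>x\<in>X. c x \<noteq> 0) \<and> (\<Sum>x\<in>X. Const (c x) * e x) \<in> J"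
    by (rule forms_dependent_modulo[OF J step B tK X ef])
  then obtain c where c: "\<exists>x\<in>X. c x \<noteq> 0" and sJ: "(\<Sum>x\<in>X. Const (c x) * e x) \<in> J" by blast
  then obtain P i1 where Pi1: "P \<in> T" "i1 < n P" "c (P, i1) \<noteq> 0" by (auto simp: X_def)
  \<comment> \<open>The last step at \<open>P\<close> that the relation involves. Earlier steps at
    \<open>P\<close> lie in \<open>M P i\<close>, later ones have coefficient 0, and terms from
    other points lie in the stalk of \<open>J\<close>; so step \<open>i\<close> itself is forced
    into \<open>M P i\<close>.\<close>
  define i where "i = Max {i. i < n P \<and> c (P, i) \<noteq> 0}"
  have "i \<in> {i. i < n P \<and> c (P, i) \<noteq> 0}" unfolding i_def using Pi1 by (intro Max_in) auto
  then have i: "i < n P" "c (P, i) \<noteq> 0" by auto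
  have imax: "c (P, j) = 0" if "i < j" "j < n P" for j
  proof (rule ccontr)
    assume "c (P, j) \<noteq> 0"
    then have "j \<le> i" unfolding i_def using that by (intro Max_ge) auto
    then show False using that by simp
  qed
  have Pp: "P \<in> proj_space" and PS: "P \<in> support" using Pi1(1) Tp T(2) by auto
  have ch: "is_chain J P (n P) (M P)" using M Pi1 by auto
  then have id: "is_ideal_in (local_ring P) (M P i)" and st: "ideal_stalk J P \<subseteq> M P i"
    using i(1) by (auto simp: is_chain_def)
  have id0: "0 \<in> M P i" and idadd: "\<And>u v. u \<in> M P i \<Longrightarrow> v \<in> M P i \<Longrightarrow> u + v \<in> M P i"
    and idmult: "\<And>a u. a \<in> local_ring P \<Longrightarrow> u \<in> M P i \<Longrightarrow> a * u \<in> M P i"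
    using id by (auto simp: is_ideal_in_def)
  have idsum: "(\<Sum>y\<in>Y. w y) \<in> M P i" if "\<And>y. y \<in> Y \<Longrightarrow> w y \<in> M P i" for Y and w :: "('k, 'v) vec set \<times> nat \<Rightarrow> _"
    using that by (induction Y rule: infinite_finite_induct) (auto intro: id0 idadd)
  have lP: "\<not> vanishes_at (l ^ j) P" for j by (rule not_vanishes_power[OF Pp l l_nonvanishing[OF PS]])
  have l0: "l ^ j \<noteq> 0" for j using lP by (rule not_vanishes_nonzero)
  define \<psi> where "\<psi> x = Fract (Const (c x) * e x) (l ^ K)" for x
  have \<psi>c: "\<psi> x = Fract (Const (c x)) 1 * Fract (e x) (l ^ K)" for x by (simp add: \<psi>_def)
  have total: "(\<Sum>x\<in>X. \<psi> x) \<in> M P i"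
  proof -
    have "(\<Sum>x\<in>X. \<psi> x) = Fract (\<Sum>x\<in>X. Const (c x) * e x) (l ^ K)"
      unfolding \<psi>_def using Fract_sum[OF l0] by metis
    also have "\<dots> \<in> ideal_stalk J P"
    proof (rule ideal_stalkI[OF sJ _ is_form_power[OF l] lP])
      show "is_form K (\<Sum>x\<in>X. Const (c x) * e x)"
        using ef by (intro is_form_sum is_form_Const_mult)
    qed
    finally show ?thesis using st by blast
  qed
  \<comment> \<open>Up to a unit of the local ring, \<open>e (P, j)\<close> divided by
    \<open>l ^ K\<close> is the element \<open>u (P, j)\<close> that witnesses the strict
    inclusion.\<close>
  have quot: "Fract (e (P, j)) (l ^ K) = Fract (g (P, j) * h P * l ^ (K - d (P, j))) (l ^ K) * u (P, j)"
    if "j < n P" for j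
  proof -
    have x: "(P, j) \<in> X" using that Pi1(1) by (simp add: X_def)
    have "g (P, j) \<noteq> 0" using ufg[OF x] not_vanishes_nonzero by auto
    then show ?thesis using ufg[OF x] l0[of K] by (simp add: e_def eq_fract)
  qed
  have unit: "is_form K (g (P, j) * h P * l ^ (K - d (P, j)))"
    "\<not> vanishes_at (g (P, j) * h P * l ^ (K - d (P, j))) P" if "j < n P" for j
  proof -
    have x: "(P, j) \<in> X" using that Pi1(1) by (simp add: X_def)
    have 1: "is_form (m (P, j) + k P) (g (P, j) * h P)" "\<not> vanishes_at (g (P, j) * h P) P"
      using ufg[OF x] hk[OF Pi1(1)] not_vanishes_mult[OF Pp] by (auto intro: is_form_mult)
    show "\<not> vanishes_at (g (P, j) * h P * l ^ (K - d (P, j))) P"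
      by (rule not_vanishes_mult[OF Pp 1(1) is_form_power[OF l] 1(2) lP])
    show "is_form K (g (P, j) * h P * l ^ (K - d (P, j)))"
      using is_form_mult[OF 1(1) is_form_power[OF l, of "K - d (P, j)"]] dK[OF x] by (simp add: d_def)
  qed
  have other: "\<psi> x \<in> M P i" if x: "x \<in> X - {(P, i)}" for x
  proof -
    obtain Q j where Qj: "x = (Q, j)" "Q \<in> T" "j < n Q" using x by (auto simp: X_def)
    have "Fract (e x) (l ^ K) \<in> M P i \<or> c x = 0"
    proof (cases "Q = P")
      case True
      show ?thesis
      proof (cases "j < i")
        case True
        have "u (P, j) \<in> M P (Suc j)" using ufg[of x] x Qj \<open>Q = P\<close> by auto
        then have "u (P, j) \<in> M P i" using chain_mono[OF ch, of "Suc j" i] True i(1) by auto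
        then have "Fract (e (P, j)) (l ^ K) \<in> M P i"
          unfolding quot[OF Qj(3)[unfolded \<open>Q = P\<close>]]
          by (intro idmult local_ringI[OF unit(1) is_form_power[OF l] lP]) (use Qj \<open>Q = P\<close> in auto)
        then show ?thesis using Qj \<open>Q = P\<close> by simp
      next
        case False
        then have "i < j" using x Qj \<open>Q = P\<close> by auto
        then show ?thesis using imax Qj \<open>Q = P\<close> by simp
      qed
    next
      case False
      obtain g' m' where g': "is_form m' g'" "\<not> vanishes_at g' P" "g' * h Q \<in> J"
        using hk[OF Qj(2)] Pi1(1) False by blast
      have "(g' * h Q) * (f x * l ^ (K - d x)) \<in> J" using g'(3) by (rule hideal_mult2[OF J])
      then have eJ: "g' * e x \<in> J" using Qj(1) by (simp add: e_def mult_ac)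
      have "Fract (g' * e x) (g' * l ^ K) \<in> ideal_stalk J P"
      proof (rule ideal_stalkI[OF eJ])
        show "is_form (m' + K) (g' * e x)" using x by (intro is_form_mult[OF g'(1)] ef) simp
        show "is_form (m' + K) (g' * l ^ K)" by (rule is_form_mult[OF g'(1) is_form_power[OF l]])
      qed (rule not_vanishes_mult[OF Pp g'(1) is_form_power[OF l] g'(2) lP])
      moreover have "Fract (g' * e x) (g' * l ^ K) = Fract (e x) (l ^ K)"
        using not_vanishes_nonzero[OF g'(2)] l0 by (simp add: eq_fract)
      ultimately show ?thesis using st by auto
    qed
    then show ?thesis
    proof
      assume "c x = 0"
      moreover have "Fract 0 (l ^ K) = 0" using l0[of K] by (simp add: Zero_fract_def eq_fract)
      ultimately have "\<psi> x = 0" by (simp only: \<psi>_def Const_0 mult_zero_left)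
      then show ?thesis using id0 by simp
    qed (simp only: \<psi>c idmult Const_in_local_ring[OF Pp])
  qed
  have xi: "(P, i) \<in> X" using Pi1(1) i(1) by (simp add: X_def)
  have "\<psi> (P, i) = (\<Sum>x\<in>X. \<psi> x) + Fract (Const (- 1)) 1 * (\<Sum>x\<in>X - {(P, i)}. \<psi> x)"
  proof -
    have "Fract (Const (- 1)) 1 = (- 1 :: ('v, 'k) mpoly fract)" by (simp add: One_fract_def Const_minus)
    then show ?thesis using sum.remove[OF X(1) xi, of \<psi>] by simp
  qed
  also have "\<dots> \<in> M P i"
    by (intro idadd idmult total idsum other Const_in_local_ring[OF Pp])
  finally have "Fract (Const (1 / c (P, i))) 1 * \<psi> (P, i) \<in> M P i"
    by (intro idmult Const_in_local_ring[OF Pp])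
  moreover have "Fract (Const (1 / c (P, i))) 1 * \<psi> (P, i) = Fract (e (P, i)) (l ^ K)"
  proof -
    have "Const (1 / c (P, i)) * (Const (c (P, i)) * e (P, i)) = e (P, i)"
      using i(2) by (simp only: mult.assoc[symmetric] Const_mult[symmetric]) simp
    then show ?thesis by (simp only: \<psi>_def mult_fract mult_1_left)
  qed
  ultimately have eM: "Fract (e (P, i)) (l ^ K) \<in> M P i" by simp
  let ?w = "g (P, i) * h P * l ^ (K - d (P, i))"
  have "Fract (l ^ K) ?w * Fract (e (P, i)) (l ^ K) \<in> M P i"
    by (intro idmult eM local_ringI[OF is_form_power[OF l] unit[OF i(1)]])
  moreover have "Fract (l ^ K) ?w * Fract (e (P, i)) (l ^ K) = u (P, i)"
  proof -
    have "Fract (l ^ K) ?w * Fract ?w (l ^ K) = 1"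
      using l0 not_vanishes_nonzero[OF unit(2)[OF i(1)]] by (simp add: One_fract_def eq_fract mult_ac)
    then show ?thesis unfolding quot[OF i(1)] by (simp only: mult.assoc[symmetric] mult_1_left)
  qed
  ultimately have uM: "u (P, i) \<in> M P i" by (simp only:)
  have "u (P, i) \<notin> M P i" using ufg[OF xi] unfolding fst_conv snd_conv by blast
  then show False using uM by blast
qed

text \<open>Off the support every ideal of a chain is the whole local ring, so these points
  contribute 0. On it chain lengths are bounded, so each local length is 0 or attained by a chain,
  and the joint bound for chains covers all finite partial sums.\<close>

theorem scheme_length_le: "scheme_length J \<le> enat (card B)"
proof -
  let ?q = "\<lambda>P. quotient_length (local_ring P) (ideal_stalk J P)"
  let ?S = "\<lambda>P. {n. \<exists>M. is_chain J P n M}"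
  have q: "?q P = Sup (enat ` ?S P)" for P by (simp add: quotient_length_def is_chain_def)
  have outside: "?q P = 0" if P: "P \<in> proj_space" "P \<notin> support" for P
  proof -
    obtain m f where f: "f \<in> J" "is_form m f" "\<not> vanishes_at f P" using P by (auto simp: support_def)
    have "n = 0" if ch: "is_chain J P n M" for n M
    proof (rule ccontr)
      assume n: "n \<noteq> 0"
      have "local_ring P \<subseteq> M 0" using stalk_outside_support[OF P(1) J f] ch by (auto simp: is_chain_def)
      moreover have "M (Suc 0) \<subseteq> local_ring P" "M 0 \<subset> M (Suc 0)"
        using ch n by (auto simp: is_chain_def is_ideal_in_def)
      ultimately show False by blast
    qed
    then have "?S P \<subseteq> {0}" by blast
    then have "?q P \<le> 0" unfolding q by (intro Sup_least) (auto simp: zero_enat_def)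
    then show ?thesis by simp
  qed
  have inside: "\<exists>n. ?q P = enat n \<and> (0 < n \<longrightarrow> (\<exists>M. is_chain J P n M))" if P: "P \<in> support" for P
  proof (cases "?S P = {}")
    case True
    then have "?q P = enat 0" unfolding q by (simp only: image_empty) (simp add: bot_enat_def zero_enat_def)
    then show ?thesis by blast
  next
    case False
    have "n \<le> card B" if "is_chain J P n M" for n M
      using sum_chain_lengths_le[of "{P}" "\<lambda>_. n" "\<lambda>_. M"] that P by simp
    then have "?S P \<subseteq> {..card B}" by blast
    then have fin: "finite (?S P)" by (rule finite_subset) simp
    have "Sup (enat ` ?S P) = enat (Max (?S P))"
    proof (rule antisym)
      show "Sup (enat ` ?S P) \<le> enat (Max (?S P))"
      proof (rule Sup_least)
        fix x assume "x \<in> enat ` ?S P"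
        then obtain n where "x = enat n" "n \<in> ?S P" by blast
        then show "x \<le> enat (Max (?S P))" using Max_ge[OF fin, of n] by simp
      qed
      show "enat (Max (?S P)) \<le> Sup (enat ` ?S P)"
        using Max_in[OF fin False] by (intro Sup_upper) blast
    qed
    then show ?thesis unfolding q using Max_in[OF fin False] by blast
  qed
  obtain n where n: "\<And>P. P \<in> support \<Longrightarrow> ?q P = enat (n P) \<and> (0 < n P \<longrightarrow> (\<exists>M. is_chain J P (n P) M))"
    using inside by metis
  have "\<forall>P. \<exists>M. P \<in> support \<longrightarrow> 0 < n P \<longrightarrow> is_chain J P (n P) M" using n by blast
  then obtain M where M: "\<And>P. P \<in> support \<Longrightarrow> 0 < n P \<Longrightarrow> is_chain J P (n P) (M P)" by metis
  show ?thesis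
    unfolding scheme_length_def
  proof (rule SUP_least)
    fix T :: "('k, 'v) vec set set" assume T: "T \<in> {T. finite T \<and> T \<subseteq> proj_space}"
    have "(\<Sum>P\<in>T. ?q P) = (\<Sum>P\<in>T \<inter> support. ?q P)"
      by (rule sum.mono_neutral_right) (use T outside in auto)
    also have "\<dots> = (\<Sum>P\<in>T \<inter> support. enat (n P))" by (rule sum.cong) (use n in auto)
    also have "\<dots> = enat (\<Sum>P\<in>T \<inter> support. n P)"
      using of_nat_sum[of n "T \<inter> support", where ?'a = enat] by (simp add: of_nat_eq_enat)
    also have "\<dots> \<le> enat (card B)"
      using sum_chain_lengths_le[of "T \<inter> support" n M] M T by simp
    finally show "(\<Sum>P\<in>T. ?q P) \<le> enat (card B)" .
  qed
qed

end

text \<open>\<open>betti\<close> is a truncated difference, so its vanishing only says that the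
  cycles have at most the dimension of the boundaries. In finite dimension this forces
  equality.\<close>

lemma coord_subspaces_eq:
  fixes C D :: "(nat \<Rightarrow> 'k::field) set"
  assumes D: "coord.subspace D" "D \<subseteq> C" and fin: "finite W" "C \<subseteq> coord.span W"
    and dim: "coord.dim C \<le> coord.dim D"
  shows "C \<subseteq> D"
proof -
  obtain B where B: "B \<subseteq> D" "coord.independent B" "D \<subseteq> coord.span B" "card B = coord.dim D"
    by (rule coord.basis_exists)
  have "B \<subseteq> coord.span W" using B D fin by blast
  then have Bf: "finite B" using coord.independent_span_bound[OF fin(1) B(2)] by blast
  show ?thesis
  proof (rule ccontr)
    assume "\<not> C \<subseteq> D"
    then obtain x where x: "x \<in> C" "x \<notin> D" by blast
    have "coord.span B \<subseteq> D" using B(1) D(1) by (rule coord.span_minimal)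
    then have ind: "coord.independent (insert x B)" using x B(2) by (intro coord.independent_insertI) auto
    obtain B' where B': "insert x B \<subseteq> B'" "B' \<subseteq> C" "coord.independent B'" "C \<subseteq> coord.span B'"
      using coord.maximal_independent_subset_extend[of "insert x B" C] ind x(1) B(1) D(2) by blast
    have "finite B'" using coord.independent_span_bound[OF fin(1) B'(3)] B'(2) fin(2) by blast
    have "x \<notin> B" using x B(1) by blast
    then have "Suc (coord.dim D) = card (insert x B)" using B(4) Bf by simp
    also have "\<dots> \<le> card B'" using B'(1) \<open>finite B'\<close> by (rule card_mono[rotated])
    also have "\<dots> = coord.dim C" using B'(2-4) by (intro coord.basis_card_eq_dim) auto
    finally show False using dim by simp
  qed
qed

lemma (in resolution) betti_zero_imp_acyclic:
  assumes "coord.dim (tensor_cycles F (Suc i) t) \<le> coord.dim (tensor_boundaries F (Suc i) t)"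
  shows "tensor_cycles F (Suc i) t \<subseteq> tensor_boundaries F (Suc i) t"
proof (rule coord_subspaces_eq[OF _ _ _ _ assms])
  let ?j = "Suc i"
  let ?e = "\<lambda>(k::nat) k'. if k' = k then 1 else 0 :: 'k"
  show "finite (?e ` {..<rk F ?j})" by simp
  show "tensor_cycles F ?j t \<subseteq> coord.span (?e ` {..<rk F ?j})"
  proof
    fix u assume u: "u \<in> tensor_cycles F ?j t"
    have uz: "u k = 0" if "\<not> k < rk F ?j" for k
      using u that by (auto simp: tensor_cycles_def tensor_piece_def)
    have "(\<Sum>k<rk F ?j. (\<lambda>k'. u k * ?e k k')) \<in> coord.span (?e ` {..<rk F ?j})"
      by (intro coord.span_sum coord.span_scale coord.span_base) auto
    moreover have "(\<Sum>k<rk F ?j. (\<lambda>k'. u k * ?e k k')) = u"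
    proof
      fix k'
      have "(\<Sum>k<rk F ?j. (\<lambda>k'. u k * ?e k k')) k' = (\<Sum>k<rk F ?j. if k = k' then u k' else 0)"
        unfolding sum_apply by (rule sum.cong) auto
      then show "(\<Sum>k<rk F ?j. (\<lambda>k'. u k * ?e k k')) k' = u k'" using uz by auto
    qed
    ultimately show "u \<in> coord.span (?e ` {..<rk F ?j})" by simp
  qed
  show "coord.subspace (tensor_boundaries F ?j t)"
  proof -
    have add: "tensor_bd F ?j (u + v) = tensor_bd F ?j u + tensor_bd F ?j v" for u v
      by (simp add: tensor_bd_def fun_eq_iff distrib_left sum.distrib)
    have sc: "tensor_bd F ?j (\<lambda>k. c * u k) = (\<lambda>k. c * tensor_bd F ?j u k)" for c u
      by (simp add: tensor_bd_def fun_eq_iff sum_distrib_left mult_ac)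
    show ?thesis
      unfolding coord.subspace_def tensor_boundaries_def
    proof (intro conjI ballI allI)
      show "0 \<in> tensor_bd F ?j ` tensor_piece F (Suc ?j) t"
        by (rule image_eqI[of _ _ 0]) (simp_all add: tensor_bd_def tensor_piece_def fun_eq_iff)
      show "x + y \<in> tensor_bd F ?j ` tensor_piece F (Suc ?j) t"
        if xy: "x \<in> tensor_bd F ?j ` tensor_piece F (Suc ?j) t" "y \<in> tensor_bd F ?j ` tensor_piece F (Suc ?j) t" for x y
      proof -
        obtain u v where uv: "x = tensor_bd F ?j u" "u \<in> tensor_piece F (Suc ?j) t"
          "y = tensor_bd F ?j v" "v \<in> tensor_piece F (Suc ?j) t" using xy by blast
        show ?thesis
        proof (rule image_eqI)
          show "x + y = tensor_bd F ?j (u + v)" unfolding uv add ..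
          show "u + v \<in> tensor_piece F (Suc ?j) t" using uv by (auto simp: tensor_piece_def)
        qed
      qed
      show "(\<lambda>k. c * x k) \<in> tensor_bd F ?j ` tensor_piece F (Suc ?j) t"
        if x: "x \<in> tensor_bd F ?j ` tensor_piece F (Suc ?j) t" for x c
      proof -
        obtain u where u: "x = tensor_bd F ?j u" "u \<in> tensor_piece F (Suc ?j) t" using x by blast
        show ?thesis
        proof (rule image_eqI)
          show "(\<lambda>k. c * x k) = tensor_bd F ?j (\<lambda>k. c * u k)" unfolding u sc ..
          show "(\<lambda>k. c * u k) \<in> tensor_piece F (Suc ?j) t" using u by (auto simp: tensor_piece_def)
        qed
      qed
    qed
  qed
  show "tensor_boundaries F ?j t \<subseteq> tensor_cycles F ?j t"
  proof
    fix w assume "w \<in> tensor_boundaries F ?j t"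
    then obtain v where v: "w = tensor_bd F ?j v" "v \<in> tensor_piece F (Suc ?j) t" by (auto simp: tensor_boundaries_def)
    \<comment> \<open>Lifting to constant polynomials turns a boundary of F \<otimes> k into the
      constant terms of a boundary of \<open>F\<close>; homogeneity gives its degree and
      \<open>bd_bd\<close> the cycle condition.\<close>
    define g where "g k = (Const (v k) :: ('v, 'k) mpoly)" for k
    have g: "g \<in> Fmod (Suc ?j)" using v(2) by (simp add: g_def fmod_def tensor_piece_def)
    have w: "w k = eval_poly (bd F ?j g k) 0" for k
      by (simp add: v(1) bd_def tensor_bd_def g_def eval_at_0[symmetric])
    have gh: "deg_el (Suc ?j) t g"
      unfolding hel_def
    proof (intro allI)
      fix k show "if k < rk F (Suc ?j) \<and> bdeg F (Suc ?j) k \<le> t then is_form (t - bdeg F (Suc ?j) k) (g k) else g k = 0"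
        using v(2) by (cases "k < rk F (Suc ?j) \<and> bdeg F (Suc ?j) k = t") (auto simp: tensor_piece_def g_def)
    qed
    have h: "deg_el ?j t (bd F ?j g)" using gh by (rule bd_hel)
    have "w k = 0" if "\<not> (k < rk F ?j \<and> bdeg F ?j k = t)" for k
      using hel_constant_term[OF h that] by (simp only: w)
    moreover have "tensor_bd F i w k = 0" for k
    proof -
      have "eval_poly (bd F i (bd F ?j g) k) 0 = tensor_bd F i w k"
        by (simp add: bd_def[of F i] tensor_bd_def w eval_at_0[symmetric])
      then show ?thesis using bd_bd[OF g] by simp
    qed
    ultimately show "w \<in> tensor_cycles F ?j t"
      by (auto simp: tensor_cycles_def tensor_piece_def fun_eq_iff)
  qed
qed

text \<open>A nonzero element of the span that lies in \<open>J\<close> is a relation modulo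
  \<open>J\<close>; solving it for some \<open>b\<close> makes that generator redundant. The
  equality case rests on this.\<close>

lemma span_modulo_drop:
  fixes J :: "('v, 'k::field) mpoly set"
  assumes J: "kv.subspace J" and B: "finite B" and s: "s \<in> kv.span B" "s \<in> J" "s \<noteq> 0"
  obtains b where "b \<in> B" "\<And>x. x \<in> kv.span B \<Longrightarrow> \<exists>y\<in>kv.span (B - {b}). x - y \<in> J"
proof -
  obtain c where c: "s = (\<Sum>b\<in>B. Const (c b) * b)" using s(1) unfolding kv.span_finite[OF B] by blast
  obtain b where b: "b \<in> B" "c b \<noteq> 0"
  proof -
    have "\<exists>b\<in>B. c b \<noteq> 0"
    proof (rule ccontr)
      assume "\<not> ?thesis"
      then have "s = 0" unfolding c by (intro sum.neutral) auto
      then show False using s(3) by blast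
    qed
    then show ?thesis using that by blast
  qed
  define r where "r = (\<Sum>b'\<in>B - {b}. Const (c b') * b')"
  have r: "r \<in> kv.span (B - {b})" unfolding r_def by (intro kv.span_sum kv.span_scale kv.span_base) auto
  have sr: "s = Const (c b) * b + r" unfolding c r_def by (rule sum.remove[OF B b(1)])
  show ?thesis
  proof (rule that[OF b(1)])
    fix x assume "x \<in> kv.span B"
    then have "x \<in> kv.span (insert b (B - {b}))" using b(1) by (simp add: insert_absorb)
    then obtain a where a: "x - Const a * b \<in> kv.span (B - {b})" unfolding kv.span_breakdown_eq by blast
    show "\<exists>y\<in>kv.span (B - {b}). x - y \<in> J"
    proof
      show "(x - Const a * b) - Const (a / c b) * r \<in> kv.span (B - {b})"
        by (intro kv.span_diff a kv.span_scale r)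
      have "Const (a / c b) * Const (c b) = (Const a :: ('v, 'k) mpoly)" using b(2) by (simp add: Const_mult[symmetric])
      then have "x - ((x - Const a * b) - Const (a / c b) * r) = Const (a / c b) * s"
        by (simp add: sr distrib_left mult.assoc[symmetric])
      then show "x - ((x - Const a * b) - Const (a / c b) * r) \<in> J" using kv.subspace_scale[OF J s(2)] by metis
    qed
  qed
qed

section \<open>Linear sections\<close>

lemma algebraic_set_Int:
  assumes "algebraic_set A" "algebraic_set B"
  shows "algebraic_set (A \<inter> B)"
proof -
  obtain S T where S: "\<forall>f\<in>S. \<exists>m. is_form m f" "A = zero_locus S"
    and T: "\<forall>f\<in>T. \<exists>m. is_form m f" "B = zero_locus T" using assms unfolding algebraic_set_def by blast
  have "A \<inter> B = zero_locus (S \<union> T)" unfolding S T zero_locus_def by blast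
  then show ?thesis
    unfolding algebraic_set_def by (intro exI[of _ "S \<union> T"] conjI) (use S(1) T(1) in auto)
qed

text \<open>A nonzero vector of \<open>V\<close> spans a projective point inside \<open>V\<close>,
  and any such line covers the origin. For V = {0} there would be no point, and the ideal on the
  left would be everything.\<close>

lemma mem_ideal_of_linear:
  fixes V :: "('k::alg_closed_field ^ 'v::finite) set"
  assumes V: "vec.subspace V" "vec.dim V \<noteq> 0"
  shows "f \<in> ideal_of {P \<in> proj_space. P \<subseteq> V} \<longleftrightarrow> vanishes_at f V"
proof -
  have "f \<in> ideal_of {P \<in> proj_space. P \<subseteq> V} \<longleftrightarrow> (\<forall>P\<in>{P \<in> proj_space. P \<subseteq> V}. vanishes_at f P)"
    by (rule mem_ideal_of) blast
  also have "\<dots> \<longleftrightarrow> vanishes_at f V"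
  proof
    assume f: "\<forall>P\<in>{P \<in> proj_space. P \<subseteq> V}. vanishes_at f P"
    have ex: "eval_poly f y = 0" if "x \<in> V" "x \<noteq> 0" "y \<in> vec.span {x}" for x y
    proof -
      have "vec.span {x} \<subseteq> V" using that(1) V(1) by (intro vec.span_minimal) auto
      then show ?thesis using f span_in_proj_space[OF that(2)] that(3) unfolding vanishes_at_def by blast
    qed
    obtain z where z: "z \<in> V" "z \<noteq> 0" using V(2) vec.dim_eq_0[of V] by (auto simp: subset_iff)
    show "vanishes_at f V"
      unfolding vanishes_at_def
    proof
      fix x assume "x \<in> V"
      then show "eval_poly f x = 0"
        using ex[of x x] ex[OF z vec.span_zero] by (cases "x = 0") (auto intro: vec.span_base)
    qed
  qed (auto simp: vanishes_at_def)
  finally show ?thesis .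
qed

lemma hideal_vanishing_on:
  fixes V :: "('k::alg_closed_field ^ 'v::finite) set"
  assumes "vec.subspace V"
  shows "hideal {f. vanishes_at f V}"
  using hideal_vanishing[of "{V}"] assms by simp

text \<open>A common zero of I_X and I(V) other than the origin would be a point of \<open>X\<close>
  inside \<open>V\<close>, and there is none. So the Nullstellensatz supplies the crude bound
  \<open>s\<close>, which \<open>quotient_degree_bound\<close> sharpens to \<open>d\<close>.\<close>

lemma property_N_generation:
  fixes X :: "('k::alg_closed_field ^ 'v::{finite,linorder}) set set"
  assumes X: "algebraic_set X" and N: "property_N d p X" and p: "p \<noteq> 0"
    and V: "vec.subspace V" "vec.dim V = p" and disjoint: "\<And>P. P \<in> X \<Longrightarrow> \<not> P \<subseteq> V"
    and f: "d \<le> t" "is_form t f"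
  shows "\<exists>a\<in>ideal_of X. \<exists>b. vanishes_at b V \<and> f = a + b"
proof -
  let ?I = "ideal_of X"
  have I: "hideal ?I" by (rule hideal_ideal_of[OF algebraic_set_subset[OF X]])
  have mI: "g \<in> ?I \<longleftrightarrow> (\<forall>P\<in>X. vanishes_at g P)" for g by (rule mem_ideal_of[OF algebraic_set_subset[OF X]])
  \<comment> \<open>The same choice as inside \<open>betti\<close>, so that the Betti numbers speak
    about this resolution.\<close>
  define F where "F = (SOME F. graded_free_resolution F ?I)"
  have res: "graded_free_resolution F ?I"
    unfolding F_def using exists_graded_free_resolution[OF I] by (rule someI_ex)
  interpret resolution F ?I by unfold_locales (rule res)
  obtain i where i: "p = Suc i" using p not0_implies_Suc by blast
  have ac: "tensor_cycles F (Suc i) t \<subseteq> tensor_boundaries F (Suc i) t" if t: "d + p \<le> t" for t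
  proof (rule betti_zero_imp_acyclic)
    have "betti ?I p (t - p) = 0" using N t unfolding property_N_def by simp
    then show "coord.dim (tensor_cycles F (Suc i) t) \<le> coord.dim (tensor_boundaries F (Suc i) t)"
      using t i unfolding betti_def F_def[symmetric] Let_def by simp
  qed
  let ?S = "{a + b | a b. a \<in> ?I \<and> b \<in> {f. vanishes_at f V}}"
  have S: "hideal ?S" by (rule hideal_sum_ideals[OF I hideal_vanishing_on[OF V(1)]])
  have "x = 0" if x: "\<forall>f\<in>?S. eval_poly f x = 0" for x
  proof (rule ccontr)
    assume x0: "x \<noteq> 0"
    have xI: "eval_poly a x = 0" if "a \<in> ?I" for a
    proof -
      have "a + 0 \<in> ?S" using that vanishes_at_0 by blast
      then show ?thesis using x by fastforce
    qed
    have xV: "eval_poly b x = 0" if "vanishes_at b V" for b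
    proof -
      have "0 + b \<in> ?S" using that hideal_0[OF I] by blast
      then show ?thesis using x by fastforce
    qed
    have "x \<in> V"
    proof (rule ccontr)
      assume "x \<notin> V"
      then obtain l where "is_form 1 l" "vanishes_at l V" "eval_poly l x = 1" by (rule exists_linform[OF V(1)])
      then show False using xV by simp
    qed
    then have PV: "vec.span {x} \<subseteq> V" using V(1) by (intro vec.span_minimal) auto
    have Pp: "vec.span {x} \<in> proj_space" by (rule span_in_proj_space[OF x0])
    have xP: "x \<in> vec.span {x}" by (rule vec.span_base) simp
    obtain T where T: "\<forall>f\<in>T. \<exists>m. is_form m f" "X = zero_locus T" using X unfolding algebraic_set_def by blast
    have "vanishes_at g (vec.span {x})" if g: "g \<in> T" for g
    proof -
      obtain m where m: "is_form m g" using T(1) g by blast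
      have "g \<in> ?I" unfolding mI using g unfolding T(2) zero_locus_def by blast
      then show ?thesis using vanishes_at_form[OF Pp xP x0 m] xI by blast
    qed
    then have "vec.span {x} \<in> X" unfolding T(2) zero_locus_def using Pp by blast
    then show False using disjoint PV by blast
  qed
  then obtain s where s: "\<forall>t\<ge>s. \<forall>f. is_form t f \<longrightarrow> f \<in> ?S" using projective_nullstellensatz[OF S] by blast
  show ?thesis
  proof (rule quotient_degree_bound[OF V _ _ f])
    show "\<exists>a\<in>?I. \<exists>b. vanishes_at b V \<and> f = a + b" if "s \<le> t" "is_form t f" for t f
      using s that by blast
    show "u \<in> bnd {0} p" if "d + p \<le> t" "u \<in> cyc {0} p" "deg_el p t u" for t u
      using tensor_acyclic_imp_bnd[OF ac[OF that(1)]] that(2,3) i by simp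
  qed
qed

theorem theorem3p1:
  fixes X L :: "('k::alg_closed_field ^ 'v::{finite,linorder}) set set"
    and n e d p :: nat
  assumes "CARD('v) = n + e + 1"
    and "algebraic_set X"
    and "nondegenerate X"
    and "has_dimension X n"
    and "d \<ge> 2" and "1 \<le> p" and "p \<le> e"
    and "property_N d p X"
    and "linear_subspace p L"
    and "has_dimension (L \<inter> X) 0"
  shows "scheme_length (intersection_ideal L X) \<le> enat ((d - 1 + p) choose p) \<and>
    (scheme_length (intersection_ideal L X) = enat ((d - 1 + p) choose p) \<longrightarrow>
       (\<forall>k. 1 \<le> k \<and> k \<le> d - 1 \<longrightarrow> L \<subseteq> base_locus X k))"
proof -
  note X = assms(2)
  let ?I = "ideal_of X" and ?J = "intersection_ideal L X" and ?t0 = "d - 1"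
  obtain V where V: "vec.subspace V" "vec.dim V = p + 1" "L = {P \<in> proj_space. P \<subseteq> V}"
    using assms(9) unfolding linear_subspace_def by blast
  have I: "hideal ?I" by (rule hideal_ideal_of[OF algebraic_set_subset[OF X]])
  have mI: "g \<in> ?I \<longleftrightarrow> (\<forall>P\<in>X. vanishes_at g P)" for g by (rule mem_ideal_of[OF algebraic_set_subset[OF X]])
  have L: "f \<in> ideal_of L \<longleftrightarrow> vanishes_at f V" for f
    unfolding V(3) using V by (intro mem_ideal_of_linear) auto
  have iL: "hideal (ideal_of L)" by (rule hideal_ideal_of) (auto simp: V(3))
  have J: "hideal ?J" unfolding intersection_ideal_def by (rule hideal_sum_ideals[OF iL I])
  have JI: "a + b \<in> ?J" if "vanishes_at a V" "b \<in> ?I" for a b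
    using that L unfolding intersection_ideal_def by blast
  have aLX: "algebraic_set (L \<inter> X)"
    unfolding V(3) by (intro algebraic_set_Int algebraic_linear V(1) X)
  have fin: "finite (L \<inter> X)" by (rule finite_of_dimension_0[OF aLX assms(10)])
  obtain l where l: "is_form 1 l" "\<And>P. P \<in> L \<inter> X \<Longrightarrow> \<not> vanishes_at l P"
    using linear_form_avoiding_points[OF fin algebraic_set_subset[OF aLX]] by blast
  \<comment> \<open>\<open>has_dimension\<close> excludes the empty set, so
    \<open>L \<inter> X\<close> has a point, and \<open>l\<close> does not vanish there.\<close>
  have "\<exists>v\<in>V. eval_poly l v \<noteq> 0"
  proof -
    obtain C where "irreducible_chain (L \<inter> X) 0 C" using assms(10) unfolding has_dimension_def by blast
    then have "C 0 \<noteq> {}" "C 0 \<subseteq> L \<inter> X" by (auto simp: irreducible_chain_def irreducible_set_def)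
    then obtain P where "P \<in> L \<inter> X" by blast
    then show ?thesis using l(2)[of P] V(3) unfolding vanishes_at_def by blast
  qed
  then obtain v0 where v0: "v0 \<in> V" "eval_poly l v0 \<noteq> 0" by blast
  define v where "v = (1 / eval_poly l v0) *s v0"
  have v: "v \<in> V" "eval_poly l v = 1"
    using v0 V(1) by (simp_all add: v_def vec.subspace_scale linform_scale[OF l(1)])
  let ?W = "ker_on V l"
  have W: "vec.subspace ?W" "vec.dim ?W = p"
    using subspace_ker_on[OF V(1) l(1)] dim_ker_on[OF V(1) l(1) v0] V(2) by auto
  have disj: "\<not> P \<subseteq> ?W" if "P \<in> X" for P
  proof
    assume P: "P \<subseteq> ?W"
    have "P \<in> L" using P that algebraic_set_subset[OF X] V(3) by blast
    then have "\<not> vanishes_at l P" using l(2) that by blast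
    then show False using P unfolding vanishes_at_def by blast
  qed
  have step: "\<exists>g. is_form t g \<and> f - l * g \<in> ?J" if t: "?t0 \<le> t" and f: "is_form (Suc t) f" for t f
  proof -
    \<comment> \<open>This makes \<open>d - 1\<close> the starting degree: forms of degree
      \<open>t + 1 \<ge> d\<close> lie in I_X + I(W), and the part vanishing on W is a multiple of
      \<open>l\<close> modulo I(V).\<close>
    have "d \<le> Suc t" using t by simp
    then obtain a b where ab: "a \<in> ?I" "vanishes_at b ?W" "f = a + b"
      using property_N_generation[OF X assms(8) _ W disj _ f] assms(6) by auto
    obtain g where g: "vanishes_at (b - l * g) V" by (rule vanishes_on_hyperplane[OF V(1) l(1) v ab(2)])
    have "(b - l * g) + a \<in> ?J" using JI g ab(1) by blast
    then have "hcomp (Suc t) (f - l * g) \<in> ?J" using hideal_hcomp[OF J] by (simp add: ab(3) algebra_simps)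
    then have "f - l * hcomp t g \<in> ?J"
      using f by (simp add: hcomp_diff hcomp_form hcomp_mult_form[OF l(1)])
    then show ?thesis using is_form_hcomp by blast
  qed
  obtain B where B: "finite B" "card B \<le> (?t0 + (p + 1) - 1) choose ?t0" "\<forall>b\<in>B. is_form ?t0 b"
    "\<forall>f. is_form ?t0 f \<longrightarrow> (\<exists>s\<in>kv.span B. vanishes_at (f - s) V)"
    using forms_on_subspace_spanned[OF V(1,2), of ?t0] by (elim exE conjE)
  have "(?t0 + (p + 1) - 1) choose ?t0 = (d - 1 + p) choose p"
    using binomial_symmetric[of ?t0 "?t0 + p"] by simp
  then have cB: "card B \<le> (d - 1 + p) choose p" using B(2) by simp
  have BJ: "\<exists>s\<in>kv.span B. f - s \<in> ?J" if f: "is_form ?t0 f" for f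
  proof -
    obtain s where "s \<in> kv.span B" "vanishes_at (f - s) V" using B(4) f by blast
    then show ?thesis using JI[OF _ hideal_0[OF I], of "f - s"] by auto
  qed
  have "scheme_length ?J \<le> enat (card B)" by (rule scheme_length_le[OF J l(1) step B(1) BJ])
  then have a: "scheme_length ?J \<le> enat ((d - 1 + p) choose p)"
    using cB by (meson enat_ord_simps(1) order_trans)
  have b: "L \<subseteq> base_locus X k"
    if eq: "scheme_length ?J = enat ((d - 1 + p) choose p)" and k: "1 \<le> k" "k \<le> d - 1" for k
  proof -
    \<comment> \<open>A form of \<open>J\<close> that does not vanish on \<open>V\<close> would give
      a nonzero relation modulo \<open>J\<close> among the elements of \<open>B\<close>, so that
      fewer elements span degree \<open>d - 1\<close> and the length is smaller than
      assumed.\<close>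
    have JV: "vanishes_at f V" if f: "is_form ?t0 f" "f \<in> ?J" for f
    proof (rule ccontr)
      assume nv: "\<not> vanishes_at f V"
      obtain s where s: "s \<in> kv.span B" "vanishes_at (f - s) V" using B(4) f(1) by blast
      have "s = f - (f - s)" by simp
      moreover have "f - s \<in> ?J" using JI[OF s(2) hideal_0[OF I]] by simp
      ultimately have sJ: "s \<in> ?J" using hideal_diff[OF J f(2)] by metis
      have s0: "s \<noteq> 0" using s(2) nv by auto
      obtain b where b: "b \<in> B" "\<And>x. x \<in> kv.span B \<Longrightarrow> \<exists>y\<in>kv.span (B - {b}). x - y \<in> ?J"
        using span_modulo_drop[OF subspace_hideal[OF J] B(1) s(1) sJ s0] by metis
      have BJ': "\<exists>y\<in>kv.span (B - {b}). g - y \<in> ?J" if g: "is_form ?t0 g" for g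
      proof -
        obtain s' where s': "s' \<in> kv.span B" "g - s' \<in> ?J" using BJ g by blast
        obtain y where y: "y \<in> kv.span (B - {b})" "s' - y \<in> ?J" using b(2) s'(1) by blast
        have "(g - s') + (s' - y) \<in> ?J" using s'(2) y(2) by (rule hideal_add[OF J])
        then show ?thesis using y(1) by auto
      qed
      have "scheme_length ?J \<le> enat (card (B - {b}))"
        by (rule scheme_length_le[OF J l(1) step _ BJ']) (use B(1) in auto)
      moreover have "card (B - {b}) < card B" using B(1) b(1) by (rule card_Diff1_less)
      ultimately have "scheme_length ?J < enat ((d - 1 + p) choose p)"
        using cB by (meson enat_ord_simps(2) le_less_trans less_le_trans)
      then show False using eq by simp
    qed
    show ?thesis
    proof
      fix P assume P: "P \<in> L"
      have "vanishes_at f P" if f: "f \<in> ideal_forms X k" for f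
      proof -
        have fk: "is_form k f" "\<forall>P\<in>X. vanishes_at f P" using f by (auto simp: ideal_forms_def)
        have "f \<in> ?I" using fk(2) mI by blast
        \<comment> \<open>Multiplication by a power of \<open>l\<close> brings \<open>f\<close> to
          degree \<open>d - 1\<close>, where \<open>JV\<close> applies; the power is cancelled
          afterwards.\<close>
        then have "0 + l ^ (?t0 - k) * f \<in> ?J" by (intro JI vanishes_at_0 hideal_mult[OF I])
        moreover have "is_form ?t0 (l ^ (?t0 - k) * f)"
          using is_form_mult[OF is_form_power[OF l(1), of "?t0 - k"] fk(1)] le_add_diff_inverse2[OF k(2)] by metis
        ultimately have "vanishes_at (l ^ (?t0 - k) * f) V" using JV by simp
        moreover have "vanishes_at f V" if "vanishes_at (l ^ j * f) V" for j
          using that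
        proof (induction j)
          case (Suc j)
          then have "vanishes_at (l * (l ^ j * f)) V" by (simp add: mult.assoc)
          then show ?case using Suc.IH vanishes_at_cancel[OF V(1) l(1) v0] by blast
        qed simp
        ultimately have "vanishes_at f V" by blast
        then show ?thesis using P V(3) unfolding vanishes_at_def by blast
      qed
      then show "P \<in> base_locus X k" using P V(3) unfolding base_locus_def zero_locus_def by blast
    qed
  qed
  show ?thesis using a b by blast
qed

end
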